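(* Let $b\ge1$ and $0<\alpha<1$. In the infinite Poisson model, let $\widehat B_\alpha$ be the length of the block containing bucket $0$. Then $$\Pr(\widehat B_\alpha=k)=\frac{k\Pr(B_\alpha=k)}{\mathbb E\,B_\alpha}=T_0(b\alpha)\,k\Pr(B_\alpha=k),\qquad k\ge1,$$ and hence its probability generating function is $$\psi_{\widehat B}(q)=T_0(b\alpha)\,q\,\psi_B'(q)=T_0(b\alpha)\,q\sum_{\ell=0}^{b-1}\zeta_\ell'(q)\prod_{j\ne\ell}(1-\zeta_j(q)).$$ Moreover, in the exact model, as $m,n\to\infty$ with $n/(bm)\to\alpha$, $\widehat B_{m,n}\to\widehat B_\alpha$ in distribution with convergence of all moments, and for some $\delta>0$ the probability generating function of $\widehat B_{m,n}$ converges to $\psi_{\widehat B}(q)$ uniformly for $|q|\le1+\delta$.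
   Context: $T(z)=\sum_{n\ge1}n^{n-1}z^n/n!$, $\omega=e^{2\pi i/b}$; for $|q|\le(e^{\alpha-1}/\alpha)^b$, $\zeta_\ell(q)=T(\omega^\ell\alpha e^{-\alpha}q^{1/b})/\alpha$ (fixed choice of $q^{1/b}$; symmetric expressions do not depend on it), $\zeta_\ell=\zeta_\ell(1)$ with $1^{1/b}=1$, $T_0(b\alpha)=b(1-\alpha)/\prod_{\ell=1}^{b-1}(1-\zeta_\ell)$. $B_\alpha=\min\{i\ge1:X_1+\dots+X_i<bi\}$ with $X_i$ i.i.d. Poisson($\alpha b$), and $\psi_B(q)=\mathbb E\,q^{B_\alpha}$. Infinite Poisson model: buckets $i\in\mathbb Z$ of capacity $b$, $X_i$ i.i.d. Poisson($\alpha b$) keys hash to bucket $i$; $H_i=b+\max_{j<i}\sum_{k=j+1}^i(X_k-b)$; bucket $i$ is full iff $H_i\ge b$. A block is a maximal run of consecutive full buckets followed by a non-full bucket. Exact model: $m$ cyclically arranged buckets of capacity $b$, $n<bm$ keys with independent uniform hash addresses, linear probing with wrap-around; $\widehat B_{m,n}$ is the length of the block containing a given bucket. *)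

theory Defs
  imports "HOL-Probability.Probability" "HOL-Complex_Analysis.Complex_Analysis"
begin

section \<open>The tree function and its branches\<close>

text \<open>The series starts at $n = 1$; the index is shifted by one because the term
  $n^{n-1}z^n/n!$ would be $1$ rather than $0$ at $n = 0$ with truncated subtraction.\<close>

definition tree_fun :: "complex \<Rightarrow> complex" where
  "tree_fun z = (\<Sum>n. of_nat (Suc n) ^ n * z ^ Suc n / fact (Suc n))"

definition root_unity :: "nat \<Rightarrow> complex" where
  "root_unity b = exp (2 * of_real pi * \<i> / of_nat b)"

text \<open>The last argument is the chosen value $w$ of $q^{1/b}$, so that $\zeta_\ell(q)$ is
  \<open>zeta_br b \<alpha> l (\<rho> q)\<close> for a branch \<open>\<rho>\<close> of the $b$-th root, and
  $\zeta_\ell = \zeta_\ell(1)$ is \<open>zeta_br b \<alpha> l 1\<close>.\<close>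

definition zeta_br :: "nat \<Rightarrow> real \<Rightarrow> nat \<Rightarrow> complex \<Rightarrow> complex" where
  "zeta_br b \<alpha> l w =
     tree_fun (root_unity b ^ l * of_real (\<alpha> * exp (- \<alpha>)) * w) / of_real \<alpha>"

definition T0 :: "nat \<Rightarrow> real \<Rightarrow> complex" where
  "T0 b \<alpha> = of_nat b * (1 - of_real \<alpha>) / (\<Prod>l=1..b-1. 1 - zeta_br b \<alpha> l 1)"

definition pgf_radius :: "nat \<Rightarrow> real \<Rightarrow> real" where
  "pgf_radius b \<alpha> = (exp (\<alpha> - 1) / \<alpha>) ^ b"


section \<open>Probabilistic notions\<close>

definition iid_poisson :: "'a measure \<Rightarrow> 'i set \<Rightarrow> ('i \<Rightarrow> 'a \<Rightarrow> nat) \<Rightarrow> real \<Rightarrow> bool" where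
  "iid_poisson M I X r \<longleftrightarrow>
     prob_space M \<and>
     prob_space.indep_vars M (\<lambda>_. count_space UNIV) X I \<and>
     (\<forall>i\<in>I. distr M (count_space UNIV) (X i) = measure_pmf (poisson_pmf r))"

definition pgf :: "'a measure \<Rightarrow> ('a \<Rightarrow> nat) \<Rightarrow> complex \<Rightarrow> complex" where
  "pgf M Z q = (\<integral>x. q ^ Z x \<partial>M)"

text \<open>For a sequence $x_1, x_2, \dots$ (the entry with index $0$ is not used). If the set is
  empty (probability $0$ for i.i.d. Poisson variables of mean less than $b$), the value is an
  unspecified constant.\<close>

definition first_below :: "nat \<Rightarrow> (nat \<Rightarrow> nat) \<Rightarrow> nat" where
  "first_below b x = (LEAST i. 1 \<le> i \<and> (\<Sum>j=1..i. x j) < b * i)"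


section \<open>Blocks\<close>

text \<open>The buckets \<open>s, \<dots>, e\<close> form a block: a maximal run of full buckets, possibly empty,
  together with the non-full bucket \<open>e\<close> following it.\<close>

definition is_block :: "(int \<Rightarrow> bool) \<Rightarrow> int \<Rightarrow> int \<Rightarrow> bool" where
  "is_block full s e \<longleftrightarrow>
     s \<le> e \<and> (\<forall>i\<in>{s..<e}. full i) \<and> \<not> full e \<and> \<not> full (s - 1)"

text \<open>There is at most one block containing \<open>i\<close>; the union is empty if there is none.\<close>

definition block_at :: "(int \<Rightarrow> bool) \<Rightarrow> int \<Rightarrow> int set" where
  "block_at full i = \<Union>{{s..e} | s e. is_block full s e \<and> i \<in> {s..e}}"

definition block_length :: "(int \<Rightarrow> bool) \<Rightarrow> int \<Rightarrow> nat" where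
  "block_length full i = card (block_at full i)"


section \<open>The infinite model\<close>

text \<open>For the Poisson model with load less than \<open>b\<close> per bucket the set is almost surely
  bounded above; being a nonempty set of integers, its supremum is then its maximum.\<close>

definition infinite_H :: "nat \<Rightarrow> (int \<Rightarrow> nat) \<Rightarrow> int \<Rightarrow> int" where
  "infinite_H b x i = int b + (SUP j\<in>{..<i}. \<Sum>k\<in>{j+1..i}. int (x k) - int b)"

definition infinite_full :: "nat \<Rightarrow> (int \<Rightarrow> nat) \<Rightarrow> int \<Rightarrow> bool" where
  "infinite_full b x i \<longleftrightarrow> infinite_H b x i \<ge> int b"


section \<open>The exact model\<close>

text \<open>A key with hash address \<open>a\<close> is stored in the first bucket among
  \<open>a, a + 1, a + 2, \<dots>\<close> (modulo \<open>m\<close>) that holds fewer than \<open>b\<close> keys; the table content \<open>c\<close>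
  is recorded as the number of keys in each of the buckets \<open>0, \<dots>, m - 1\<close>.\<close>

definition probe :: "nat \<Rightarrow> nat \<Rightarrow> (nat \<Rightarrow> nat) \<Rightarrow> nat \<Rightarrow> nat" where
  "probe b m c a = (a + (LEAST d. c ((a + d) mod m) < b)) mod m"

definition insert_key :: "nat \<Rightarrow> nat \<Rightarrow> nat \<Rightarrow> (nat \<Rightarrow> nat) \<Rightarrow> (nat \<Rightarrow> nat)" where
  "insert_key b m a c = (let p = probe b m c a in c(p := Suc (c p)))"

definition hash_table :: "nat \<Rightarrow> nat \<Rightarrow> nat list \<Rightarrow> nat \<Rightarrow> nat" where
  "hash_table b m as = fold (insert_key b m) as (\<lambda>_. 0)"

text \<open>The cyclic arrangement is unrolled to a periodic pattern on the integers. If some bucket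
  is not full, then blocks of the periodic pattern have length at most \<open>m\<close> and project
  bijectively to the blocks on the cycle.\<close>

definition exact_full :: "nat \<Rightarrow> nat \<Rightarrow> nat list \<Rightarrow> int \<Rightarrow> bool" where
  "exact_full b m as i \<longleftrightarrow> hash_table b m as (nat (i mod int m)) = b"

definition hash_addresses :: "nat \<Rightarrow> nat \<Rightarrow> nat list pmf" where
  "hash_addresses m n = replicate_pmf n (pmf_of_set {..<m})"

end

theory Submission
  imports Defs "HOL-Real_Asymp.Real_Asymp"
begin

text \<open>Call a bucket full if some window of buckets ending there received at least \<open>b\<close> keys per
  bucket on average; this describes both models. A block starts behind a non-full bucket and ends at the
  first passage below 0 of the walk \<open>X\<^sub>1 + \<dots> + X\<^sub>i - b i\<close>, so independence of the two sides gives
  \<open>P(length = k) = k p P(B = k)\<close>, with \<open>p\<close> the probability that a bucket is not full.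
  Long windows are exponentially unlikely to be overfull, uniformly in both models, so every block event
  is approximated by an event depending on finitely many buckets, where multinomial counts converge to
  independent Poisson variables. The same bounds are summable majorants for all the limits claimed,
  and since the exact block lengths are never 0 or infinite they also give \<open>p E B = 1\<close>.
  The generating function of \<open>B\<close> comes from the kernel method: for \<open>|q| < 1\<close> the numbers \<open>\<zeta>\<^sub>l(q)\<close> are the
  roots in the closed unit disk of \<open>z\<^sup>b = q E z\<^sup>X\<close>, hence of a monic polynomial of degree \<open>b\<close> whose value at 1 is
  \<open>1 - E q\<^sup>B\<close>.\<close>

section \<open>Blocks and windows\<close>

text \<open>Fullness is a property of the two-sided walk with increments \<open>x i - b\<close>:
  bucket i is not full exactly when the walk stands strictly below its whole past. Blocks are the
  stretches between consecutive strict record lows. A block therefore splits into a condition on the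
  buckets left of its start and a first passage on its own buckets. Only the left condition looks
  infinitely far, so it alone has to be truncated. Finite events are written as predicates on lists,
  because the three probability spaces (the two-sided family, the one-sided family and the random
  addresses) can be compared only through laws of lists. The constant p is accordingly a limit of
  list probabilities. The obstacle is that the kernel method says nothing about p, and that bucket 0
  might a priori lie in no block of the infinite model, where the length takes its default 0. Only
  the total mass of the limit law excludes this, and only then is \<open>T0\<close> known to be real
  and nonzero.\<close>

definition window_sum :: "(int \<Rightarrow> nat) \<Rightarrow> int \<Rightarrow> nat \<Rightarrow> nat" where
  "window_sum x i l = (\<Sum>t<l. x (i - int t))"

definition window_full :: "nat \<Rightarrow> (int \<Rightarrow> nat) \<Rightarrow> int \<Rightarrow> bool" where
  "window_full b x i \<longleftrightarrow> (\<exists>l\<ge>1. b * l \<le> window_sum x i l)"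

text \<open>Both lists read away from the boundary behind a block: windows ending at the boundary
  and partial sums of the block become prefixes, and the two lists use disjoint buckets.\<close>

definition left_list :: "(int \<Rightarrow> nat) \<Rightarrow> int \<Rightarrow> nat \<Rightarrow> nat list" where
  "left_list x i K = map (\<lambda>t. x (i - int t)) [0..<K]"

definition right_list :: "(int \<Rightarrow> nat) \<Rightarrow> int \<Rightarrow> nat \<Rightarrow> nat list" where
  "right_list x s k = map (\<lambda>t. x (s + int t)) [0..<k]"

definition stays_below :: "nat \<Rightarrow> nat list \<Rightarrow> bool" where
  "stays_below b ys \<longleftrightarrow> (\<forall>l\<in>{1..length ys}. sum_list (take l ys) < b * l)"

definition first_pass :: "nat \<Rightarrow> nat list \<Rightarrow> bool" where
  "first_pass b zs \<longleftrightarrow> zs \<noteq> [] \<and> sum_list zs < b * length zs \<and>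
     (\<forall>l<length zs. b * l \<le> sum_list (take l zs))"

lemma length_left_list [simp]: "length (left_list x i K) = K"
  by (simp add: left_list_def)

lemma length_right_list [simp]: "length (right_list x s k) = k"
  by (simp add: right_list_def)

lemma sum_list_map_upt: "sum_list (map f [0..<n]) = (\<Sum>t<n. f t)"
  by (simp add: interv_sum_list_conv_sum_set_nat atLeast0LessThan)

lemma sum_list_take_left_list: "l \<le> K \<Longrightarrow> sum_list (take l (left_list x i K)) = window_sum x i l"
  by (simp add: left_list_def window_sum_def take_map sum_list_map_upt)

lemma sum_list_take_right_list: "l \<le> k \<Longrightarrow> sum_list (take l (right_list x s k)) = (\<Sum>t<l. x (s + int t))"
  by (simp add: right_list_def take_map sum_list_map_upt)

lemma stays_below_left_list:
  "stays_below b (left_list x i K) \<longleftrightarrow> (\<forall>l\<in>{1..K}. window_sum x i l < b * l)"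
  by (auto simp: stays_below_def sum_list_take_left_list)

lemma first_pass_right_list:
  "first_pass b (right_list x s k) \<longleftrightarrow> k \<ge> 1 \<and> (\<Sum>t<k. x (s + int t)) < b * k \<and>
     (\<forall>l<k. b * l \<le> (\<Sum>t<l. x (s + int t)))"
proof -
  have "sum_list (right_list x s k) = (\<Sum>t<k. x (s + int t))"
    using sum_list_take_right_list[of k k x s] by simp
  moreover have "right_list x s k \<noteq> [] \<longleftrightarrow> k \<ge> 1"
    by (auto simp: right_list_def)
  moreover have "(\<forall>l<k. b * l \<le> sum_list (take l (right_list x s k))) \<longleftrightarrow>
      (\<forall>l<k. b * l \<le> (\<Sum>t<l. x (s + int t)))"
    by (simp add: sum_list_take_right_list)
  ultimately show ?thesis by (simp add: first_pass_def)
qed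

section \<open>The walk of surplus keys and its record lows\<close>

definition potential :: "nat \<Rightarrow> (int \<Rightarrow> nat) \<Rightarrow> int \<Rightarrow> int" where
  "potential b x i = (if i \<ge> 0 then (\<Sum>t<nat i. int (x (1 + int t)) - int b)
     else - (\<Sum>t<nat (- i). int (x (- int t)) - int b))"

lemma potential_step: "potential b x i = potential b x (i - 1) + int (x i) - int b"
proof -
  consider "i \<ge> 1" | "i \<le> 0" by linarith
  then show ?thesis
  proof cases
    case 1
    then have "nat i = Suc (nat (i - 1))" by auto
    with 1 show ?thesis by (simp add: potential_def del: sum_constant)
  next
    case 2
    then have "nat (- (i - 1)) = Suc (nat (- i))" by auto
    with 2 show ?thesis by (cases "i = 0") (simp_all add: potential_def del: sum_constant)
  qed
qed

lemma window_sum_potential: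
  "int (window_sum x i l) - int (b * l) = potential b x i - potential b x (i - int l)"
proof (induction l)
  case (Suc l)
  show ?case
    using Suc potential_step[of b x "i - int l"]
    by (simp add: window_sum_def algebra_simps)
qed (simp add: window_sum_def)

lemma forward_sum_potential:
  "int (\<Sum>t<l. x (s + int t)) - int (b * l) = potential b x (s - 1 + int l) - potential b x (s - 1)"
proof (induction l)
  case (Suc l)
  show ?case
    using Suc potential_step[of b x "s + int l"]
    by (simp add: algebra_simps)
qed simp

text \<open>The surplus of a window is a difference of two values of the walk. Negated, this says
  that a non-full bucket is a strict record low, which turns the block structure into a question of
  order alone.\<close>

lemma window_full_potential:
  "window_full b x i \<longleftrightarrow> (\<exists>j<i. potential b x j \<le> potential b x i)"
proof
  assume "window_full b x i"
  then obtain l where "l \<ge> 1" "b * l \<le> window_sum x i l" by (auto simp: window_full_def)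
  then show "\<exists>j<i. potential b x j \<le> potential b x i"
    using window_sum_potential[of x i l b]
    by (intro exI[of _ "i - int l"]) (auto simp del: of_nat_mult)
next
  assume "\<exists>j<i. potential b x j \<le> potential b x i"
  then obtain j where j: "j < i" "potential b x j \<le> potential b x i" by auto
  define l where "l = nat (i - j)"
  have "j = i - int l" "l \<ge> 1" using j by (auto simp: l_def)
  with j show "window_full b x i"
    using window_sum_potential[of x i l b]
    by (auto simp: window_full_def simp del: of_nat_mult intro!: exI[of _ l])
qed

text \<open>After the record low at \<open>s - 1\<close>, the next strict record low is the first
  later value below it; every bucket in between has \<open>s - 1\<close> itself as a witness of
  fullness.\<close>

lemma is_block_window_full:
  assumes "k \<ge> 1"
  shows "is_block (window_full b x) s (s + int k - 1) \<longleftrightarrow>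
    \<not> window_full b x (s - 1) \<and> first_pass b (right_list x s k)"
proof -
  let ?W = "potential b x"
  have fp: "first_pass b (right_list x s k) \<longleftrightarrow>
    ?W (s + int k - 1) < ?W (s - 1) \<and> (\<forall>i\<in>{s..<s + int k - 1}. ?W (s - 1) \<le> ?W i)"
  proof -
    have "(\<Sum>t<k. x (s + int t)) < b * k \<longleftrightarrow> ?W (s + int k - 1) < ?W (s - 1)"
      using forward_sum_potential[where l=k and x=x and s=s and b=b]
        by (simp add: algebra_simps del: of_nat_mult of_nat_sum) linarith
    moreover have "(\<forall>l<k. b * l \<le> (\<Sum>t<l. x (s + int t))) \<longleftrightarrow>
      (\<forall>i\<in>{s..<s + int k - 1}. ?W (s - 1) \<le> ?W i)" (is "?L \<longleftrightarrow> ?R")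
    proof
      assume L: ?L
      show ?R
      proof
        fix i assume i: "i \<in> {s..<s + int k - 1}"
        define l where "l = nat (i - s + 1)"
        have "l < k" "i = s - 1 + int l" using i by (auto simp: l_def)
        with L show "?W (s - 1) \<le> ?W i"
          using forward_sum_potential[where l=l and x=x and s=s and b=b]
            by (force simp del: of_nat_mult of_nat_sum)
      qed
    next
      assume R: ?R
      show ?L
      proof (intro allI impI)
        fix l assume l: "l < k"
        have "?W (s - 1) \<le> ?W (s - 1 + int l)"
          using R l by (cases "l = 0") auto
        then show "b * l \<le> (\<Sum>t<l. x (s + int t))"
          using forward_sum_potential[where l=l and x=x and s=s and b=b]
            by (simp del: of_nat_mult of_nat_sum)
      qed
    qed
    ultimately show ?thesis using assms by (simp add: first_pass_right_list)
  qed
  show ?thesis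
  proof
    assume B: "is_block (window_full b x) s (s + int k - 1)"
    then have nf: "\<not> window_full b x (s - 1)" "\<not> window_full b x (s + int k - 1)"
      and f: "\<And>i. i \<in> {s..<s + int k - 1} \<Longrightarrow> window_full b x i"
      by (auto simp: is_block_def)
    \<comment> \<open>A witness j of fullness lies further left at no higher level. Inside the block
      the induction hypothesis applies to it; left of the block it is bounded below by the record
      low at \<open>s - 1\<close>.\<close>
    have ge: "?W (s - 1) \<le> ?W (s + int n)" if "s + int n < s + int k - 1" for n
      using that
    proof (induction n rule: less_induct)
      case (less n)
      have "window_full b x (s + int n)" using less.prems by (intro f) auto
      then obtain j where j: "j < s + int n" "?W j \<le> ?W (s + int n)"
        by (auto simp: window_full_potential)
      show ?case
      proof (cases "j \<ge> s")
        case True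
        define n' where "n' = nat (j - s)"
        have "j = s + int n'" using True by (simp add: n'_def)
        with j less show ?thesis by force
      next
        case False
        then have "?W (s - 1) \<le> ?W j"
          using nf(1) by (cases "j = s - 1") (auto simp: window_full_potential not_le intro: less_imp_le)
        with j show ?thesis by simp
      qed
    qed
    have "?W (s - 1) \<le> ?W i" if "i \<in> {s..<s + int k - 1}" for i
      using ge[of "nat (i - s)"] that by auto
    moreover have "?W (s + int k - 1) < ?W (s - 1)"
      using nf(2) assms by (auto simp: window_full_potential not_le)
    ultimately show "\<not> window_full b x (s - 1) \<and> first_pass b (right_list x s k)"
      using nf fp by auto
  next
    assume A: "\<not> window_full b x (s - 1) \<and> first_pass b (right_list x s k)"
    then have W: "?W (s + int k - 1) < ?W (s - 1)"
       "\<And>i. i \<in> {s..<s + int k - 1} \<Longrightarrow> ?W (s - 1) \<le> ?W i"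
       "\<And>j. j < s - 1 \<Longrightarrow> ?W (s - 1) < ?W j"
      using fp by (auto simp: window_full_potential not_le)
    have "\<not> window_full b x (s + int k - 1)"
    proof
      assume "window_full b x (s + int k - 1)"
      then obtain j where j: "j < s + int k - 1" "?W j \<le> ?W (s + int k - 1)"
        by (auto simp: window_full_potential)
      consider "j \<in> {s..<s + int k - 1}" | "j = s - 1" | "j < s - 1" using j(1) by force
      then show False using W(2)[of j] W(3)[of j] W(1) j(2) by cases auto
    qed
    moreover have "window_full b x i" if "i \<in> {s..<s + int k - 1}" for i
      using W(2)[OF that] that by (auto simp: window_full_potential intro!: exI[of _ "s - 1"])
    ultimately show "is_block (window_full b x) s (s + int k - 1)"
      using A assms by (auto simp: is_block_def)
  qed
qed

text \<open>If one block started strictly later than the other, the bucket before its start would be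
  both non-full and full; the ends are compared in the same way.\<close>

lemma is_block_unique:
  assumes "is_block full s e" "is_block full s' e'" "i \<in> {s..e}" "i \<in> {s'..e'}"
  shows "s = s' \<and> e = e'"
proof -
  have *: "s' \<le> s" if "is_block full s e" "is_block full s' e'" "i \<in> {s..e}" "i \<in> {s'..e'}" for s e s' e'
  proof (rule ccontr)
    assume "\<not> s' \<le> s"
    then have "s' - 1 \<in> {s..<e}" using that by auto
    then show False using that by (auto simp: is_block_def)
  qed
  have **: "e \<le> e'" if "is_block full s e" "is_block full s' e'" "i \<in> {s..e}"
    "i \<in> {s'..e'}" for s e s' e'
  proof (rule ccontr)
    assume "\<not> e \<le> e'"
    then have "e' \<in> {s..<e}" using that by auto
    then show False using that by (auto simp: is_block_def)
  qed
  show ?thesis using *[OF assms] *[OF assms(2,1,4,3)] **[OF assms] **[OF assms(2,1,4,3)] by auto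
qed

lemma block_length_eq:
  assumes "is_block full s e" "i \<in> {s..e}"
  shows "block_length full i = nat (e - s + 1)"
proof -
  have "{{s..e} | s e. is_block full s e \<and> i \<in> {s..e}} = {{s..e}}"
    using assms is_block_unique[OF assms(1) _ assms(2)] by blast
  then show ?thesis by (simp add: block_length_def block_at_def)
qed

text \<open>The offset t is the position of i in its block. \<open>k \<ge> 1\<close> keeps away the
  value 0, which the length takes when no block contains i.\<close>

lemma block_length_eq_iff:
  assumes "k \<ge> 1"
  shows "block_length full i = k \<longleftrightarrow> (\<exists>t<k. is_block full (i - int t) (i - int t + int k - 1))"
proof
  assume L: "block_length full i = k"
  have "\<exists>s e. is_block full s e \<and> i \<in> {s..e}"
  proof (rule ccontr)
    assume "\<not> ?thesis"
    then have "block_at full i = {}" by (auto simp: block_at_def)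
    with L assms show False by (simp add: block_length_def)
  qed
  then obtain s e where se: "is_block full s e" "i \<in> {s..e}" by auto
  with L have "nat (e - s + 1) = k" using block_length_eq by metis
  then have "e = s + int k - 1" using se by auto
  then show "\<exists>t<k. is_block full (i - int t) (i - int t + int k - 1)"
    using se by (intro exI[of _ "nat (i - s)"]) auto
next
  assume "\<exists>t<k. is_block full (i - int t) (i - int t + int k - 1)"
  then obtain t where t: "t < k" "is_block full (i - int t) (i - int t + int k - 1)" by auto
  show "block_length full i = k"
    using block_length_eq[OF t(2), of i] t(1) by auto
qed

lemma is_block_shift_disjoint:
  assumes "is_block full (i - int t) (i - int t + int k - 1)"
    "is_block full (i - int t') (i - int t' + int k - 1)" "t < k" "t' < k"
  shows "t = t'"
  using is_block_unique[OF assms(1,2), of i] assms(3,4) by auto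

section \<open>Fullness in the infinite model as a supremum over windows\<close>

lemma infinite_sum_window:
  "j < i \<Longrightarrow> (\<Sum>k\<in>{j+1..i}. int (x k) - int b) = int (window_sum x i (nat (i - j))) - int (b * nat (i - j))"
proof -
  assume "j < i"
  have "(\<Sum>k\<in>{j+1..i}. int (x k) - int b) = (\<Sum>t<nat (i - j). int (x (i - int t)) - int b)"
    by (rule sum.reindex_bij_witness[where i="\<lambda>t. i - int t" and j="\<lambda>k. nat (i - k)"]) auto
  then show ?thesis by (simp add: window_sum_def sum_subtractf)
qed

lemma infinite_window_image:
  "(\<lambda>j. \<Sum>k\<in>{j+1..i}. int (x k) - int b) ` {..<i} =
     (\<lambda>l. int (window_sum x i l) - int (b * l)) ` {1..}" (is "?L = ?g ` _")
proof (intro set_eqI iffI)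
  fix y assume "y \<in> ?L"
  then obtain j where "j < i" "y = ?g (nat (i - j))"
    by (auto simp: infinite_sum_window simp del: of_nat_mult)
  then show "y \<in> ?g ` {1..}" by (intro image_eqI[of _ _ "nat (i - j)"]) auto
next
  fix y assume "y \<in> ?g ` {1..}"
  then obtain l where "l \<ge> 1" "y = ?g l" by auto
  then show "y \<in> ?L"
    using infinite_sum_window[of "i - int l" i x b] by (intro image_eqI[of _ _ "i - int l"]) auto
qed

lemma infinite_full_window_full:
  assumes "bdd_above ((\<lambda>l. int (window_sum x i l) - int (b * l)) ` {1..})"
  shows "infinite_full b x i \<longleftrightarrow> window_full b x i"
proof -
  let ?g = "\<lambda>l. int (window_sum x i l) - int (b * l)"
  note img = infinite_window_image[of x b i]
  have "infinite_full b x i \<longleftrightarrow> Sup (?g ` {1..}) \<ge> 0"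
    by (simp add: infinite_full_def infinite_H_def img)
  also have "\<dots> \<longleftrightarrow> (\<exists>l\<ge>1. ?g l \<ge> 0)"
  proof
    assume "\<exists>l\<ge>1. ?g l \<ge> 0"
    then obtain l where "l \<ge> 1" "?g l \<ge> 0" by auto
    then show "Sup (?g ` {1..}) \<ge> 0" using cSup_upper[OF _ assms, of "?g l"] by force
  next
    assume S: "Sup (?g ` {1..}) \<ge> 0"
    show "\<exists>l\<ge>1. ?g l \<ge> 0"
    proof (rule ccontr)
      assume "\<not> ?thesis"
      \<comment> \<open>Integrality: a negative surplus is at most -1, and so is the supremum; over
        the reals it could be 0.\<close>
      then have "Sup (?g ` {1..}) \<le> -1" by (intro cSup_least) force+
      with S show False by simp
    qed
  qed
  finally show ?thesis by (auto simp: window_full_def simp del: of_nat_mult)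
qed

text \<open>On integers, \<open>Sup\<close> of an unbounded set is the unspecified value \<open>THE\<close> of an empty predicate.\<close>

lemma Sup_int_unbounded:
  fixes A :: "int set"
  assumes "\<not> bdd_above A"
  shows "Sup A = (THE x. False)"
proof -
  have "(\<lambda>x. x \<in> A \<and> (\<forall>y\<in>A. y \<le> x)) = (\<lambda>x. False)"
    using assms by (auto simp: bdd_above_def fun_eq_iff)
  then show ?thesis by (simp add: Sup_int_def)
qed

text \<open>A description valid for every outcome, also on the null set where the windows are
  unbounded and the supremum has its default value. Measurability of the block length relies on it,
  since an almost sure identity would not suffice.\<close>

lemma infinite_full_iff:
  "infinite_full b x i \<longleftrightarrow>
     (if \<exists>B. \<forall>l\<ge>1. int (window_sum x i l) - int (b * l) \<le> B then window_full b x i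
      else (THE x::int. False) \<ge> 0)"
proof -
  let ?g = "\<lambda>l. int (window_sum x i l) - int (b * l)"
  have bdd: "(\<exists>B. \<forall>l\<ge>1. ?g l \<le> B) \<longleftrightarrow> bdd_above (?g ` {1..})"
    by (auto simp: bdd_above_def)
  note img = infinite_window_image[of x b i]
  show ?thesis
    unfolding bdd using infinite_full_window_full[of x i b]
    by (auto simp: infinite_full_def infinite_H_def img Sup_int_unbounded)
qed

section \<open>The flow of displaced keys\<close>

definition hash_count :: "nat \<Rightarrow> nat list \<Rightarrow> int \<Rightarrow> nat" where
  "hash_count m as i = count_list as (nat (i mod int m))"

lemma Suc_mod_eq_iff:
  assumes "i < m"
  shows "Suc u mod m = i \<longleftrightarrow> u mod m = (i + m - 1) mod m"
proof -
  have "(i + m - 1) mod m = (if i = 0 then m - 1 else i - 1)"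
  proof (cases "i = 0")
    case False
    then have "i + m - 1 = (i - 1) + m" by simp
    then have "(i + m - 1) mod m = (i - 1) mod m" by (metis mod_add_self2)
    also have "\<dots> = i - 1" using assms by (intro mod_less) linarith
    finally show ?thesis using False by simp
  qed (use assms in auto)
  moreover have "u mod m < m" using assms by simp
  ultimately show ?thesis using assms by (auto simp: mod_Suc)
qed

text \<open>\<open>f i\<close> counts the keys whose probe sequence has moved on from bucket \<open>i\<close> to the next bucket.\<close>

lemma hash_table_flow:
  assumes "set as \<subseteq> {..<m}" "length as \<le> b * m" "m > 0"
  shows "(\<forall>i<m. hash_table b m as i \<le> b) \<and> (\<Sum>i<m. hash_table b m as i) = length as \<and>
    (\<exists>f. \<forall>i<m. hash_table b m as i + f i = count_list as i + f ((i + m - 1) mod m) \<and>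
       (f i > 0 \<longrightarrow> hash_table b m as i = b))"
  using assms(1,2)
proof (induction as rule: rev_induct)
  case Nil
  show ?case by (auto simp: hash_table_def intro!: exI[of _ "\<lambda>_. 0"])
next
  case (snoc a as)
  define c where "c = hash_table b m as"
  from snoc obtain f where le: "\<forall>i<m. c i \<le> b" and sum: "(\<Sum>i<m. c i) = length as"
    and f: "\<And>i. i < m \<Longrightarrow> c i + f i = count_list as i + f ((i + m - 1) mod m)"
       "\<And>i. i < m \<Longrightarrow> f i > 0 \<Longrightarrow> c i = b"
    unfolding c_def by auto
  have a: "a < m" using snoc.prems by auto
  define D where "D = (LEAST d. c ((a + d) mod m) < b)"
  define p where "p = (a + D) mod m"
  \<comment> \<open>The bound on the length includes the new key, so the old content leaves room in
    some bucket.\<close>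
  have "\<exists>i<m. c i < b"
  proof (rule ccontr)
    assume "\<not> ?thesis"
    then have "(\<Sum>i<m. b) \<le> (\<Sum>i<m. c i)" by (intro sum_mono) (meson lessThan_iff not_less)
    with sum snoc.prems show False by (simp add: mult.commute)
  qed
  then obtain i where "i < m" "c i < b" by auto
  moreover from this a have "(a + (i + m - a)) mod m = i" by simp
  ultimately have ex: "\<exists>d. c ((a + d) mod m) < b" by metis
  have cp: "c p < b" unfolding p_def D_def by (rule LeastI_ex[OF ex])
  have before: "c ((a + t) mod m) = b" if "t < D" for t
    using not_less_Least[OF that[unfolded D_def]] le assms(3) by (auto simp: not_less intro: antisym)
  have p: "p < m" using assms(3) by (simp add: p_def)
  have c': "hash_table b m (as @ [a]) = c(p := Suc (c p))"
    by (simp add: hash_table_def insert_key_def probe_def D_def p_def c_def Let_def)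
  \<comment> \<open>The new key moves on from exactly the D buckets probed before its final
    one.\<close>
  define f' where "f' i = f i + (\<Sum>t<D. of_bool ((a + t) mod m = i))" for i
  have "(c(p := Suc (c p))) i + f' i = count_list (as @ [a]) i + f' ((i + m - 1) mod m)"
    if i: "i < m" for i
  proof -
    \<comment> \<open>The visits to i along the probe path are counted twice: once splitting off the
      last bucket p, once splitting off the first bucket a and shifting the rest by one. Equating
      both gives conservation of flow.\<close>
    have "(\<Sum>t<Suc D. of_bool ((a + t) mod m = i)) = (\<Sum>t<D. of_bool ((a + t) mod m = i)) + (of_bool (p =
      i) :: nat)"
      by (simp add: p_def)
    moreover have "(\<Sum>t<Suc D. of_bool ((a + t) mod m = i)) =
        (of_bool (a = i) :: nat) + (\<Sum>t<D. of_bool ((a + t) mod m = (i + m - 1) mod m))"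
      using a i by (simp only: sum.lessThan_Suc_shift) (simp add: Suc_mod_eq_iff)
    ultimately have "(\<Sum>t<D. of_bool ((a + t) mod m = i)) + (of_bool (p = i) :: nat) =
       of_bool (a = i) + (\<Sum>t<D. of_bool ((a + t) mod m = (i + m - 1) mod m))" by simp
    then show ?thesis using f(1)[OF i] by (auto simp: f'_def)
  qed
  moreover have "(c(p := Suc (c p))) i = b" if i: "i < m" "f' i > 0" for i
  proof -
    have "c i = b"
    proof (cases "f i > 0")
      case False
      have "\<exists>t<D. (a + t) mod m = i"
      proof (rule ccontr)
        assume "\<not> ?thesis"
        then have "(\<Sum>t<D. of_bool ((a + t) mod m = i)) = (0::nat)" by (intro sum.neutral) auto
        with i(2) False show False unfolding f'_def by linarith
      qed
      then show ?thesis using before by auto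
    qed (use f(2) i in auto)
    with cp show ?thesis by auto
  qed
  moreover have "(\<Sum>i<m. (c(p := Suc (c p))) i) = length (as @ [a])"
  proof -
    have "(\<Sum>i<m. (c(p := Suc (c p))) i) = (\<Sum>i<m. c i + of_bool (p = i))"
      by (intro sum.cong) auto
    also have "\<dots> = length as + 1" using p sum by (simp add: sum.distrib of_bool_def)
    finally show ?thesis by simp
  qed
  moreover have "\<forall>i<m. (c(p := Suc (c p))) i \<le> b" using le cp by auto
  ultimately show ?case unfolding c' by blast
qed

lemma exact_full_periodic: "exact_full b m as (i + int m) \<longleftrightarrow> exact_full b m as i"
  "exact_full b m as (i - int m) \<longleftrightarrow> exact_full b m as i"
  by (simp_all add: exact_full_def)

lemma exact_exists_nonfull:
  assumes "set as \<subseteq> {..<m}" "length as < b * m"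
  shows "\<exists>l\<in>{1..m}. \<not> exact_full b m as (i - int l)"
proof -
  have m: "m > 0" using assms by (cases m) auto
  have "\<exists>j<m. hash_table b m as j < b"
  proof (rule ccontr)
    assume "\<not> ?thesis"
    then have "(\<Sum>i<m. b) \<le> (\<Sum>i<m. hash_table b m as i)" by (intro sum_mono) (meson lessThan_iff not_less)
    with hash_table_flow[OF assms(1) _ m, of b] assms(2) show False by (simp add: mult.commute)
  qed
  then obtain j where j: "j < m" "hash_table b m as j < b" by auto
  \<comment> \<open>The cyclic distance from j to i in the range from 1 to m; it is m, not 0, if j
    is the bucket of i.\<close>
  define l where "l = nat ((i - int j - 1) mod int m) + 1"
  have l: "l \<in> {1..m}" using m by (auto simp: l_def nat_less_iff Suc_le_eq)
  have "(i - int l) mod int m = (i - 1 - (i - int j - 1) mod int m) mod int m"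
    using m by (simp add: l_def algebra_simps)
  also have "\<dots> = (i - 1 - (i - int j - 1)) mod int m" by (rule mod_diff_right_eq)
  also have "\<dots> = int j" using j by simp
  finally have "\<not> exact_full b m as (i - int l)" using j by (simp add: exact_full_def)
  with l show ?thesis by blast
qed

text \<open>Summing the flow equation over a window leaves only the keys entering and leaving it. If
  i is full, take the window back to the nearest non-full bucket, which passes nothing on. If i is
  not full, nothing leaves at i, so no window ending there can have received enough keys.\<close>

lemma exact_full_window_full:
  assumes "set as \<subseteq> {..<m}" "length as < b * m"
  shows "exact_full b m as i \<longleftrightarrow> window_full b (hash_count m as) i"
proof -
  have m: "m > 0" using assms by (cases m) auto
  define C where "C i = hash_table b m as (nat (i mod int m))" for i
  obtain f where le: "\<forall>i<m. hash_table b m as i \<le> b" and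
    f: "\<And>i. i < m \<Longrightarrow> hash_table b m as i + f i = count_list as i + f ((i + m - 1) mod m)"
       "\<And>i. i < m \<Longrightarrow> f i > 0 \<Longrightarrow> hash_table b m as i = b"
    using hash_table_flow[OF assms(1) _ m, of b] assms(2) by auto
  define F where "F i = f (nat (i mod int m))" for i
  have nm: "nat (i mod int m) < m" for i using m by (simp add: nat_less_iff)
  have pred: "(nat (i mod int m) + m - 1) mod m = nat ((i - 1) mod int m)" for i
  proof -
    have "int ((nat (i mod int m) + m - 1) mod m) = (i mod int m + (int m - 1)) mod int m"
      using m by (simp add: zmod_int of_nat_diff add_diff_eq)
    also have "\<dots> = (i + (int m - 1)) mod int m" by (rule mod_add_left_eq)
    also have "\<dots> = (i - 1 + int m) mod int m" by (simp add: algebra_simps)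
    also have "\<dots> = (i - 1) mod int m" by simp
    finally show ?thesis by simp
  qed
  have flow: "C i + F i = hash_count m as i + F (i - 1)" for i
    using f(1)[OF nm[of i]] unfolding C_def F_def hash_count_def pred .
  have sums: "(\<Sum>t<l. C (i - int t)) + F i = window_sum (hash_count m as) i l + F (i - int l)" for l
  proof (induction l)
    case (Suc l)
    then show ?case using flow[of "i - int l"] by (simp add: window_sum_def algebra_simps)
  qed (simp add: window_sum_def)
  have Cb: "C i \<le> b" for i using le nm by (simp add: C_def)
  have F0: "F i = 0" if "C i < b" for i using f(2)[OF nm[of i]] that by (auto simp: C_def F_def)
  have full: "exact_full b m as i \<longleftrightarrow> C i = b" for i by (simp add: exact_full_def C_def)
  show ?thesis
  proof
    assume i: "exact_full b m as i"
    have ex: "\<exists>l. C (i - int l) < b"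
      using exact_exists_nonfull[OF assms, of i] Cb full by (metis le_neq_implies_less)
    define l where "l = (LEAST l. C (i - int l) < b)"
    have l: "C (i - int l) < b" unfolding l_def by (rule LeastI_ex[OF ex])
    have "C (i - int t) = b" if "t < l" for t
      using not_less_Least[OF that[unfolded l_def]] Cb by (auto simp: not_less intro: antisym)
    then have "(\<Sum>t<l. C (i - int t)) = b * l" by simp
    with sums[of l] F0[OF l] have "b * l \<le> window_sum (hash_count m as) i l" by simp
    moreover have "l \<noteq> 0" using l i full by (cases "l = 0") auto
    ultimately show "window_full b (hash_count m as) i"
      by (auto simp: window_full_def intro!: exI[of _ l])
  next
    assume "window_full b (hash_count m as) i"
    then obtain l where l: "l \<ge> 1" "b * l \<le> window_sum (hash_count m as) i l"
      by (auto simp: window_full_def)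
    show "exact_full b m as i"
    proof (rule ccontr)
      assume "\<not> exact_full b m as i"
      then have C: "C i < b" using Cb[of i] full by auto
      \<comment> \<open>Strict because of the term t = 0, bucket i itself.\<close>
      have "(\<Sum>t<l. C (i - int t)) < (\<Sum>t<l. b)"
        using l(1) C Cb by (intro sum_strict_mono_ex1) (auto intro!: bexI[of _ 0])
      with sums[of l] F0[OF C] l(2) show False by (simp add: mult.commute)
    qed
  qed
qed

lemma window_sum_hash_count_period:
  assumes "set as \<subseteq> {..<m}"
  shows "window_sum (hash_count m as) i m = length as"
proof -
  have "window_sum (hash_count m as) i m = (\<Sum>j<m. count_list as j)"
    unfolding window_sum_def hash_count_def
  proof (rule sum.reindex_bij_witness[where j="\<lambda>t. nat ((i - int t) mod int m)" and i="\<lambda>j. nat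
    ((i - int j) mod int m)"])
    fix a assume "a \<in> {..<m}"
    then show "nat ((i - int (nat ((i - int a) mod int m))) mod int m) = a"
      by (simp add: mod_diff_right_eq)
  qed (auto simp: nat_less_iff mod_diff_right_eq)
  also have "\<dots> = (\<Sum>j\<in>set as. count_list as j)"
    using assms by (intro sum.mono_neutral_right) (auto simp: count_list_0_iff)
  finally show ?thesis by (simp add: sum_count_set)
qed

text \<open>One period holds fewer than \<open>b * m\<close> keys, so it can be cut off an overfull
  window longer than m and leaves an overfull rest. Hence a first overfull window never wraps
  around, and only windows of distinct buckets need a probability bound.\<close>

lemma first_window_le_period:
  assumes "set as \<subseteq> {..<m}" "length as < b * m" "l > m"
    and "b * l \<le> window_sum (hash_count m as) i l"
  shows "\<exists>l'\<in>{1..<l}. b * l' \<le> window_sum (hash_count m as) i l'"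
proof -
  define l' where "l' = l - m"
  have m: "m > 0" using assms by (cases m) auto
  have l: "l = m + l'" using assms by (simp add: l'_def)
  have "window_sum (hash_count m as) i l =
    window_sum (hash_count m as) i m + window_sum (hash_count m as) i l'"
  proof -
    have "(\<Sum>t<m + l'. hash_count m as (i - int t)) =
      (\<Sum>t<m. hash_count m as (i - int t)) + (\<Sum>t<l'. hash_count m as (i - int (m + t)))"
      by (induction l') auto
    moreover have "hash_count m as (i - int (m + t)) = hash_count m as (i - int t)" for t
    proof -
      have "(i - int (m + t)) mod int m = (i - int t - int m) mod int m" by (simp add: algebra_simps)
      also have "\<dots> = (i - int t) mod int m" by simp
      finally show ?thesis by (simp add: hash_count_def)
    qed
    ultimately show ?thesis by (simp add: window_sum_def l)
  qed
  then have "b * l' \<le> window_sum (hash_count m as) i l'"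
    using assms(2,4) window_sum_hash_count_period[OF assms(1), of i] l by (simp add: algebra_simps)
  moreover have "l' \<in> {1..<l}" using assms(3) m by (auto simp: l'_def)
  ultimately show ?thesis by blast
qed

lemma exact_block_exists:
  assumes "set as \<subseteq> {..<m}" "length as < b * m"
  shows "1 \<le> block_length (exact_full b m as) i \<and> block_length (exact_full b m as) i \<le> m"
proof -
  let ?full = "exact_full b m as"
  have m: "m > 0" using assms by (cases m) auto
  obtain l0 where l0: "l0 \<in> {1..m}" "\<not> ?full (i - int l0)" using exact_exists_nonfull[OF assms] by blast
  \<comment> \<open>The search to the left starts at distance 1 and the one to the right at distance
    0, because bucket i may itself be the end of its block.\<close>
  define l where "l = (LEAST l. l \<ge> 1 \<and> \<not> ?full (i - int l))"
  have l: "l \<ge> 1" "\<not> ?full (i - int l)"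
    using LeastI[of "\<lambda>l. l \<ge> 1 \<and> \<not> ?full (i - int l)" l0] l0 by (auto simp: l_def)
  have lm: "l \<le> m"
    using Least_le[of "\<lambda>l. l \<ge> 1 \<and> \<not> ?full (i - int l)" l0] l0 by (auto simp: l_def)
  have lf: "?full (i - int t)" if "1 \<le> t" "t < l" for t
    using not_less_Least[OF that(2)[unfolded l_def]] that by auto
  define d where "d = (LEAST d. \<not> ?full (i + int d))"
  \<comment> \<open>One period after the non-full bucket on the left comes another non-full one,
    which bounds the total length by m.\<close>
  have nf: "\<not> ?full (i + int (m - l))"
  proof -
    have "i + int (m - l) = i - int l + int m" using lm by simp
    then show ?thesis using l exact_full_periodic(1)[of b m as "i - int l"] by metis
  qed
  have d: "\<not> ?full (i + int d)" unfolding d_def by (rule LeastI[of "\<lambda>d. \<not> ?full (i + int d)", OF nf])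
  have dm: "d \<le> m - l" unfolding d_def by (rule Least_le[of "\<lambda>d. \<not> ?full (i + int d)", OF nf])
  have df: "?full (i + int t)" if "t < d" for t
    using not_less_Least[OF that[unfolded d_def]] by auto
  have "is_block ?full (i - int l + 1) (i + int d)"
    unfolding is_block_def
  proof (intro conjI ballI)
    fix j assume j: "j \<in> {i - int l + 1..<i + int d}"
    show "?full j"
    proof (cases "j \<ge> i")
      case True
      then show ?thesis using df[of "nat (j - i)"] j by auto
    next
      case False
      then show ?thesis using lf[of "nat (i - j)"] j by auto
    qed
  qed (use l d in auto)
  from block_length_eq[OF this, of i] show ?thesis using l lm dm by auto
qed

section \<open>Lists of independent Poisson variables\<close>

lemma replicate_pmf_add:
  "replicate_pmf (m + n) p = map_pmf (\<lambda>(xs, ys). xs @ ys) (pair_pmf (replicate_pmf m p)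
    (replicate_pmf n p))"
  by (simp add: replicate_pmf_distrib pair_pmf_def map_bind_pmf bind_assoc_pmf bind_return_pmf map_pmf_def)

lemma pmf_replicate_pmf: "pmf (replicate_pmf (length xs) p) xs = (\<Prod>x\<leftarrow>xs. pmf p x)"
proof (induction xs)
  case (Cons x xs)
  have "replicate_pmf (Suc (length xs)) p =
    map_pmf (\<lambda>(x, xs). x # xs) (pair_pmf p (replicate_pmf (length xs) p))"
    by (simp add: pair_pmf_def map_pmf_def bind_assoc_pmf bind_return_pmf)
  moreover have "pmf (map_pmf (\<lambda>(x, xs). x # xs) (pair_pmf p (replicate_pmf (length xs) p))) (x # xs) =
     pmf (pair_pmf p (replicate_pmf (length xs) p)) (x, xs)"
    using pmf_map_inj'[of "\<lambda>(x, xs). x # xs" "pair_pmf p (replicate_pmf (length xs) p)" "(x, xs)"]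
    by (auto simp: inj_def)
  ultimately show ?case using Cons by (simp add: pmf_pair)
qed simp

lemma replicate_pmf_length: "xs \<in> set_pmf (replicate_pmf n p) \<Longrightarrow> length xs = n"
  by (simp add: set_replicate_pmf)

lemma prob_replicate_pmf_split:
  fixes p :: "'a :: countable pmf"
  shows "measure_pmf.prob (replicate_pmf (m + n) p) {xs. P (take m xs) \<and> Q (drop m xs)} =
    measure_pmf.prob (replicate_pmf m p) {xs. P xs} * measure_pmf.prob (replicate_pmf n p) {xs. Q xs}"
proof -
  have "measure_pmf.prob (replicate_pmf (m + n) p) {xs. P (take m xs) \<and> Q (drop m xs)} =
    measure_pmf.prob (pair_pmf (replicate_pmf m p) (replicate_pmf n p))
      ((\<lambda>(xs, ys). xs @ ys) -` {xs. P (take m xs) \<and> Q (drop m xs)})"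
    by (simp add: replicate_pmf_add)
  also have "\<dots> = measure_pmf.prob (pair_pmf (replicate_pmf m p) (replicate_pmf n p))
    ({xs. P xs} \<times> {ys. Q ys})"
    by (intro measure_pmf.finite_measure_eq_AE) (auto simp: AE_measure_pmf_iff set_replicate_pmf)
  finally show ?thesis by (simp add: measure_pmf_prob_product)
qed

text \<open>Exponential moments are taken in \<open>ennreal\<close>, where they factor over the list
  without an integrability proof.\<close>

lemma nn_integral_replicate_pmf_power_sum:
  "(\<integral>\<^sup>+xs. ennreal x ^ sum_list xs \<partial>measure_pmf (replicate_pmf n p)) =
     (\<integral>\<^sup>+a. ennreal x ^ a \<partial>measure_pmf p) ^ n"
  by (induction n) (simp_all add: power_add nn_integral_cmult nn_integral_multc)

lemma nn_integral_poisson_power: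
  assumes "r > 0" "x \<ge> 0"
  shows "(\<integral>\<^sup>+a. ennreal x ^ a \<partial>measure_pmf (poisson_pmf r)) = ennreal (exp (r * (x - 1)))"
proof -
  have s: "(\<lambda>a. (r * x) ^ a / fact a * exp (- r)) sums (exp (r * x) * exp (- r))"
    using exp_converges[of "r * x"] by (intro sums_mult2) (simp add: field_simps scaleR_conv_of_real)
  have "(\<integral>\<^sup>+a. ennreal x ^ a \<partial>measure_pmf (poisson_pmf r)) =
     (\<integral>\<^sup>+a. ennreal ((r * x) ^ a / fact a * exp (- r)) \<partial>count_space UNIV)"
    unfolding nn_integral_measure_pmf
    using assms by (intro nn_integral_cong)
      (simp add: ennreal_power ennreal_mult'[symmetric] power_mult_distrib mult_ac)
  also have "\<dots> = ennreal (exp (r * x) * exp (- r))"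
    using assms by (subst nn_integral_count_space_nat, subst suminf_ennreal_eq[OF _ s]) auto
  also have "exp (r * x) * exp (- r) = exp (r * (x - 1))"
    by (simp add: exp_add[symmetric] algebra_simps)
  finally show ?thesis .
qed

abbreviation poisson_lists :: "real \<Rightarrow> nat \<Rightarrow> nat list pmf" where
  "poisson_lists r l \<equiv> replicate_pmf l (poisson_pmf r)"

text \<open>Chernoff bound: on the event \<open>x ^ sum_list xs / x ^ (b * l)\<close> is at least 1,
  and its mean is explicit. The free \<open>x\<close> is later chosen as the reciprocal of the
  load.\<close>

lemma poisson_window_bound:
  assumes "r > 0" "x \<ge> 1"
  shows "measure_pmf.prob (poisson_lists r l) {xs. b * l \<le> sum_list xs} \<le>
    (exp (r * (x - 1)) / x ^ b) ^ l"
proof -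
  let ?p = "poisson_lists r l"
  have "emeasure ?p {xs. b * l \<le> sum_list xs} =
    (\<integral>\<^sup>+xs. indicator {xs. b * l \<le> sum_list xs} xs \<partial>measure_pmf ?p)"
    by simp
  also have "\<dots> \<le> (\<integral>\<^sup>+xs. ennreal (1 / x ^ (b * l)) * ennreal x ^ sum_list xs \<partial>measure_pmf ?p)"
  proof (intro nn_integral_mono)
    fix xs :: "nat list"
    have "1 \<le> 1 / x ^ (b * l) * x ^ sum_list xs" if "b * l \<le> sum_list xs"
      using power_increasing[OF that assms(2)] assms(2) by (simp add: field_simps)
    then show "indicator {xs. b * l \<le> sum_list xs} xs \<le>
      ennreal (1 / x ^ (b * l)) * ennreal x ^ sum_list xs"
      using assms(2) by (auto simp: indicator_def ennreal_power ennreal_mult'[symmetric])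
  qed
  also have "\<dots> = ennreal (1 / x ^ (b * l)) * ennreal (exp (r * (x - 1))) ^ l"
    using assms by (simp add: nn_integral_cmult nn_integral_replicate_pmf_power_sum nn_integral_poisson_power)
  also have "\<dots> = ennreal ((exp (r * (x - 1)) / x ^ b) ^ l)"
    using assms by (simp add: ennreal_power ennreal_mult'[symmetric] power_divide power_mult)
  finally show ?thesis
    using assms by (simp add: measure_pmf.emeasure_eq_measure)
qed

section \<open>Finite-dimensional laws of an i.i.d. Poisson family\<close>

lemma measurable_map_list:
  fixes X :: "'i \<Rightarrow> 'a \<Rightarrow> 'b :: countable"
  assumes "\<And>j. j \<in> set js \<Longrightarrow> X j \<in> measurable M (count_space UNIV)"
  shows "(\<lambda>\<omega>. map (\<lambda>j. X j \<omega>) js) \<in> measurable M (count_space UNIV)"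
  using assms
proof (induction js)
  case (Cons j js)
  then have 1: "X j \<in> measurable M (count_space UNIV)"
    "(\<lambda>\<omega>. map (\<lambda>j. X j \<omega>) js) \<in> measurable M (count_space UNIV)"
    by auto
  have "(\<lambda>\<omega>. (\<lambda>a \<omega>. a # map (\<lambda>j. X j \<omega>) js) (X j \<omega>) \<omega>) \<in> measurable M (count_space UNIV)"
    by (rule measurable_compose_countable[OF _ 1(1)]) (auto intro: measurable_compose[OF 1(2)])
  then show ?case by simp
qed simp

text \<open>Lists over a countable type have a discrete law, so it suffices to compare singletons,
  where independence gives a product of point masses. Events on finitely many buckets are evaluated
  through this.\<close>

lemma iid_poisson_distr_map:
  assumes iid: "iid_poisson M I X r" and js: "distinct js" "set js \<subseteq> I"
  shows "distr M (count_space UNIV) (\<lambda>\<omega>. map (\<lambda>j. X j \<omega>) js) =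
    measure_pmf (poisson_lists r (length js))"
proof -
  interpret prob_space M using iid by (simp add: iid_poisson_def)
  have ind: "indep_vars (\<lambda>_. count_space UNIV) X I"
    and d: "\<And>i. i \<in> I \<Longrightarrow> distr M (count_space UNIV) (X i) = measure_pmf (poisson_pmf r)"
    using iid by (auto simp: iid_poisson_def)
  have rv: "X i \<in> measurable M (count_space UNIV)" if "i \<in> I" for i
    using ind that by (auto simp: indep_vars_def)
  have meas: "(\<lambda>\<omega>. map (\<lambda>j. X j \<omega>) js) \<in> measurable M (count_space UNIV)"
    using js(2) rv by (intro measurable_map_list) auto
  have sing: "prob {\<omega> \<in> space M. map (\<lambda>j. X j \<omega>) js = xs} = pmf (poisson_lists r (length js)) xs" for xs
  proof (cases "length xs = length js")
    case False
    then have "{\<omega> \<in> space M. map (\<lambda>j. X j \<omega>) js = xs} = {}"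
      by (metis (mono_tags, lifting) empty_Collect_eq length_map)
    moreover have "xs \<notin> set_pmf (poisson_lists r (length js))"
      using False by (auto simp: set_replicate_pmf)
    ultimately show ?thesis by (simp only: set_pmf_iff) simp
  next
    case True
    show ?thesis
    proof (cases "js = []")
      case True
      with \<open>length xs = length js\<close> show ?thesis by (simp add: prob_space)
    next
      case False
      \<comment> \<open>Independence speaks about a set of indices, so each index j is sent back to
        its position in \<open>js\<close>, which is unique because \<open>js\<close> is
        distinct.\<close>
      define A where "A j = {xs ! (THE i. i < length js \<and> js ! i = j)}" for j
      have A: "A (js ! i) = {xs ! i}" if "i < length js" for i
      proof -
        have "(THE i'. i' < length js \<and> js ! i' = js ! i) = i"
          using that js(1) by (auto intro!: the_equality simp: nth_eq_iff_index_eq)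
        then show ?thesis by (simp add: A_def)
      qed
      have "{\<omega> \<in> space M. map (\<lambda>j. X j \<omega>) js = xs} = (\<Inter>j\<in>set js. X j -` A j \<inter> space M)"
      proof (intro set_eqI iffI)
        fix \<omega> assume \<omega>: "\<omega> \<in> {\<omega> \<in> space M. map (\<lambda>j. X j \<omega>) js = xs}"
        show "\<omega> \<in> (\<Inter>j\<in>set js. X j -` A j \<inter> space M)"
        proof
          fix j assume "j \<in> set js"
          then obtain i where i: "i < length js" "j = js ! i" by (auto simp: in_set_conv_nth)
          with \<omega> have "X j \<omega> = xs ! i" by auto
          with A[OF i(1)] i(2) \<omega> show "\<omega> \<in> X j -` A j \<inter> space M" by simp
        qed
      next
        fix \<omega> assume \<omega>: "\<omega> \<in> (\<Inter>j\<in>set js. X j -` A j \<inter> space M)"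
        have "X (js ! i) \<omega> = xs ! i" if "i < length js" for i
        proof -
          have "\<omega> \<in> X (js ! i) -` A (js ! i) \<inter> space M" using \<omega> nth_mem[OF that] by blast
          then show ?thesis using A[OF that] by simp
        qed
        then have "map (\<lambda>j. X j \<omega>) js = xs" by (intro nth_equalityI) (simp_all add: True)
        moreover have "\<omega> \<in> space M" using \<omega> False hd_in_set by blast
        ultimately show "\<omega> \<in> {\<omega> \<in> space M. map (\<lambda>j. X j \<omega>) js = xs}" by simp
      qed
      then have "prob {\<omega> \<in> space M. map (\<lambda>j. X j \<omega>) js = xs} = prob (\<Inter>j\<in>set js. X j -` A j \<inter> space M)"
        by simp
      also have "\<dots> = (\<Prod>j\<in>set js. prob (X j -` A j \<inter> space M))"
        using ind js False unfolding indep_vars_def2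
        by (intro indep_setsD[where F="\<lambda>i. {X i -` A \<inter> space M | A. A \<in> sets
          (count_space UNIV)}" and I=I]) auto
      also have "\<dots> = (\<Prod>j\<in>set js. measure (measure_pmf (poisson_pmf r)) (A j))"
        using js(2) by (intro prod.cong refl) (subst d[symmetric], auto simp: measure_distr rv)
      also have "\<dots> = (\<Prod>j\<leftarrow>js. measure (measure_pmf (poisson_pmf r)) (A j))"
        using js(1) by (simp add: prod.distinct_set_conv_list)
      also have "map (\<lambda>j. measure (measure_pmf (poisson_pmf r)) (A j)) js = map (pmf (poisson_pmf r)) xs"
        using True by (intro nth_equalityI) (auto simp: A measure_pmf_single)
      finally show ?thesis using True pmf_replicate_pmf[of xs "poisson_pmf r"] by simp
    qed
  qed
  show ?thesis
  proof (rule measure_eqI_countable[where A=UNIV])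
    fix xs :: "nat list"
    have "emeasure (distr M (count_space UNIV) (\<lambda>\<omega>. map (\<lambda>j. X j \<omega>) js)) {xs} =
      emeasure M {\<omega> \<in> space M. map (\<lambda>j. X j \<omega>) js = xs}"
      by (subst emeasure_distr[OF meas]) (auto simp: vimage_def Int_def conj_commute)
    also have "\<dots> = ennreal (pmf (poisson_lists r (length js)) xs)"
      by (simp add: emeasure_eq_measure sing)
    finally show "emeasure (distr M (count_space UNIV) (\<lambda>\<omega>. map (\<lambda>j. X j \<omega>) js)) {xs} =
      emeasure (measure_pmf (poisson_lists r (length js))) {xs}"
      by (simp add: emeasure_pmf_single)
  qed auto
qed

lemma iid_poisson_measurable:
  "iid_poisson M I X r \<Longrightarrow> i \<in> I \<Longrightarrow> X i \<in> measurable M (count_space UNIV)"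
  by (auto simp: iid_poisson_def prob_space.indep_vars_def)

lemma iid_poisson_prob_map:
  assumes iid: "iid_poisson M I X r" and js: "distinct js" "set js \<subseteq> I"
  shows "measure M {\<omega> \<in> space M. P (map (\<lambda>j. X j \<omega>) js)} =
    measure_pmf.prob (poisson_lists r (length js)) {xs. P xs}"
proof -
  have "(\<lambda>\<omega>. map (\<lambda>j. X j \<omega>) js) \<in> measurable M (count_space UNIV)"
    using js(2) by (intro measurable_map_list iid_poisson_measurable[OF iid]) auto
  then show ?thesis
    unfolding iid_poisson_distr_map[OF assms, symmetric]
    by (subst measure_distr) (auto simp: vimage_def Int_def conj_commute)
qed

section \<open>Blocks in the infinite model\<close>

lemma window_sum_left_list: "window_sum x i l = sum_list (left_list x i l)"
  using sum_list_take_left_list[of l l x i] by simp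

lemma measurable_left_list:
  assumes "\<And>k. (\<lambda>\<omega>. x \<omega> k) \<in> measurable M (count_space UNIV)"
  shows "(\<lambda>\<omega>. left_list (x \<omega>) i K) \<in> measurable M (count_space UNIV)"
  unfolding left_list_def
  by (rule measurable_map_list[where X="\<lambda>t \<omega>. x \<omega> (i - int t)"]) (rule assms)

lemma measurable_right_list:
  assumes "\<And>k. (\<lambda>\<omega>. x \<omega> k) \<in> measurable M (count_space UNIV)"
  shows "(\<lambda>\<omega>. right_list (x \<omega>) i K) \<in> measurable M (count_space UNIV)"
  unfolding right_list_def
  by (rule measurable_map_list[where X="\<lambda>t \<omega>. x \<omega> (i + int t)"]) (rule assms)

lemma measurable_window_sum:
  assumes "\<And>k. (\<lambda>\<omega>. x \<omega> k) \<in> measurable M (count_space UNIV)"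
  shows "(\<lambda>\<omega>. window_sum (x \<omega>) i l) \<in> measurable M (count_space UNIV)"
  unfolding window_sum_left_list by (rule measurable_compose[OF measurable_left_list[OF assms]]) auto

lemma measurable_window_full:
  assumes "\<And>k. (\<lambda>\<omega>. x \<omega> k) \<in> measurable M (count_space UNIV)"
  shows "Measurable.pred M (\<lambda>\<omega>. window_full b (x \<omega>) i)"
proof -
  note [measurable] = measurable_window_sum[of x M, OF assms]
  show ?thesis unfolding window_full_def by measurable
qed

text \<open>The events differ only if the first overfull window ending at i is longer than K; sum
  the geometric bounds over its length. The hypothesis concerns first overfull windows because this
  is what holds for all l in the periodic exact model, and A is arbitrary so that the right part of
  a block can be carried along.\<close>

lemma truncated_window_bound:
  fixes x :: "'a \<Rightarrow> int \<Rightarrow> nat"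
  assumes "prob_space M"
    and meas: "\<And>k. (\<lambda>\<omega>. x \<omega> k) \<in> measurable M (count_space UNIV)"
    and \<rho>: "0 \<le> \<rho>" "\<rho> < 1"
    and tail: "\<And>l. l \<ge> 1 \<Longrightarrow> measure M {\<omega> \<in> space M. b * l \<le> window_sum (x \<omega>) i l \<and>
        (\<forall>l'\<in>{1..<l}. window_sum (x \<omega>) i l' < b * l')} \<le> \<rho> ^ l"
    and A: "A \<in> sets M"
  shows "\<bar>measure M ({\<omega> \<in> space M. stays_below b (left_list (x \<omega>) i K)} \<inter> A) -
     measure M ({\<omega> \<in> space M. \<not> window_full b (x \<omega>) i} \<inter> A)\<bar> \<le> \<rho> ^ (K + 1) / (1 - \<rho>)"
proof -
  interpret prob_space M by fact
  note [measurable] = measurable_window_sum[of x M, OF meas] A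
  define D where "D l = {\<omega> \<in> space M. b * l \<le> window_sum (x \<omega>) i l \<and>
        (\<forall>l'\<in>{1..<l}. window_sum (x \<omega>) i l' < b * l')}" for l
  have D[measurable]: "D l \<in> sets M" for l unfolding D_def by measurable
  define S where "S = {\<omega> \<in> space M. stays_below b (left_list (x \<omega>) i K)} \<inter> A"
  define F where "F = {\<omega> \<in> space M. \<not> window_full b (x \<omega>) i} \<inter> A"
  have [measurable]: "S \<in> sets M" "F \<in> sets M"
    unfolding S_def F_def stays_below_left_list window_full_def by measurable
  have FS: "F \<subseteq> S"
  proof
    fix \<omega> assume "\<omega> \<in> F"
    then have "\<not> (\<exists>l\<ge>1. b * l \<le> window_sum (x \<omega>) i l)" "\<omega> \<in> space M" "\<omega> \<in> A"
      by (auto simp: F_def window_full_def)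
    then show "\<omega> \<in> S" by (simp add: S_def stays_below_left_list) (metis atLeastAtMost_iff not_le)
  qed
  have SD: "S - F \<subseteq> (\<Union>n. D (K + 1 + n))"
  proof
    fix \<omega> assume \<omega>: "\<omega> \<in> S - F"
    then have "window_full b (x \<omega>) i" and sp: "\<omega> \<in> space M" by (auto simp: S_def F_def)
    then obtain l0 where l0: "l0 \<ge> 1 \<and> b * l0 \<le> window_sum (x \<omega>) i l0" by (auto simp: window_full_def)
    define l where "l = (LEAST l. l \<ge> 1 \<and> b * l \<le> window_sum (x \<omega>) i l)"
    have l: "l \<ge> 1 \<and> b * l \<le> window_sum (x \<omega>) i l" unfolding l_def by (rule LeastI) (rule l0)
    have min: "window_sum (x \<omega>) i l' < b * l'" if "l' \<in> {1..<l}" for l'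
      using not_less_Least[of l' "\<lambda>l. l \<ge> 1 \<and> b * l \<le> window_sum (x \<omega>) i l"] that
      by (auto simp: l_def)
    have "\<not> l \<le> K" using l \<omega> by (auto simp: S_def stays_below_left_list dest!: bspec[of _ _ l])
    then have "l = K + 1 + (l - K - 1)" by simp
    moreover have "\<omega> \<in> D l" using l min sp by (auto simp: D_def)
    ultimately show "\<omega> \<in> (\<Union>n. D (K + 1 + n))" by (metis UN_I UNIV_I)
  qed
  have sm: "summable (\<lambda>n. \<rho> ^ (K + 1 + n))"
    using summable_geometric[of \<rho>] \<rho> by (simp add: power_add)
  have Dle: "prob (D (K + 1 + n)) \<le> \<rho> ^ (K + 1 + n)" for n
    unfolding D_def by (rule tail) simp
  have sm': "summable (\<lambda>n. prob (D (K + 1 + n)))"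
    by (rule summable_comparison_test_ev[OF _ sm]) (use Dle in \<open>auto simp: measure_nonneg\<close>)
  have "prob (S - F) \<le> prob (\<Union>n. D (K + 1 + n))"
    by (intro finite_measure_mono SD) auto
  also have "\<dots> \<le> (\<Sum>n. prob (D (K + 1 + n)))"
    using sm' by (intro finite_measure_subadditive_countably) auto
  also have "\<dots> \<le> (\<Sum>n. \<rho> ^ (K + 1 + n))" by (rule suminf_le[OF Dle sm' sm])
  also have "\<dots> = \<rho> ^ (K + 1) * (\<Sum>n. \<rho> ^ n)"
    using \<rho> summable_geometric[of \<rho>] by (subst suminf_mult[symmetric]) (auto simp: power_add mult_ac)
  also have "\<dots> = \<rho> ^ (K + 1) / (1 - \<rho>)" using \<rho> by (simp add: suminf_geometric)
  finally have "prob (S - F) \<le> \<rho> ^ (K + 1) / (1 - \<rho>)" .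
  moreover have "prob (S - F) = prob S - prob F" using FS by (intro finite_measure_Diff) auto
  ultimately show ?thesis
    using measure_nonneg[of M "S - F"] unfolding S_def F_def by linarith
qed

section \<open>The two factors of the block law\<close>

definition below_prob :: "nat \<Rightarrow> real \<Rightarrow> nat \<Rightarrow> real" where
  "below_prob b r K = measure_pmf.prob (poisson_lists r K) {ys. stays_below b ys}"

definition pass_prob :: "nat \<Rightarrow> real \<Rightarrow> nat \<Rightarrow> real" where
  "pass_prob b r k = measure_pmf.prob (poisson_lists r k) {zs. first_pass b zs}"

text \<open>A limit of list probabilities, so that the constant belongs to neither model; that the
  limit exists is seen in the infinite model.\<close>

definition nonfull_prob :: "nat \<Rightarrow> real \<Rightarrow> real" where
  "nonfull_prob b r = lim (below_prob b r)"

locale poisson_load =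
  fixes b :: nat and \<alpha> :: real
  assumes b: "b \<ge> 1" and \<alpha>: "0 < \<alpha>" "\<alpha> < 1"
begin

abbreviation "rate \<equiv> \<alpha> * real b"

lemma rate_pos: "rate > 0" using b \<alpha> by simp

text \<open>The Chernoff bound for one bucket at load a: with \<open>r = a * b\<close>, the quotient
  \<open>exp (r * (x - 1)) / x ^ b\<close> is smallest at \<open>x = 1 / a\<close>.\<close>

definition decay :: "real \<Rightarrow> real" where
  "decay a = (a * exp (1 - a)) ^ b"

lemma decay_bounds:
  assumes "0 < a" "a < 1"
  shows "0 < decay a" "decay a < 1"
proof -
  have "ln a < a - 1"
    using ln_le_minus_one[of a] ln_eq_minus_one[of a] assms by fastforce
  then have "a < exp (a - 1)" using assms by (metis exp_less_mono exp_ln)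
  then have "a * exp (1 - a) < exp (a - 1) * exp (1 - a)" by simp
  also have "\<dots> = 1" by (simp add: exp_add[symmetric])
  finally have 1: "a * exp (1 - a) < 1" .
  show "0 < decay a" using assms by (simp add: decay_def)
  show "decay a < 1" unfolding decay_def using 1 assms b by (intro power_less_one_iff[THEN iffD2]) auto
qed

lemma decay_tail_tendsto:
  assumes "0 < a" "a < 1"
  shows "(\<lambda>K. decay a ^ (K + 1) / (1 - decay a)) \<longlonglongrightarrow> 0"
proof -
  have "(\<lambda>K. decay a ^ K) \<longlonglongrightarrow> 0" using decay_bounds[OF assms] by (intro LIMSEQ_realpow_zero) auto
  then have "(\<lambda>K. decay a ^ Suc K) \<longlonglongrightarrow> 0" by (rule LIMSEQ_Suc)
  then show ?thesis using tendsto_divide_zero[of _ sequentially "1 - decay a"] by simp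
qed

end

locale infinite_model = poisson_load +
  fixes M :: "'a measure" and X :: "int \<Rightarrow> 'a \<Rightarrow> nat"
  assumes iid: "iid_poisson M UNIV X rate"
begin

sublocale prob_space M using iid by (simp add: iid_poisson_def)

abbreviation counts :: "'a \<Rightarrow> int \<Rightarrow> nat" where
  "counts \<omega> \<equiv> \<lambda>i. X i \<omega>"

lemma X_measurable [measurable]: "X i \<in> measurable M (count_space UNIV)"
  using iid_poisson_measurable[OF iid] by simp

lemma prob_window:
  "prob {\<omega> \<in> space M. b * l \<le> window_sum (counts \<omega>) i l} \<le> decay \<alpha> ^ l"
proof -
  have "prob {\<omega> \<in> space M. b * l \<le> window_sum (counts \<omega>) i l} =
    prob {\<omega> \<in> space M. b * l \<le> sum_list (map (\<lambda>j. X j \<omega>) (map (\<lambda>t. i - int t) [0..<l]))}"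
    by (simp add: window_sum_left_list left_list_def comp_def)
  also have "\<dots> = measure_pmf.prob (poisson_lists rate l) {xs. b * l \<le> sum_list xs}"
    by (subst iid_poisson_prob_map[OF iid]) (auto simp: distinct_map inj_on_def)
  also have "\<dots> \<le> (exp (rate * (1 / \<alpha> - 1)) / (1 / \<alpha>) ^ b) ^ l"
    using \<alpha> rate_pos by (intro poisson_window_bound) auto
  also have "exp (rate * (1 / \<alpha> - 1)) / (1 / \<alpha>) ^ b = decay \<alpha>"
  proof -
    have "rate * (1 / \<alpha> - 1) = real b * (1 - \<alpha>)" using \<alpha> by (simp add: field_simps)
    then have "exp (rate * (1 / \<alpha> - 1)) = exp (1 - \<alpha>) ^ b" by (simp only: exp_of_nat_mult)
    moreover have "(1 / \<alpha>) ^ b = 1 / \<alpha> ^ b" by (rule power_one_over)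
    ultimately show ?thesis by (simp only: decay_def power_mult_distrib divide_divide_eq_right div_by_1 mult.commute)
  qed
  finally show ?thesis .
qed

lemma prob_left_right:
  "prob {\<omega> \<in> space M. stays_below b (left_list (counts \<omega>) (s - 1) K) \<and>
     first_pass b (right_list (counts \<omega>) s k)} = below_prob b rate K * pass_prob b rate k"
proof -
  let ?js = "map (\<lambda>t. s - 1 - int t) [0..<K] @ map (\<lambda>t. s + int t) [0..<k]"
  have "prob {\<omega> \<in> space M. stays_below b (left_list (counts \<omega>) (s - 1) K) \<and>
     first_pass b (right_list (counts \<omega>) s k)} =
    prob {\<omega> \<in> space M. stays_below b (take K (map (\<lambda>j. X j \<omega>) ?js)) \<and>
      first_pass b (drop K (map (\<lambda>j. X j \<omega>) ?js))}"
    by (simp add: left_list_def right_list_def comp_def)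
  also have "\<dots> = measure_pmf.prob (poisson_lists rate (K + k))
     {xs. stays_below b (take K xs) \<and> first_pass b (drop K xs)}"
    by (subst iid_poisson_prob_map[OF iid]) (auto simp: distinct_map inj_on_def)
  finally show ?thesis by (simp add: prob_replicate_pmf_split below_prob_def pass_prob_def)
qed

lemma prob_below: "prob {\<omega> \<in> space M. stays_below b (left_list (counts \<omega>) i K)} = below_prob b rate K"
proof -
  let ?js = "map (\<lambda>t. i - int t) [0..<K]"
  have "prob {\<omega> \<in> space M. stays_below b (left_list (counts \<omega>) i K)} =
    prob {\<omega> \<in> space M. stays_below b (map (\<lambda>j. X j \<omega>) ?js)}"
    by (simp add: left_list_def comp_def)
  also have "\<dots> = below_prob b rate K" unfolding below_prob_def
    by (subst iid_poisson_prob_map[OF iid]) (auto simp: distinct_map inj_on_def)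
  finally show ?thesis .
qed

lemma prob_first_window:
  "prob {\<omega> \<in> space M. b * l \<le> window_sum (counts \<omega>) i l \<and>
     (\<forall>l'\<in>{1..<l}. window_sum (counts \<omega>) i l' < b * l')} \<le> decay \<alpha> ^ l"
proof -
  have [measurable]: "(\<lambda>\<omega>. window_sum (counts \<omega>) i l) \<in> measurable M (count_space UNIV)" for i l
    by (rule measurable_window_sum) simp
  show ?thesis by (rule order.trans[OF finite_measure_mono prob_window]) auto
qed

lemma below_prob_tendsto:
  "below_prob b rate \<longlonglongrightarrow> prob {\<omega> \<in> space M. \<not> window_full b (counts \<omega>) i}"
proof -
  have "\<bar>below_prob b rate K - prob {\<omega> \<in> space M. \<not> window_full b (counts \<omega>) i}\<bar>
     \<le> decay \<alpha> ^ (K + 1) / (1 - decay \<alpha>)" for K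
    using truncated_window_bound[of M "\<lambda>\<omega> i. X i \<omega>" "decay \<alpha>" b i "space M" K]
      decay_bounds[OF \<alpha>] prob_first_window prob_space_axioms prob_below[of i K]
    by (simp add: Int_absorb2)
  then have "(\<lambda>K. below_prob b rate K - prob {\<omega> \<in> space M. \<not> window_full b (counts \<omega>) i}) \<longlonglongrightarrow> 0"
    by (intro Lim_null_comparison[OF _ decay_tail_tendsto[OF \<alpha>]]) auto
  then show ?thesis by (simp add: LIM_zero_iff)
qed

lemma nonfull_prob_eq: "prob {\<omega> \<in> space M. \<not> window_full b (counts \<omega>) i} = nonfull_prob b rate"
  using below_prob_tendsto[of i] by (simp add: nonfull_prob_def limI)

lemma below_prob_tendsto_nonfull: "below_prob b rate \<longlonglongrightarrow> nonfull_prob b rate"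
  using below_prob_tendsto[of 0] unfolding nonfull_prob_eq .

text \<open>With the condition left of s truncated to K buckets, the two conditions concern disjoint
  buckets and factor. The product converges both to the block probability and to the product of the
  limits.\<close>

lemma prob_is_block:
  assumes "k \<ge> 1"
  shows "prob {\<omega> \<in> space M. is_block (window_full b (counts \<omega>)) s (s + int k - 1)} =
    nonfull_prob b rate * pass_prob b rate k"
proof -
  define A where "A = {\<omega> \<in> space M. first_pass b (right_list (counts \<omega>) s k)}"
  have [measurable]: "(\<lambda>\<omega>. right_list (counts \<omega>) s k) \<in> measurable M (count_space UNIV)"
    by (rule measurable_right_list) simp
  have A: "A \<in> sets M" unfolding A_def by measurable
  let ?p = "prob {\<omega> \<in> space M. is_block (window_full b (counts \<omega>)) s (s + int k - 1)}"
  have "\<bar>below_prob b rate K * pass_prob b rate k - ?p\<bar> \<le> decay \<alpha> ^ (K + 1) / (1 - decay \<alpha>)" for K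
  proof -
    have "{\<omega> \<in> space M. stays_below b (left_list (counts \<omega>) (s - 1) K)} \<inter> A =
      {\<omega> \<in> space M. stays_below b (left_list (counts \<omega>) (s - 1) K) \<and>
     first_pass b (right_list (counts \<omega>) s k)}" by (auto simp: A_def)
    moreover have "{\<omega> \<in> space M. \<not> window_full b (counts \<omega>) (s - 1)} \<inter> A =
      {\<omega> \<in> space M. is_block (window_full b (counts \<omega>)) s (s + int k - 1)}"
      by (auto simp: A_def is_block_window_full[OF assms])
    ultimately show ?thesis
      using truncated_window_bound[of M "\<lambda>\<omega> i. X i \<omega>" "decay \<alpha>" b "s - 1" A K]
        decay_bounds[OF \<alpha>] prob_first_window prob_space_axioms prob_left_right[of s K k] A by simp
  qed
  then have "(\<lambda>K. below_prob b rate K * pass_prob b rate k - ?p) \<longlonglongrightarrow> 0"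
    by (intro Lim_null_comparison[OF _ decay_tail_tendsto[OF \<alpha>]]) auto
  then have "(\<lambda>K. below_prob b rate K * pass_prob b rate k) \<longlonglongrightarrow> ?p" by (simp add: LIM_zero_iff)
  moreover have "(\<lambda>K. below_prob b rate K * pass_prob b rate k) \<longlonglongrightarrow>
    nonfull_prob b rate * pass_prob b rate k"
    by (intro tendsto_intros below_prob_tendsto_nonfull)
  ultimately show ?thesis by (rule LIMSEQ_unique)
qed

text \<open>Borel-Cantelli: almost surely only finitely many windows ending at i are overfull, so
  the surpluses are bounded and the supremum is genuine.\<close>

lemma AE_infinite_full: "AE \<omega> in M. \<forall>i. infinite_full b (counts \<omega>) i = window_full b (counts \<omega>) i"
proof -
  have [measurable]: "(\<lambda>\<omega>. window_sum (counts \<omega>) i l) \<in> measurable M (count_space UNIV)" for i l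
    by (rule measurable_window_sum) simp
  have "AE \<omega> in M. infinite_full b (counts \<omega>) i = window_full b (counts \<omega>) i" for i
  proof -
    define E where "E l = {\<omega> \<in> space M. b * l \<le> window_sum (counts \<omega>) i l}" for l
    have "summable (\<lambda>l. prob (E l))"
    proof (rule summable_comparison_test_ev)
      show "summable (\<lambda>l. decay \<alpha> ^ l)" using decay_bounds[OF \<alpha>] by (intro summable_geometric) auto
      show "\<forall>\<^sub>F l in sequentially. norm (prob (E l)) \<le> decay \<alpha> ^ l"
        using prob_window[of _ i] by (auto simp: E_def)
    qed
    then have "AE \<omega> in M. \<forall>\<^sub>F l in sequentially. \<omega> \<in> space M - E l"
      by (intro borel_cantelli_AE1) (auto simp: E_def emeasure_eq_measure)
    then show ?thesis
    proof eventually_elim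
      case (elim \<omega>)
      then obtain l0 where l0: "\<And>l. l \<ge> l0 \<Longrightarrow> window_sum (counts \<omega>) i l < b * l"
        by (auto simp: eventually_sequentially E_def not_le)
      let ?g = "\<lambda>l. int (window_sum (counts \<omega>) i l) - int (b * l)"
      have "?g l \<le> Max (insert 0 (?g ` {..l0}))" for l
      proof (cases "l \<le> l0")
        case False
        then have "?g l \<le> 0" using l0[of l] by (simp del: of_nat_mult)
        also have "0 \<le> Max (insert 0 (?g ` {..l0}))" by (rule Max_ge) auto
        finally show ?thesis .
      qed (intro Max_ge; auto)
      then have "bdd_above (?g ` {1..})" by (auto simp: bdd_above_def)
      then show ?case by (rule infinite_full_window_full)
    qed
  qed
  then show ?thesis by (simp add: AE_all_countable)
qed

text \<open>A positive length is a finite union of block events, which are built from fullness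
  events; the length 0 is obtained as the complement of all the others.\<close>

lemma block_length_measurable:
  "(\<lambda>\<omega>. block_length (infinite_full b (counts \<omega>)) 0) \<in> measurable M (count_space UNIV)"
proof -
  have [measurable]: "(\<lambda>\<omega>. window_sum (counts \<omega>) i l) \<in> measurable M (count_space UNIV)" for i l
    by (rule measurable_window_sum) simp
  have [measurable]: "Measurable.pred M (\<lambda>\<omega>. window_full b (counts \<omega>) i)" for i
    by (rule measurable_window_full) simp
  have [measurable]: "Measurable.pred M (\<lambda>\<omega>. infinite_full b (counts \<omega>) i)" for i
  proof -
    have [measurable]: "Measurable.pred M (\<lambda>\<omega>. int (window_sum (counts \<omega>) i l) - int (b * l) \<le>
      B)" for l B
      by (rule measurable_compose[where N="count_space UNIV" and g="\<lambda>n. int n - int (b * l) \<le>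
        B"]) simp_all
    have [measurable]: "Measurable.pred M (\<lambda>\<omega>. \<exists>B. \<forall>l\<ge>1. int (window_sum (counts \<omega>) i l) - int (b *
      l) \<le> B)"
      by measurable
    show ?thesis unfolding infinite_full_iff if_bool_eq_conj by measurable
  qed
  have pos: "{\<omega> \<in> space M. block_length (infinite_full b (counts \<omega>)) 0 = k} \<in> sets M" if "k \<ge> 1" for k
    unfolding block_length_eq_iff[OF that] is_block_def by measurable
  have "{\<omega> \<in> space M. block_length (infinite_full b (counts \<omega>)) 0 = 0} =
     space M - (\<Union>k\<in>{1..}. {\<omega> \<in> space M. block_length (infinite_full b (counts \<omega>)) 0 = k})"
    by force
  also have "\<dots> \<in> sets M" using pos by auto
  finally have zero: "{\<omega> \<in> space M. block_length (infinite_full b (counts \<omega>)) 0 = 0} \<in> sets M" .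
  show ?thesis
  proof (subst measurable_count_space_eq_countable, safe)
    fix k
    have "(\<lambda>\<omega>. block_length (infinite_full b (counts \<omega>)) 0) -` {k} \<inter> space M =
      {\<omega> \<in> space M. block_length (infinite_full b (counts \<omega>)) 0 = k}" by auto
    then show "(\<lambda>\<omega>. block_length (infinite_full b (counts \<omega>)) 0) -` {k} \<inter> space M \<in> sets M"
      using pos[of k] zero by (cases "k = 0") auto
  qed auto
qed

text \<open>The factor k counts the positions that bucket 0 can take in its block. These events are
  disjoint, and all have the same probability by stationarity.\<close>

lemma prob_block_length:
  assumes "k \<ge> 1"
  shows "prob {\<omega> \<in> space M. block_length (infinite_full b (counts \<omega>)) 0 = k} =
    real k * (nonfull_prob b rate * pass_prob b rate k)"
proof -
  have [measurable]: "Measurable.pred M (\<lambda>\<omega>. window_full b (counts \<omega>) i)" for i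
    by (rule measurable_window_full) simp
  note block_length_measurable[measurable]
  define I where "I t = {\<omega> \<in> space M. is_block (window_full b (counts \<omega>)) (0 - int t) (0 - int t +
    int k - 1)}" for t
  have I: "I t \<in> sets M" for t unfolding I_def is_block_def by measurable
  have "prob {\<omega> \<in> space M. block_length (infinite_full b (counts \<omega>)) 0 = k} = prob (\<Union>t<k. I t)"
  proof (intro finite_measure_eq_AE)
    show "AE \<omega> in M. (\<omega> \<in> {\<omega> \<in> space M. block_length (infinite_full b (counts \<omega>)) 0 = k}) \<longleftrightarrow>
      (\<omega> \<in> (\<Union>t<k. I t))"
      using AE_infinite_full
    proof eventually_elim
      case (elim \<omega>)
      then have "infinite_full b (counts \<omega>) = window_full b (counts \<omega>)" by auto
      then show ?case using block_length_eq_iff[OF assms, of "window_full b (counts \<omega>)" 0]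
        by (auto simp: I_def)
    qed
  qed (use I in measurable)
  also have "\<dots> = (\<Sum>t<k. prob (I t))"
    using is_block_shift_disjoint[of _ 0 _ k] I
    by (intro finite_measure_finite_Union) (auto simp: disjoint_family_on_def I_def)
  also have "\<dots> = (\<Sum>t<k. nonfull_prob b rate * pass_prob b rate k)"
    unfolding I_def by (intro sum.cong refl prob_is_block[OF assms])
  finally show ?thesis by simp
qed

end

section \<open>Hash counts\<close>

abbreviation hash_prob :: "nat \<Rightarrow> nat \<Rightarrow> nat list set \<Rightarrow> real" where
  "hash_prob m n \<equiv> measure_pmf.prob (hash_addresses m n)"

lemma hash_addresses_support:
  "m > 0 \<Longrightarrow> as \<in> set_pmf (hash_addresses m n) \<Longrightarrow> set as \<subseteq> {..<m} \<and> length as = n"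
  by (auto simp: hash_addresses_def set_replicate_pmf set_pmf_of_set lists_eq_set lessThan_empty_iff)

lemma finite_hash_addresses: "m > 0 \<Longrightarrow> finite (set_pmf (hash_addresses m n))"
proof -
  assume m: "m > 0"
  have "set_pmf (hash_addresses m n) \<subseteq> {xs. set xs \<subseteq> {..<m} \<and> length xs = n}"
    using hash_addresses_support[OF m] by auto
  then show ?thesis by (rule finite_subset) (intro finite_lists_length_eq, simp)
qed

lemma expectation_hash_addresses_Suc:
  fixes h :: "nat list \<Rightarrow> real"
  assumes m: "m > 0"
  shows "measure_pmf.expectation (hash_addresses m (Suc n)) h =
    (\<Sum>a<m. measure_pmf.expectation (hash_addresses m n) (\<lambda>as. h (a # as))) / real m"
proof -
  have "hash_addresses m (Suc n) = pmf_of_set {..<m} \<bind> (\<lambda>a. map_pmf ((#) a) (hash_addresses m n))"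
    by (simp add: hash_addresses_def map_pmf_def)
  then show ?thesis
    using m finite_hash_addresses[OF m]
    by (simp add: pmf_expectation_bind_pmf_of_set lessThan_empty_iff sum_distrib_left divide_inverse mult.commute)
qed

lemma prob_hash_addresses_Suc:
  assumes m: "m > 0"
  shows "hash_prob m (Suc n) {as. Q as} =
    (\<Sum>a<m. hash_prob m n {as. Q (a # as)}) / real m"
proof -
  have "hash_prob m (Suc n) {as. Q as} =
    measure_pmf.expectation (hash_addresses m (Suc n)) (indicator {as. Q as})" by simp
  also have "\<dots> = (\<Sum>a<m. measure_pmf.expectation (hash_addresses m n) (indicator {as. Q
    (a # as)})) / real m"
  proof -
    have "indicator {as. Q as} (a # as) = (indicator {as. Q (a # as)} as :: real)" for a as
      by (simp add: indicator_def)
    then show ?thesis unfolding expectation_hash_addresses_Suc[OF m] by (simp only:)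
  qed
  finally show ?thesis by simp
qed

text \<open>Each key contributes an independent factor, equal to z with probability
  \<open>card J / m\<close> and to 1 otherwise.\<close>

lemma expectation_power_hash_count:
  assumes m: "m > 0" and J: "J \<subseteq> {..<m}"
  shows "measure_pmf.expectation (hash_addresses m n) (\<lambda>as. z ^ (\<Sum>j\<in>J. count_list as j)) =
    (1 + real (card J) * (z - 1) / real m) ^ n"
proof (induction n)
  case 0
  show ?case by (simp add: hash_addresses_def)
next
  case (Suc n)
  have fin: "finite J" using J finite_subset by blast
  have cnt: "(\<Sum>j\<in>J. count_list (a # as) j) = of_bool (a \<in> J) + (\<Sum>j\<in>J. count_list as j)" for a as
  proof -
    have "(\<Sum>j\<in>J. count_list (a # as) j) = (\<Sum>j\<in>J. (if j = a then 1 else 0) + count_list as j)"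
      by (intro sum.cong) auto
    then show ?thesis using fin by (simp add: sum.distrib)
  qed
  have "measure_pmf.expectation (hash_addresses m (Suc n)) (\<lambda>as. z ^ (\<Sum>j\<in>J. count_list as j)) =
    (\<Sum>a<m. z ^ of_bool (a \<in> J)) * (1 + real (card J) * (z - 1) / real m) ^ n / real m"
    unfolding expectation_hash_addresses_Suc[OF m] cnt by (simp add: power_add Suc sum_distrib_right)
  also have "(\<Sum>a<m. z ^ of_bool (a \<in> J)) = (\<Sum>a<m. 1 + (z - 1) * of_bool (a \<in> J))"
    by (intro sum.cong) auto
  also have "\<dots> = real m + (z - 1) * real (card J)"
    using J by (simp add: sum.distrib sum_distrib_left[symmetric] Int_absorb1 del: sum_mult_of_bool_eq)
  finally show ?case using m by (simp add: field_simps)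
qed

text \<open>Chernoff again; \<open>1 + u \<le> exp u\<close> brings the binomial moment into the
  Poisson shape, so that both models have the same rate.\<close>

lemma hash_window_bound:
  assumes m: "m > 0" and J: "J \<subseteq> {..<m}" and z: "z \<ge> 1" and card: "card J = l"
  shows "hash_prob m n {as. c \<le> (\<Sum>j\<in>J. count_list as j)} \<le>
    exp (real n * (real l * (z - 1) / real m)) / z ^ c"
proof -
  let ?p = "hash_addresses m n"
  have "measure_pmf.prob ?p {as. c \<le> (\<Sum>j\<in>J. count_list as j)} =
    measure_pmf.expectation ?p (indicator {as. c \<le> (\<Sum>j\<in>J. count_list as j)})" by simp
  also have "\<dots> \<le> measure_pmf.expectation ?p (\<lambda>as. z ^ (\<Sum>j\<in>J. count_list as j) / z ^ c)"
  proof (intro integral_mono integrable_measure_pmf_finite finite_hash_addresses m)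
    fix as
    have "1 \<le> z ^ (\<Sum>j\<in>J. count_list as j) / z ^ c" if "c \<le> (\<Sum>j\<in>J. count_list as j)"
      using power_increasing[OF that z] z by simp
    then show "indicator {as. c \<le> (\<Sum>j\<in>J. count_list as j)} as \<le> z ^ (\<Sum>j\<in>J. count_list as j) / z ^ c"
      using z by (auto simp: indicator_def)
  qed
  also have "\<dots> = (1 + real l * (z - 1) / real m) ^ n / z ^ c"
    using expectation_power_hash_count[OF m J, of n z] card by simp
  also have "\<dots> \<le> exp (real l * (z - 1) / real m) ^ n / z ^ c"
    using z by (intro divide_right_mono power_mono exp_ge_add_one_self) auto
  finally show ?thesis by (simp only: exp_of_nat_mult)
qed

text \<open>A multinomial probability in which all buckets outside \<open>js\<close> form one
  further class. Conditioning on the first key reproduces Pascal's rule. If the prescribed counts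
  exceed n, the binomial coefficient is 0, which takes care of the truncated exponent.\<close>

lemma prob_hash_counts:
  assumes m: "m > 0" and js: "inj_on js {..<L}" "js ` {..<L} \<subseteq> {..<m}"
  shows "hash_prob m n {as. \<forall>i<L. count_list as (js i) = x i} =
    real (n choose (\<Sum>i<L. x i)) * fact (\<Sum>i<L. x i) / (\<Prod>i<L. fact (x i)) *
      (1 / real m) ^ (\<Sum>i<L. x i) * (1 - real L / real m) ^ (n - (\<Sum>i<L. x i))"
proof (induction n arbitrary: x)
  case 0
  show ?case
  proof (cases "\<forall>i<L. x i = 0")
    case True
    then have "(\<Sum>i<L. x i) = 0" "(\<Prod>i<L. fact (x i)) = (1 :: real)" by auto
    then show ?thesis using True by (simp add: hash_addresses_def measure_pmf_single indicator_def)
  next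
    case False
    then have "(\<Sum>i<L. x i) \<noteq> 0" by auto
    then have "0 choose (\<Sum>i<L. x i) = 0" by (intro binomial_eq_0) linarith
    moreover have "{as :: nat list. as = [] \<and> (\<forall>i<L. count_list as (js i) = x i)} = {}" using False
      by auto
    ultimately show ?thesis using False by (simp add: hash_addresses_def indicator_def)
  qed
next
  case (Suc n)
  define W where "W n x = real (n choose (\<Sum>i<L. x i)) * fact (\<Sum>i<L. x i) / (\<Prod>i<L. fact (x i)) *
      (1 / real m) ^ (\<Sum>i<L. x i) * (1 - real L / real m) ^ (n - (\<Sum>i<L. x i))" for n x
  define S where "S = (\<Sum>i<L. x i)"
  define \<beta> where "\<beta> = 1 - real L / real m"
  have Lm: "card (js ` {..<L}) = L" "L \<le> m"
    using js card_image[OF js(1)] card_mono[OF _ js(2)] by auto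
  define P where "P a = hash_prob m n {as. \<forall>i<L. count_list (a # as) (js i) = x i}" for a
  have out: "P a = W n x" if "a \<notin> js ` {..<L}" for a
  proof -
    have "{as. \<forall>i<L. count_list (a # as) (js i) = x i} = {as. \<forall>i<L. count_list as (js i) = x i}"
      using that by auto
    then show ?thesis unfolding P_def W_def by (simp only: Suc)
  qed
  \<comment> \<open>A first key in bucket \<open>js i\<close> uses up one of its \<open>x i\<close>
    keys; the factor \<open>x i\<close> makes the formula vanish when none is prescribed.\<close>
  have inn: "P (js i) = real (n choose (S - 1)) * fact (S - 1) * real (x i) / (\<Prod>i<L. fact (x i)) *
      (1 / real m) ^ (S - 1) * \<beta> ^ (n - (S - 1))" if i: "i < L" for i
  proof (cases "x i = 0")
    case True
    then have "{as. \<forall>i'<L. count_list (js i # as) (js i') = x i'} = {}" using i by force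
    then show ?thesis unfolding P_def by (simp only: True) simp
  next
    case False
    define y where "y = x(i := x i - 1)"
    have "{as. \<forall>i'<L. count_list (js i # as) (js i') = x i'} = {as. \<forall>i'<L. count_list as (js i') = y i'}"
    proof -
      have "count_list (js i # as) (js i') = x i' \<longleftrightarrow> count_list as (js i') = y i'" if "i' < L" for i' as
      proof (cases "i' = i")
        case True
        then show ?thesis using False by (auto simp: y_def)
      next
        case ne: False
        then have "js i \<noteq> js i'" using inj_onD[OF js(1), of i i'] i that by auto
        then show ?thesis using ne by (simp add: y_def)
      qed
      then show ?thesis by (intro Collect_cong all_cong) auto
    qed
    then have "P (js i) = W n y" unfolding P_def W_def by (simp only: Suc)
    moreover have "S = (\<Sum>i<L. y i) + 1"
    proof -
      have "S = x i + (\<Sum>j\<in>{..<L} - {i}. x j)" unfolding S_def using i by (intro sum.remove) auto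
      moreover have "(\<Sum>i<L. y i) = y i + (\<Sum>j\<in>{..<L} - {i}. y j)" using i by (intro sum.remove) auto
      moreover have "(\<Sum>j\<in>{..<L} - {i}. y j) = (\<Sum>j\<in>{..<L} - {i}. x j)"
        by (intro sum.cong) (auto simp: y_def)
      ultimately show ?thesis using False by (simp add: y_def)
    qed
    then have Sy: "(\<Sum>i<L. y i) = S - 1" by simp
    have "(\<Prod>i<L. fact (x i) :: real) = real (x i) * (\<Prod>i<L. fact (y i))"
    proof -
      have "(\<Prod>i<L. fact (x i) :: real) = fact (x i) * (\<Prod>j\<in>{..<L} - {i}. fact (x j))"
        using i by (intro prod.remove) auto
      moreover have "(\<Prod>i<L. fact (y i) :: real) = fact (y i) * (\<Prod>j\<in>{..<L} - {i}. fact (y j))"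
        using i by (intro prod.remove) auto
      moreover have "(\<Prod>j\<in>{..<L} - {i}. fact (y j) :: real) = (\<Prod>j\<in>{..<L} - {i}. fact (x j))"
        by (intro prod.cong) (auto simp: y_def)
      moreover have "(fact (x i) :: real) = real (x i) * fact (y i)"
        using False by (simp add: y_def fact_reduce)
      ultimately show ?thesis by simp
    qed
    moreover have "(\<Prod>i<L. fact (y i) :: real) \<noteq> 0" by simp
    ultimately show ?thesis
      using False unfolding W_def Sy \<beta>_def by (simp add: field_simps)
  qed
  have "hash_prob m (Suc n) {as. \<forall>i<L. count_list as (js i) = x i} = (\<Sum>a<m. P a) / real m"
    unfolding prob_hash_addresses_Suc[OF m] P_def ..
  also have "(\<Sum>a<m. P a) = (\<Sum>a\<in>{..<m} - js ` {..<L}. P a) + (\<Sum>a\<in>js ` {..<L}. P a)"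
    using js by (intro sum.subset_diff) auto
  also have "(\<Sum>a\<in>{..<m} - js ` {..<L}. P a) = real (m - L) * W n x"
    using out js Lm by (simp add: card_Diff_subset)
  also have "(\<Sum>a\<in>js ` {..<L}. P a) = (\<Sum>i<L. P (js i))" using js(1) by (simp add: sum.reindex)
  also have "(\<Sum>i<L. P (js i)) = real (n choose (S - 1)) * fact (S - 1) * real S / (\<Prod>i<L. fact (x i)) *
      (1 / real m) ^ (S - 1) * \<beta> ^ (n - (S - 1))"
    by (simp add: inn S_def sum_distrib_left sum_distrib_right sum_divide_distrib)
  finally have eq: "hash_prob m (Suc n) {as. \<forall>i<L. count_list as (js i) = x i} =
    (real (m - L) * W n x + real (n choose (S - 1)) * fact (S - 1) * real S / (\<Prod>i<L. fact (x i)) *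
      (1 / real m) ^ (S - 1) * \<beta> ^ (n - (S - 1))) / real m" .
  have \<beta>m: "real (m - L) = real m * \<beta>" using m Lm by (simp add: \<beta>_def of_nat_diff field_simps)
  have Wn: "W n x = real (n choose S) * fact S / (\<Prod>i<L. fact (x i)) * (1 / real m) ^ S * \<beta> ^ (n - S)"
    by (simp add: W_def S_def \<beta>_def)
  have goal: "(real (m - L) * W n x + real (n choose (S - 1)) * fact (S - 1) *
    real S / (\<Prod>i<L. fact (x i)) *
      (1 / real m) ^ (S - 1) * \<beta> ^ (n - (S - 1))) / real m =
    real (Suc n choose S) * fact S / (\<Prod>i<L. fact (x i)) * (1 / real m) ^ S * \<beta> ^ (Suc n - S)"
  proof (cases S)
    case 0
    then show ?thesis using m by (simp add: Wn \<beta>m)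
  next
    case (Suc S')
    \<comment> \<open>For S > n both sides are 0, although the truncated exponents do not
      match.\<close>
    have 1: "real (n choose S) * \<beta> ^ (n - S) * \<beta> = real (n choose S) * \<beta> ^ (n - S')"
    proof (cases "S \<le> n")
      case True
      then have "n - S' = Suc (n - S)" using Suc by simp
      then show ?thesis by simp
    qed (simp add: binomial_eq_0)
    have "(real (m - L) * W n x + real (n choose (S - 1)) * fact (S - 1) * real S / (\<Prod>i<L. fact (x i)) *
      (1 / real m) ^ (S - 1) * \<beta> ^ (n - (S - 1))) / real m =
      (real (n choose S) * \<beta> ^ (n - S) * \<beta>) * (fact S / (\<Prod>i<L. fact (x i)) * (1 / real m) ^ S) +
      real (n choose S') * \<beta> ^ (n - S') * (fact S / (\<Prod>i<L. fact (x i)) * (1 / real m) ^ S)"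
      using m Suc by (simp add: Wn \<beta>m field_simps)
    also have "\<dots> = real (Suc n choose S) * fact S / (\<Prod>i<L. fact (x i)) * (1 / real m) ^ S *
      \<beta> ^ (Suc n - S)"
      unfolding 1 using Suc by (simp add: algebra_simps add_divide_distrib)
    finally show ?thesis .
  qed
  show ?case using eq goal by (simp add: S_def \<beta>_def)
qed

text \<open>The law of rare events for finitely many buckets: the falling factorial over
  \<open>m ^ S\<close> tends to \<open>r ^ S\<close>, and the keys missing all L buckets contribute
  \<open>exp (- r * L)\<close>. The positions may move with t, since the observed bucket
  does.\<close>

lemma hash_counts_limit:
  fixes m n :: "nat \<Rightarrow> nat" and js :: "nat \<Rightarrow> nat \<Rightarrow> nat"
  assumes m: "filterlim m at_top sequentially" and n: "filterlim n at_top sequentially"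
    and r: "(\<lambda>t. real (n t) / real (m t)) \<longlonglongrightarrow> r" "r > 0"
    and js: "eventually (\<lambda>t. inj_on (js t) {..<length xs} \<and>
      js t ` {..<length xs} \<subseteq> {..<m t}) sequentially"
  shows "(\<lambda>t. hash_prob (m t) (n t) {as. \<forall>i<length xs. count_list as (js t i) = xs ! i}) \<longlonglongrightarrow>
    pmf (poisson_lists r (length xs)) xs"
proof -
  define L where "L = length xs"
  define S where "S = (\<Sum>i<L. xs ! i)"
  define c where "c = (\<Prod>i<L. fact (xs ! i) :: real)"
  have mp: "eventually (\<lambda>t. m t > L) sequentially"
    using m[unfolded filterlim_at_top, rule_format, of "Suc L"] by (simp add: Suc_le_eq)
  have np: "eventually (\<lambda>t. n t \<ge> S) sequentially"
    using n by (simp add: filterlim_at_top)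
  have mr: "filterlim (\<lambda>t. real (m t)) at_top sequentially"
    by (rule filterlim_compose[OF filterlim_real_sequentially m])
  have m0: "(\<lambda>t. 1 / real (m t)) \<longlonglongrightarrow> 0"
    using tendsto_divide_0[OF tendsto_const filterlim_at_top_imp_at_infinity[OF mr]] by simp
  have ff: "(\<lambda>t. (\<Prod>i<S. (real (n t) - real i) / real (m t))) \<longlonglongrightarrow> (\<Prod>i<S. r)"
  proof (intro tendsto_prod)
    fix i
    have "(\<lambda>t. real (n t) / real (m t) - real i * (1 / real (m t))) \<longlonglongrightarrow> r - real i * 0"
      by (intro tendsto_intros r m0)
    then show "(\<lambda>t. (real (n t) - real i) / real (m t)) \<longlonglongrightarrow> r" by (simp add: diff_divide_distrib)
  qed
  \<comment> \<open>The power with exponent n is written as exp of n/m times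
    \<open>m * ln (1 - L / m)\<close>, which separates the load from a limit in m alone.\<close>
  have "(\<lambda>t. real (m t) * ln (1 - real L / real (m t))) \<longlonglongrightarrow> - real L"
  proof -
    have "((\<lambda>y::real. y * ln (1 - real L / y)) \<longlongrightarrow> - real L) at_top" by real_asymp
    from filterlim_compose[OF this mr] show ?thesis .
  qed
  then have "(\<lambda>t. (real (n t) / real (m t)) * (real (m t) * ln (1 - real L / real (m t)))) \<longlonglongrightarrow>
    r * (- real L)"
    by (intro tendsto_mult r)
  then have "(\<lambda>t. exp ((real (n t) / real (m t)) * (real (m t) * ln (1 - real L / real (m t))))) \<longlonglongrightarrow>
    exp (r * (- real L))"
    by (rule tendsto_exp)
  moreover have "eventually (\<lambda>t. exp ((real (n t) / real (m t)) * (real (m t) *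
    ln (1 - real L / real (m t)))) =
      (1 - real L / real (m t)) ^ n t) sequentially"
    using mp
  proof eventually_elim
    case (elim t)
    then have "(real (n t) / real (m t)) * (real (m t) * ln (1 - real L / real (m t))) =
      real (n t) * ln (1 - real L / real (m t))"
      and "1 - real L / real (m t) > 0" by auto
    then show ?case by (simp add: exp_of_nat_mult)
  qed
  ultimately have pw: "(\<lambda>t. (1 - real L / real (m t)) ^ n t) \<longlonglongrightarrow> exp (r * (- real L))"
    by (rule Lim_transform_eventually)
  have "(\<lambda>t. 1 - real L * (1 / real (m t))) \<longlonglongrightarrow> 1 - real L * 0" by (intro tendsto_intros m0)
  then have b1: "(\<lambda>t. (1 - real L / real (m t)) ^ S) \<longlonglongrightarrow> 1" using tendsto_power[of _ 1 sequentially S]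
    by fastforce
  have lim: "(\<lambda>t. (\<Prod>i<S. (real (n t) - real i) / real (m t)) / c *
    ((1 - real L / real (m t)) ^ n t / (1 - real L / real (m t)) ^ S))
     \<longlonglongrightarrow> (\<Prod>i<S. r) / c * (exp (r * (- real L)) / 1)"
    by (intro tendsto_intros ff pw b1) (auto simp: c_def)
  have "eventually (\<lambda>t. (\<Prod>i<S. (real (n t) - real i) / real (m t)) / c *
    ((1 - real L / real (m t)) ^ n t / (1 - real L / real (m t)) ^ S) =
    hash_prob (m t) (n t) {as. \<forall>i<length xs. count_list as (js t i) = xs ! i}) sequentially"
    using mp np js
  proof eventually_elim
    case (elim t)
    then have "m t > 0" and \<beta>: "1 - real L / real (m t) \<noteq> 0" by auto
    have "(1 - real L / real (m t)) ^ n t / (1 - real L / real (m t)) ^ S =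
      (1 - real L / real (m t)) ^ (n t - S)"
      using elim \<beta> by (simp add: power_diff)
    moreover have "real (n t choose S) * fact S = (\<Prod>i<S. real (n t) - real i)"
      using elim(2) by (simp add: binomial_gbinomial gbinomial_prod_rev atLeast0LessThan)
    moreover have "(\<Prod>i<S. (real (n t) - real i) / real (m t)) =
      (\<Prod>i<S. real (n t) - real i) * (1 / real (m t)) ^ S"
      by (simp add: prod_dividef power_one_over)
    ultimately show ?case
      using prob_hash_counts[OF \<open>m t > 0\<close>, of "js t" L "n t" "\<lambda>i. xs ! i"] elim(3)
      by (simp add: L_def S_def c_def mult_ac)
  qed
  with lim have "(\<lambda>t. hash_prob (m t) (n t) {as. \<forall>i<length xs. count_list as (js t i) = xs ! i})
    \<longlonglongrightarrow> (\<Prod>i<S. r) / c * (exp (r * (- real L)) / 1)"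
    by (rule Lim_transform_eventually)
  moreover have "(\<Prod>i<S. r) / c * (exp (r * (- real L)) / 1) = pmf (poisson_lists r (length xs)) xs"
  proof -
    have "pmf (poisson_lists r (length xs)) xs = (\<Prod>i<L. r ^ (xs ! i) / fact (xs ! i) * exp (- r))"
    proof -
      have "prod_list (map g xs) = (\<Prod>i<length xs. g (xs ! i))" for g :: "nat \<Rightarrow> real"
        by (induction xs) (simp_all add: prod.lessThan_Suc_shift del: prod.lessThan_Suc)
      then show ?thesis using r(2) by (simp add: pmf_replicate_pmf L_def)
    qed
    also have "\<dots> = r ^ S / c * exp (- r) ^ L"
      by (simp add: prod.distrib prod_dividef S_def c_def power_sum)
    also have "exp (- r) ^ L = exp (r * (- real L))"
      by (simp add: exp_of_nat_mult[symmetric] mult.commute)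
    finally show ?thesis by simp
  qed
  ultimately show ?thesis by simp
qed

section \<open>Blocks in the exact model\<close>

lemma inj_on_mod:
  assumes "inj_on p A" "\<And>t t'. t \<in> A \<Longrightarrow> t' \<in> A \<Longrightarrow> \<bar>p t - p t'\<bar> < int m"
  shows "inj_on (\<lambda>t. nat (p t mod int m)) A"
proof (rule inj_onI)
  fix t t' assume t: "t \<in> A" "t' \<in> A" "nat (p t mod int m) = nat (p t' mod int m)"
  have "m > 0" using assms(2)[OF t(1,1)] by simp
  then have "p t mod int m = p t' mod int m" using t(3) by (simp add: eq_nat_nat_iff)
  then have "int m dvd p t - p t'" by (rule mod_eq_dvd_iff[THEN iffD1])
  then have "p t - p t' = 0" 
    using assms(2)[OF t(1,2)] dvd_imp_le_int[of "p t - p t'" "int m"] by linarith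
  then show "t = t'" using assms(1) t by (auto dest: inj_onD)
qed

lemma prob_map_finite:
  assumes "finite C"
  shows "measure_pmf.prob p {x. f x \<in> C} = (\<Sum>c\<in>C. measure_pmf.prob p {x. f x = c})"
proof -
  have "measure_pmf.prob p {x. f x \<in> C} = measure_pmf.prob (map_pmf f p) C"
    by (simp add: vimage_def)
  also have "\<dots> = (\<Sum>c\<in>C. pmf (map_pmf f p) c)" using assms by (rule measure_measure_pmf_finite)
  finally show ?thesis by (simp add: pmf_map vimage_def)
qed

text \<open>Both conditions bound the number of keys from above, hence every entry. Finiteness is
  what lets the limits of point probabilities be summed.\<close>

lemma finite_passing_lists:
  "finite {xs. length xs = K + k \<and> stays_below b (take K xs) \<and> first_pass b (drop K xs)}"
proof (rule finite_subset)
  show "finite {xs. set xs \<subseteq> {..b * (K + k)} \<and> length xs = K + k}"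
    by (intro finite_lists_length_eq) simp
  show "{xs. length xs = K + k \<and> stays_below b (take K xs) \<and> first_pass b (drop K xs)} \<subseteq>
    {xs. set xs \<subseteq> {..b * (K + k)} \<and> length xs = K + k}"
  proof safe
    fix xs x assume xs: "length xs = K + k" "stays_below b (take K xs)" "first_pass b (drop K xs)"
      "x \<in> set xs"
    have "x \<in> set (take K xs) \<or> x \<in> set (drop K xs)"
      using xs(4) by (metis Un_iff append_take_drop_id set_append)
    then show "x \<le> b * (K + k)"
    proof
      assume x: "x \<in> set (take K xs)"
      then have "K \<ge> 1" by (cases K) auto
      then have "sum_list (take K xs) < b * K"
        using xs(1,2) by (auto simp: stays_below_def dest!: bspec[of _ _ K])
      with member_le_sum_list[OF x] show ?thesis by (simp add: algebra_simps)
    next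
      assume x: "x \<in> set (drop K xs)"
      have "sum_list (drop K xs) < b * k" using xs by (auto simp: first_pass_def)
      with member_le_sum_list[OF x] show ?thesis by (simp add: algebra_simps)
    qed
  qed
qed

lemma below_pass_prob_sum:
  "below_prob b r K * pass_prob b r k =
    (\<Sum>xs\<in>{xs. length xs = K + k \<and> stays_below b (take K xs) \<and> first_pass b (drop K xs)}.
       pmf (poisson_lists r (K + k)) xs)"
proof -
  have "below_prob b r K * pass_prob b r k =
    measure_pmf.prob (poisson_lists r (K + k)) {xs. stays_below b (take K xs) \<and>
      first_pass b (drop K xs)}"
    by (simp add: below_prob_def pass_prob_def prob_replicate_pmf_split)
  also have "\<dots> = measure_pmf.prob (poisson_lists r (K + k))
      {xs. length xs = K + k \<and> stays_below b (take K xs) \<and> first_pass b (drop K xs)}"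
    by (intro measure_pmf.finite_measure_eq_AE) (auto simp: AE_measure_pmf_iff set_replicate_pmf)
  finally show ?thesis by (simp add: measure_measure_pmf_finite[OF finite_passing_lists])
qed

lemma hash_left_right_limit:
  fixes m n :: "nat \<Rightarrow> nat" and s :: "nat \<Rightarrow> int"
  assumes m: "filterlim m at_top sequentially" and n: "filterlim n at_top sequentially"
    and r: "(\<lambda>t. real (n t) / real (m t)) \<longlonglongrightarrow> r" "r > 0"
  shows "(\<lambda>t. hash_prob (m t) (n t)
      {as. stays_below b (left_list (hash_count (m t) as) (s t - 1) K) \<and>
        first_pass b (right_list (hash_count (m t) as) (s t) k)}) \<longlonglongrightarrow> below_prob b r K * pass_prob b r k"
proof -
  define C where "C = {xs. length xs = K + k \<and> stays_below b (take K xs) \<and> first_pass b (drop K xs)}"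
  define f where "f t as = left_list (hash_count (m t) as) (s t - 1) K @ right_list (hash_count
    (m t) as) (s t) k" for t as
  define p where "p t i = (if i < K then s t - 1 - int i else s t + int (i - K))" for t i
  define js where "js t i = nat (p t i mod int (m t))" for t i
  have fin: "finite C" unfolding C_def by (rule finite_passing_lists)
  have ev: "{as. stays_below b (left_list (hash_count (m t) as) (s t - 1) K) \<and>
        first_pass b (right_list (hash_count (m t) as) (s t) k)} = {as. f t as \<in> C}" for t
    by (auto simp: C_def f_def)
  \<comment> \<open>The K + k positions are consecutive integers, so they fall into distinct buckets
    of the cycle as soon as m is larger than their number.\<close>
  have js: "eventually (\<lambda>t. inj_on (js t) {..<K + k} \<and> js t ` {..<K + k} \<subseteq> {..<m t}) sequentially"
    using m[unfolded filterlim_at_top, rule_format, of "K + k + 1"]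
  proof eventually_elim
    case (elim t)
    have "inj_on (p t) {..<K + k}" by (auto simp: inj_on_def p_def split: if_splits)
    moreover have "\<bar>p t i - p t j\<bar> < int (m t)" if "i \<in> {..<K + k}" "j \<in> {..<K + k}" for i j
      using that elim by (auto simp: p_def)
    ultimately have "inj_on (js t) {..<K + k}" unfolding js_def by (rule inj_on_mod)
    moreover have "js t ` {..<K + k} \<subseteq> {..<m t}" using elim by (auto simp: js_def nat_less_iff)
    ultimately show ?case by blast
  qed
  have eq: "{as. f t as = xs} = {as. \<forall>i<length xs. count_list as (js t i) = xs ! i}"
    if "length xs = K + k" for xs t
  proof -
    have "f t as = xs \<longleftrightarrow> (\<forall>i<length xs. f t as ! i = xs ! i)" for as
      using that by (auto simp: list_eq_iff_nth_eq f_def)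
    moreover have "f t as ! i = count_list as (js t i)" if "i < K + k" for i as
      using that by (auto simp: f_def js_def p_def nth_append left_list_def right_list_def hash_count_def)
    ultimately show ?thesis using that by auto
  qed
  have "(\<lambda>t. \<Sum>xs\<in>C. hash_prob (m t) (n t) {as. f t as = xs}) \<longlonglongrightarrow>
     (\<Sum>xs\<in>C. pmf (poisson_lists r (K + k)) xs)"
  proof (rule tendsto_sum)
    fix xs assume "xs \<in> C"
    then have len: "length xs = K + k" by (simp add: C_def)
    show "(\<lambda>t. hash_prob (m t) (n t) {as. f t as = xs}) \<longlonglongrightarrow>
       pmf (poisson_lists r (K + k)) xs"
      unfolding eq[OF len] using hash_counts_limit[OF m n r, of js xs] js len by simp
  qed
  then show ?thesis
    unfolding ev prob_map_finite[OF fin] below_pass_prob_sum C_def[symmetric] .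
qed

section \<open>Exponential bounds uniform over the exact models\<close>

context poisson_load
begin

text \<open>The buckets of the window are distinct because \<open>l \<le> m\<close>. Here
  \<open>a\<close> is an upper bound for the load rather than the load, so that one rate serves all
  late tables of a sequence.\<close>

lemma prob_hash_window:
  assumes m: "m > 0" and l: "l \<le> m" and a: "0 < a" "a < 1" and n: "real n \<le> real b * a * real m"
  shows "hash_prob m n {as. b * l \<le> window_sum (hash_count m as) i l} \<le> decay a ^ l"
proof -
  define J where "J = (\<lambda>t. nat ((i - int t) mod int m)) ` {..<l}"
  have inj: "inj_on (\<lambda>t. nat ((i - int t) mod int m)) {..<l}"
    using l by (intro inj_on_mod) (auto simp: inj_on_def)
  have J: "J \<subseteq> {..<m}" "card J = l" using m by (auto simp: J_def card_image[OF inj] nat_less_iff)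
  have "window_sum (hash_count m as) i l = (\<Sum>j\<in>J. count_list as j)" for as
    unfolding J_def sum.reindex[OF inj] by (simp add: window_sum_def hash_count_def)
  then have "hash_prob m n {as. b * l \<le> window_sum (hash_count m as) i l} \<le>
    exp (real n * (real l * (1 / a - 1) / real m)) / (1 / a) ^ (b * l)"
    using hash_window_bound[OF m J(1) _ J(2), of "1 / a" n "b * l"] a by simp
  also have "\<dots> \<le> exp (real (b * l) * (1 - a)) / (1 / a) ^ (b * l)"
  proof (intro divide_right_mono, subst exp_le_cancel_iff)
    have "real n * (real l * (1 / a - 1) / real m) = (real n / real m) * (real l * (1 / a - 1))" by simp
    also have "\<dots> \<le> (real b * a) * (real l * (1 / a - 1))"
    proof (rule mult_right_mono)
      show "real n / real m \<le> real b * a" using n m by (simp add: divide_le_eq)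
      show "0 \<le> real l * (1 / a - 1)" using a by simp
    qed
    also have "\<dots> = real (b * l) * (a * (1 / a - 1))" by (simp only: of_nat_mult mult_ac)
    also have "a * (1 / a - 1) = 1 - a" using a by (simp add: right_diff_distrib)
    finally show "real n * (real l * (1 / a - 1) / real m) \<le> real (b * l) * (1 - a)" .
  qed (use a in simp)
  also have "\<dots> = decay a ^ l"
  proof -
    have "exp (real (b * l) * (1 - a)) = exp (1 - a) ^ (b * l)" by (rule exp_of_nat_mult)
    moreover have "(1 / a) ^ (b * l) = 1 / a ^ (b * l)" by (rule power_one_over)
    ultimately show ?thesis by (simp add: decay_def power_mult_distrib power_mult)
  qed
  finally show ?thesis .
qed

text \<open>A window longer than a period cannot be the first overfull one, so the bound holds for
  all l.\<close>

lemma prob_hash_first_window: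
  assumes a: "0 < a" "a < 1" and n: "real n \<le> real b * a * real m" "n < b * m"
  shows "hash_prob m n {as. b * l \<le> window_sum (hash_count m as) i l \<and>
    (\<forall>l'\<in>{1..<l}. window_sum (hash_count m as) i l' < b * l')} \<le> decay a ^ l"
proof -
  have m: "m > 0" using n by (cases m) auto
  show ?thesis
  proof (cases "l \<le> m")
    case True
    show ?thesis
      by (rule order.trans[OF measure_pmf.finite_measure_mono prob_hash_window[OF m True a n(1), of i]]) auto
  next
    case False
    have "hash_prob m n {as. b * l \<le> window_sum (hash_count m as) i l \<and>
      (\<forall>l'\<in>{1..<l}. window_sum (hash_count m as) i l' < b * l')} = hash_prob m n {}"
    proof (intro measure_pmf.finite_measure_eq_AE)
      show "AE as in hash_addresses m n. as \<in> {as. b * l \<le> window_sum (hash_count m as) i l \<and>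
        (\<forall>l'\<in>{1..<l}. window_sum (hash_count m as) i l' < b * l')} \<longleftrightarrow> as \<in> {}"
        unfolding AE_measure_pmf_iff
      proof
        fix as assume "as \<in> set_pmf (hash_addresses m n)"
        then have "set as \<subseteq> {..<m}" "length as = n" using hash_addresses_support[OF m] by auto
        then show "as \<in> {as. b * l \<le> window_sum (hash_count m as) i l \<and>
          (\<forall>l'\<in>{1..<l}. window_sum (hash_count m as) i l' < b * l')} \<longleftrightarrow> as \<in> {}"
          using first_window_le_period[of as m b l i] False n(2) by (force simp: not_le not_less)
      qed
    qed auto
    then show ?thesis using decay_bounds[OF a] by simp
  qed
qed

lemma exact_block_truncated:
  assumes a: "0 < a" "a < 1" and n: "real n \<le> real b * a * real m" "n < b * m" and k: "k \<ge> 1"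
  shows "\<bar>hash_prob m n {as. stays_below b (left_list (hash_count m as) (s - 1) K) \<and>
        first_pass b (right_list (hash_count m as) s k)} -
    hash_prob m n {as. is_block (window_full b (hash_count m as)) s (s + int k - 1)}\<bar>
     \<le> decay a ^ (K + 1) / (1 - decay a)"
proof -
  have 1: "{as. stays_below b (left_list (hash_count m as) (s - 1) K) \<and>
    first_pass b (right_list (hash_count m as) s k)} =
    {as \<in> space (measure_pmf (hash_addresses m n)). stays_below b (left_list (hash_count m as)
      (s - 1) K)} \<inter>
     {as. first_pass b (right_list (hash_count m as) s k)}" by auto
  have 2: "{as. is_block (window_full b (hash_count m as)) s (s + int k - 1)} =
    {as \<in> space (measure_pmf (hash_addresses m n)). \<not> window_full b (hash_count m as) (s - 1)} \<inter>
     {as. first_pass b (right_list (hash_count m as) s k)}"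
    by (auto simp: is_block_window_full[OF k])
  show ?thesis unfolding 1 2
    using decay_bounds[OF a] prob_hash_first_window[OF a n]
    by (intro truncated_window_bound[where x="\<lambda>as. hash_count m as"])
      (auto simp: measure_pmf.prob_space_axioms)
qed

text \<open>The buckets of a block before its last one form an overfull window of length k - 1; the
  last bucket is not full and yields no further factor.\<close>

lemma exact_block_tail:
  assumes a: "0 < a" "a < 1" and n: "real n \<le> real b * a * real m" "n < b * m" and k: "1 \<le> k" "k \<le> m"
  shows "hash_prob m n {as. is_block (window_full b (hash_count m as)) s (s + int k - 1)} \<le>
     decay a ^ (k - 1)"
proof -
  have m: "m > 0" using k by simp
  have "first_pass b (right_list x s k) \<Longrightarrow> b * (k - 1) \<le> window_sum x (s + int k - 2) (k - 1)" for x
  proof -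
    assume "first_pass b (right_list x s k)"
    then have "b * (k - 1) \<le> (\<Sum>t<k - 1. x (s + int t))" using k by (simp add: first_pass_right_list)
    also have "\<dots> = window_sum x (s + int k - 2) (k - 1)"
      unfolding window_sum_def
      \<comment> \<open>The block is summed from its start and the window backwards from its end, so
        the order is reversed.\<close>
      by (rule sum.reindex_bij_witness[where i="\<lambda>t. k - 2 - t" and j="\<lambda>t. k - 2 - t"])
        (auto simp: of_nat_diff)
    finally show ?thesis .
  qed
  then have "hash_prob m n {as. is_block (window_full b (hash_count m as)) s (s + int k - 1)} \<le>
    hash_prob m n {as. b * (k - 1) \<le> window_sum (hash_count m as) (s + int k - 2) (k - 1)}"
    by (intro measure_pmf.finite_measure_mono) (auto simp: is_block_window_full[OF k(1)])
  also have "\<dots> \<le> decay a ^ (k - 1)" using k by (intro prob_hash_window m a n) auto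
  finally show ?thesis .
qed

lemma exact_block_length_prob:
  assumes n: "n < b * m" and k: "k \<ge> 1"
  shows "hash_prob m n {as. block_length (exact_full b m as) v = k} =
    (\<Sum>t<k. hash_prob m n
       {as. is_block (window_full b (hash_count m as)) (v - int t) (v - int t + int k - 1)})"
proof -
  have m: "m > 0" using n by (cases m) auto
  define I where "I t = {as. is_block (window_full b (hash_count m as)) (v - int t) (v - int t +
    int k - 1)}" for t
  have "hash_prob m n {as. block_length (exact_full b m as) v = k} =
    hash_prob m n (\<Union>t<k. I t)"
  proof (intro measure_pmf.finite_measure_eq_AE)
    show "AE as in hash_addresses m n. as \<in> {as. block_length (exact_full b m as) v = k} \<longleftrightarrow>
      as \<in> (\<Union>t<k. I t)"
      unfolding AE_measure_pmf_iff
    proof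
      fix as assume "as \<in> set_pmf (hash_addresses m n)"
      then have "set as \<subseteq> {..<m}" "length as = n" using hash_addresses_support[OF m] by auto
      then have "exact_full b m as = window_full b (hash_count m as)"
        using exact_full_window_full[of as m b] n by auto
      then show "as \<in> {as. block_length (exact_full b m as) v = k} \<longleftrightarrow> as \<in> (\<Union>t<k. I t)"
        using block_length_eq_iff[OF k, of "window_full b (hash_count m as)" v] by (auto simp: I_def)
    qed
  qed auto
  also have "\<dots> = (\<Sum>t<k. hash_prob m n (I t))"
    using is_block_shift_disjoint[of _ v _ k]
    by (intro measure_pmf.finite_measure_finite_Union) (auto simp: disjoint_family_on_def I_def)
  finally show ?thesis by (simp add: I_def)
qed

text \<open>Lengths outside 1..m do not occur, so one bound covers every k and can serve as a
  majorant independent of m and n.\<close>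

lemma exact_block_length_bound:
  assumes a: "0 < a" "a < 1" and n: "real n \<le> real b * a * real m" "n < b * m"
  shows "hash_prob m n {as. block_length (exact_full b m as) v = k} \<le> real k * decay a ^ (k - 1)"
proof -
  have m: "m > 0" using n by (cases m) auto
  show ?thesis
  proof (cases "1 \<le> k \<and> k \<le> m")
    case True
    then have "(\<Sum>t<k. hash_prob m n
       {as. is_block (window_full b (hash_count m as)) (v - int t) (v - int t + int k - 1)}) \<le>
         (\<Sum>t<k. decay a ^ (k - 1))"
      by (intro sum_mono exact_block_tail a n) auto
    then show ?thesis using exact_block_length_prob[OF n(2), of k v] True by simp
  next
    case False
    have "hash_prob m n {as. block_length (exact_full b m as) v = k} =
      hash_prob m n {}"
    proof (intro measure_pmf.finite_measure_eq_AE)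
      show "AE as in hash_addresses m n. as \<in> {as. block_length (exact_full b m as) v = k} \<longleftrightarrow> as \<in> {}"
        unfolding AE_measure_pmf_iff
      proof
        fix as assume "as \<in> set_pmf (hash_addresses m n)"
        then have "set as \<subseteq> {..<m}" "length as = n" using hash_addresses_support[OF m] by auto
        then have "1 \<le> block_length (exact_full b m as) v \<and> block_length (exact_full b m as) v \<le> m"
          using exact_block_exists[of as m b v] n by auto
        then show "as \<in> {as. block_length (exact_full b m as) v = k} \<longleftrightarrow> as \<in> {}" using False by auto
      qed
    qed auto
    then show ?thesis using decay_bounds[OF a] by simp
  qed
qed

end

section \<open>Limits of block probabilities in the exact model\<close>

context infinite_model
begin

text \<open>The midpoint between \<alpha> and 1: loads tending to \<alpha> are eventually below it,
  and it still gives a decay below 1.\<close>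

definition "upper_load = (1 + \<alpha>) / 2"

lemma upper_load: "0 < upper_load" "upper_load < 1" "\<alpha> < upper_load"
  using \<alpha> by (auto simp: upper_load_def)

lemma eventually_upper_load:
  assumes m: "filterlim m at_top sequentially"
    and lim: "(\<lambda>t. real (n t) / (real b * real (m t))) \<longlonglongrightarrow> \<alpha>"
  shows "eventually (\<lambda>t. real (n t) \<le> real b * upper_load * real (m t)) sequentially"
  using order_tendstoD(2)[OF lim upper_load(3)] m[unfolded filterlim_at_top, rule_format, of 1]
proof eventually_elim
  case (elim t)
  then have "real b * real (m t) > 0" using b by simp
  then show ?case using elim(1) by (simp add: divide_less_eq mult_ac)
qed

lemma exact_block_limit:
  fixes m n :: "nat \<Rightarrow> nat" and s :: "nat \<Rightarrow> int"
  assumes m: "filterlim m at_top sequentially" and n: "filterlim n at_top sequentially"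
    and nm: "\<And>t. n t < b * m t"
    and lim: "(\<lambda>t. real (n t) / (real b * real (m t))) \<longlonglongrightarrow> \<alpha>" and k: "k \<ge> 1"
  shows "(\<lambda>t. hash_prob (m t) (n t)
      {as. is_block (window_full b (hash_count (m t) as)) (s t) (s t + int k - 1)}) \<longlonglongrightarrow>
     nonfull_prob b rate * pass_prob b rate k"
proof (rule LIMSEQ_I)
  fix \<epsilon> :: real assume \<epsilon>: "\<epsilon> > 0"
  have r: "(\<lambda>t. real (n t) / real (m t)) \<longlonglongrightarrow> rate"
  proof -
    have "(\<lambda>t. real (n t) / (real b * real (m t)) * real b) \<longlonglongrightarrow> \<alpha> * real b"
      by (intro tendsto_intros lim)
    then show ?thesis using b by (simp add: field_simps)
  qed
  note e0 = decay_tail_tendsto[OF upper_load(1,2)]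
  have L: "(\<lambda>K. below_prob b rate K * pass_prob b rate k) \<longlonglongrightarrow> nonfull_prob b rate * pass_prob b rate k"
    by (intro tendsto_intros below_prob_tendsto_nonfull)
  \<comment> \<open>K can be fixed before t, because the truncation error depends only on
    \<open>upper_load\<close> and not on the size of the table.\<close>
  have "eventually (\<lambda>K. decay upper_load ^ (K + 1) / (1 - decay upper_load) < \<epsilon> / 3 \<and>
     \<bar>below_prob b rate K * pass_prob b rate k - nonfull_prob b rate * pass_prob b rate k\<bar> <
       \<epsilon> / 3) sequentially"
    using order_tendstoD(2)[OF e0, of "\<epsilon> / 3"] tendstoD[OF L, of "\<epsilon> / 3"] \<epsilon>
    by (auto simp: dist_real_def intro: eventually_conj)
  then obtain K where K: "decay upper_load ^ (K + 1) / (1 - decay upper_load) < \<epsilon> / 3"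
     "\<bar>below_prob b rate K * pass_prob b rate k - nonfull_prob b rate * pass_prob b rate k\<bar> < \<epsilon> / 3"
    by (auto simp: eventually_sequentially)
  have close: "eventually (\<lambda>t. dist (hash_prob (m t) (n t)
      {as. stays_below b (left_list (hash_count (m t) as) (s t - 1) K) \<and>
        first_pass b (right_list (hash_count (m t) as) (s t) k)}) (below_prob b rate K *
          pass_prob b rate k) < \<epsilon> / 3) sequentially"
    using \<epsilon> by (intro tendstoD[OF hash_left_right_limit[OF m n r rate_pos, of b s K k]]) simp
  have "eventually (\<lambda>t. \<bar>hash_prob (m t) (n t)
      {as. is_block (window_full b (hash_count (m t) as)) (s t) (s t + int k - 1)} -
      nonfull_prob b rate * pass_prob b rate k\<bar> < \<epsilon>) sequentially"
    using close eventually_upper_load[OF m lim]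
  proof eventually_elim
    case (elim t)
    then show ?case
      using exact_block_truncated[OF upper_load(1,2) elim(2) nm[of t] k, of "s t" K] K
      unfolding dist_real_def by linarith
  qed
  then show "\<exists>t0. \<forall>t\<ge>t0. norm (hash_prob (m t) (n t)
      {as. is_block (window_full b (hash_count (m t) as)) (s t) (s t + int k - 1)} -
      nonfull_prob b rate * pass_prob b rate k) < \<epsilon>"
    by (simp add: eventually_sequentially)
qed

lemma exact_block_length_limit:
  fixes m n :: "nat \<Rightarrow> nat" and v :: "nat \<Rightarrow> int"
  assumes m: "filterlim m at_top sequentially" and n: "filterlim n at_top sequentially"
    and nm: "\<And>t. n t < b * m t"
    and lim: "(\<lambda>t. real (n t) / (real b * real (m t))) \<longlonglongrightarrow> \<alpha>"
  shows "(\<lambda>t. hash_prob (m t) (n t) {as. block_length (exact_full b (m t) as) (v t) = k}) \<longlonglongrightarrow>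
     real k * (nonfull_prob b rate * pass_prob b rate k)"
proof (cases "k = 0")
  case True
  have "hash_prob (m t) (n t) {as. block_length (exact_full b (m t) as) (v t) = 0} = 0" for t
  proof -
    have m0: "m t > 0" using nm[of t] by (cases "m t") auto
    show ?thesis
    proof (subst measure_pmf_zero_iff, safe)
      fix as assume "as \<in> set_pmf (hash_addresses (m t) (n t))"
        "block_length (exact_full b (m t) as) (v t) = 0"
      then show "as \<in> {}"
        using hash_addresses_support[OF m0, of as "n t"] exact_block_exists[of as "m t" b "v t"] nm[of t] by auto
    qed
  qed
  then show ?thesis using True by simp
next
  case False
  then have k: "k \<ge> 1" by simp
  have "(\<lambda>t. \<Sum>i<k. hash_prob (m t) (n t)
       {as. is_block (window_full b (hash_count (m t) as)) (v t - int i) (v t - int i + int k - 1)}) \<longlonglongrightarrow>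
       (\<Sum>i<k. nonfull_prob b rate * pass_prob b rate k)"
    by (intro tendsto_sum exact_block_limit m n nm lim k)
  then show ?thesis unfolding exact_block_length_prob[OF nm k] by simp
qed

end

section \<open>The tree function\<close>

text \<open>The n-th finite difference of a polynomial of degree below n. It is read off from
  \<open>(exp x - 1) ^ n\<close>, whose expansion starts at \<open>x ^ n\<close>.\<close>

lemma alternating_binomial_power_sum:
  assumes "j < n"
  shows "(\<Sum>k\<le>n. of_nat (n choose k) * (-1) ^ (n - k) * of_nat k ^ j) = (0 :: complex)"
proof -
  have "fps_nth ((fps_exp 1 + (-1)) ^ n :: complex fps) j = 0"
    using startsby_zero_power_prefix[of "fps_exp 1 + (-1) :: complex fps" n] assms by simp
  moreover have "fps_nth ((fps_exp 1 + (-1)) ^ n :: complex fps) j =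
     (\<Sum>k\<le>n. of_nat (n choose k) * (-1) ^ (n - k) * of_nat k ^ j / fact j)"
  proof -
    have B: "(fps_exp 1 + (-1)) ^ n = (\<Sum>k\<le>n. of_nat (n choose k) * fps_exp 1 ^ k *
      (-1 :: complex fps) ^ (n - k))"
      by (rule binomial_ring)
    have "fps_nth (of_nat (n choose k) * fps_exp 1 ^ k * (-1) ^ (n - k)) j =
      (of_nat (n choose k) * (-1) ^ (n - k) * of_nat k ^ j / fact j :: complex)" for k
    proof -
      have "of_nat (n choose k) * fps_exp 1 ^ k * (-1 :: complex fps) ^ (n - k) =
        fps_const (of_nat (n choose k) * (-1) ^ (n - k)) * fps_exp (of_nat k)"
      proof -
        have "(-1 :: complex fps) ^ (n - k) = fps_const ((-1) ^ (n - k))"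
          by (metis fps_const_1_eq_1 fps_const_neg fps_const_power)
        then show ?thesis
          by (simp only: fps_exp_power_mult fps_of_nat[symmetric] fps_const_mult[symmetric] mult_ac mult_1_left)
      qed
      then show ?thesis by (simp only: fps_mult_left_const_nth fps_exp_nth) simp
    qed
    then show ?thesis unfolding B fps_sum_nth by (intro sum.cong refl)
  qed
  ultimately have "(\<Sum>k\<le>n. of_nat (n choose k) * (-1) ^ (n - k) * of_nat k ^ j) / fact j = (0 :: complex)"
    by (simp only: sum_divide_distrib)
  then show ?thesis by (simp only: divide_eq_0_iff fact_nonzero simp_thms)
qed

section \<open>The tree series as compositional inverse of \<open>z * exp (- z)\<close>\<close>

definition tree_fps :: "complex fps" where
  "tree_fps = Abs_fps (\<lambda>n. if n = 0 then 0 else of_nat n ^ (n - 1) / fact n)"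

text \<open>Up to a factor, the coefficients beyond the first are n-th differences of
  \<open>i ^ (n - 1)\<close>, hence 0. The exponent \<open>n - 1\<close> in the tree series is just
  what makes this work.\<close>

lemma tree_fps_compose_left: "tree_fps oo (fps_X * fps_exp (-1)) = fps_X"
proof (rule fps_ext)
  fix n
  have h: "fps_nth ((fps_X * fps_exp (-1)) ^ i :: complex fps) n =
    (if n < i then 0 else (- of_nat i) ^ (n - i) / fact (n - i))" for i
    by (simp add: power_mult_distrib fps_exp_power_mult fps_X_power_mult_nth)
  show "fps_nth (tree_fps oo (fps_X * fps_exp (-1))) n = fps_nth fps_X n"
  proof (cases "n \<le> 1")
    case True
    then consider "n = 0" | "n = 1" by linarith
    then show ?thesis by cases (simp_all add: fps_compose_nth h tree_fps_def)
  next
    case False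
    have "fps_nth (tree_fps oo (fps_X * fps_exp (-1))) n =
      (\<Sum>i=0..n. fps_nth tree_fps i * ((- of_nat i) ^ (n - i) / fact (n - i)))"
      unfolding fps_compose_nth h by (intro sum.cong) auto
    also have "\<dots> = (\<Sum>i=0..n. of_nat (n choose i) * (-1) ^ (n - i) * of_nat i ^ (n - 1) / fact n)"
    proof (intro sum.cong refl)
      fix i assume i: "i \<in> {0..n}"
      show "fps_nth tree_fps i * ((- of_nat i) ^ (n - i) / fact (n - i)) =
        of_nat (n choose i) * (-1) ^ (n - i) * of_nat i ^ (n - 1) / fact n"
      proof (cases "i = 0")
        case True
        with False show ?thesis by (simp add: tree_fps_def)
      next
        case i0: False
        have "of_nat (n choose i) = (fact n / (fact i * fact (n - i)) :: complex)"
          using i by (intro binomial_fact) auto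
        moreover have "(- of_nat i :: complex) ^ (n - i) = (-1) ^ (n - i) * of_nat i ^ (n - i)"
          by (subst power_minus) simp
        moreover have "(of_nat i :: complex) ^ (i - 1) * of_nat i ^ (n - i) = of_nat i ^ (n - 1)"
          using i i0 by (simp add: power_add[symmetric])
        ultimately show ?thesis using i0 by (simp add: tree_fps_def field_simps)
      qed
    qed
    also have "\<dots> = 0"
      using alternating_binomial_power_sum[of "n - 1" n] False
      by (simp add: sum_divide_distrib[symmetric] atLeast0AtMost)
    finally show ?thesis using False by simp
  qed
qed

text \<open>By associativity, a left inverse for composition agrees with the two-sided
  inverse.\<close>

lemma tree_fps_compose_right: "(fps_X * fps_exp (-1)) oo tree_fps = fps_X"
proof -
  let ?h = "fps_X * fps_exp (-1) :: complex fps"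
  have h: "fps_nth ?h 0 = 0" "fps_nth ?h 1 \<noteq> 0" by simp_all
  have i0: "fps_nth (fps_inv ?h) 0 = 0" by (simp add: fps_inv_def)
  have "tree_fps = tree_fps oo (?h oo fps_inv ?h)"
    by (simp only: fps_inv_right[OF h] fps_X_fps_compose_startby0 fps_compose_fps_X)
  also have "\<dots> = (tree_fps oo ?h) oo fps_inv ?h" by (rule fps_compose_assoc) (use i0 in simp_all)
  also have "\<dots> = fps_inv ?h" by (simp add: tree_fps_compose_left i0)
  finally show ?thesis using fps_inv_right[OF h] by simp
qed

text \<open>\<open>n ^ n / n!\<close> is one term of the series of \<open>exp n\<close>. This yields
  convergence for \<open>norm z < exp (-1)\<close>.\<close>

lemma tree_coeff_bound: "norm (fps_nth tree_fps n) \<le> exp 1 ^ n"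
proof (cases "n = 0")
  case False
  have "real n ^ n / fact n \<le> exp (real n)"
    using sum_le_suminf[OF summable_exp[of "real n"], of "{n}"]
    by (simp add: exp_def divide_inverse mult.commute)
  moreover have "real n ^ (n - 1) \<le> real n ^ n" using False by (intro power_increasing) auto
  ultimately have "real n ^ (n - 1) / fact n \<le> exp (real n)"
    by (meson divide_right_mono fact_ge_zero order_trans)
  then show ?thesis using False
    by (simp add: tree_fps_def norm_divide norm_power exp_of_nat_mult[of n 1, simplified])
qed (simp add: tree_fps_def)

lemma tree_summable:
  assumes "norm z < exp (-1)"
  shows "summable (\<lambda>n. norm (fps_nth tree_fps n * z ^ n))"
proof (rule summable_comparison_test_ev)
  have "exp 1 * norm z < 1"
    using assms mult_strict_left_mono[OF assms, of "exp 1"] by (simp flip: exp_add)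
  then show "summable (\<lambda>n. (exp 1 * norm z) ^ n)" by (intro summable_geometric) auto
  show "\<forall>\<^sub>F n in sequentially. norm (norm (fps_nth tree_fps n * z ^ n)) \<le> (exp 1 * norm z) ^ n"
    using tree_coeff_bound
    by (intro always_eventually allI) (auto simp: norm_mult norm_power power_mult_distrib intro!: mult_right_mono)
qed

lemma tree_conv_radius: "fps_conv_radius tree_fps \<ge> ereal (exp (-1))"
  unfolding fps_conv_radius_def
proof (rule conv_radius_geI_ex')
  fix r :: real assume "0 < r" "ereal r < ereal (exp (-1))"
  then show "summable (\<lambda>n. fps_nth tree_fps n * of_real r ^ n)"
    using tree_summable[of "of_real r"] by (auto dest: summable_norm_cancel)
qed

section \<open>From the formal series to the analytic function\<close>

lemma tree_fun_eval_fps: "norm z < exp (-1) \<Longrightarrow> tree_fun z = eval_fps tree_fps z"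
proof -
  assume "norm z < exp (-1)"
  then have s: "summable (\<lambda>n. fps_nth tree_fps n * z ^ n)"
    by (rule summable_norm_cancel[OF tree_summable])
  have "eval_fps tree_fps z = (\<Sum>n. fps_nth tree_fps (Suc n) * z ^ Suc n) + fps_nth tree_fps 0 * z ^ 0"
    unfolding eval_fps_def suminf_split_head[OF s] by (rule diff_add_cancel[symmetric])
  also have "fps_nth tree_fps 0 * z ^ 0 = 0" by (simp add: tree_fps_def)
  also have "(\<lambda>n. fps_nth tree_fps (Suc n) * z ^ Suc n) =
    (\<lambda>n. of_nat (Suc n) ^ n * z ^ Suc n / fact (Suc n))"
    unfolding tree_fps_def by (rule ext)
      (simp only: fps_nth_Abs_fps nat.simps if_False diff_Suc_1 times_divide_eq_left)
  finally show ?thesis unfolding tree_fun_def by simp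
qed

lemma tree_fun_holomorphic: "tree_fun holomorphic_on ball 0 (exp (-1))"
proof -
  have "eval_fps tree_fps holomorphic_on ball 0 (exp (-1))"
    by (intro holomorphic_on_eval_fps)
      (auto simp: in_eball_iff intro!: less_le_trans[OF _ tree_conv_radius])
  then show ?thesis
    by (rule holomorphic_transform) (auto simp: tree_fun_eval_fps)
qed

lemma tree_fun_has_fps_expansion: "tree_fun has_fps_expansion tree_fps"
proof -
  have "eventually (\<lambda>z::complex. z \<in> ball 0 (exp (-1))) (nhds 0)"
    by (intro eventually_nhds_in_open) auto
  then have "eventually (\<lambda>z. eval_fps tree_fps z = tree_fun z) (nhds 0)"
    by eventually_elim (auto simp: tree_fun_eval_fps)
  moreover have "fps_conv_radius tree_fps > 0"
    by (rule less_le_trans[OF _ tree_conv_radius]) (simp add: zero_ereal_def)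
  ultimately show ?thesis by (simp add: has_fps_expansion_def)
qed

lemma xexp_has_fps_expansion:
  "(\<lambda>z::complex. z * exp (- z)) has_fps_expansion (fps_X * fps_exp (-1))"
  using has_fps_expansion_mult[OF has_fps_expansion_fps_X has_fps_expansion_exp[of "-1 :: complex"]]
  by (simp only: mult_minus1)

lemma eventually_tree_inverse_right: "eventually (\<lambda>z. tree_fun z * exp (- tree_fun z) = z) (nhds 0)"
proof -
  have "((\<lambda>z. z * exp (- z)) \<circ> tree_fun) has_fps_expansion fps_X"
    using has_fps_expansion_compose[OF xexp_has_fps_expansion tree_fun_has_fps_expansion]
    by (simp add: tree_fps_compose_right) (simp add: tree_fps_def)
  then show ?thesis by (auto simp: has_fps_expansion_def o_def elim: eventually_mono)
qed

lemma eventually_tree_inverse_left: "eventually (\<lambda>z. tree_fun (z * exp (- z)) = z) (nhds 0)"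
proof -
  have "(tree_fun \<circ> (\<lambda>z. z * exp (- z))) has_fps_expansion fps_X"
    using has_fps_expansion_compose[OF tree_fun_has_fps_expansion xexp_has_fps_expansion]
    by (simp add: tree_fps_compose_left)
  then show ?thesis by (auto simp: has_fps_expansion_def o_def elim: eventually_mono)
qed

text \<open>The formal identity gives the equation near 0; analytic continuation carries it over the
  disk where T is holomorphic.\<close>

lemma tree_fun_inverse:
  assumes "norm z < exp (-1)"
  shows "tree_fun z * exp (- tree_fun z) = z"
proof -
  obtain s where s: "open s" "0 \<in> s" "\<And>z. z \<in> s \<Longrightarrow> tree_fun z * exp (- tree_fun z) = z"
    using eventually_tree_inverse_right by (auto simp: eventually_nhds)
  show ?thesis
  proof (rule analytic_continuation_open[where s="s \<inter> ball 0 (exp (-1))" and s'="ball 0 (exp (-1))"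
        and f="\<lambda>z. tree_fun z * exp (- tree_fun z)" and g="\<lambda>z. z"])
    show "(\<lambda>z. tree_fun z * exp (- tree_fun z)) holomorphic_on ball 0 (exp (- 1))"
      by (intro holomorphic_intros tree_fun_holomorphic)
    have "0 \<in> s \<inter> ball 0 (exp (-1))" using s by simp
    then show "s \<inter> ball 0 (exp (-1)) \<noteq> {}" by blast
  qed (use s assms in \<open>auto intro!: holomorphic_intros\<close>)
qed

text \<open>With u = x - 1 this is \<open>1 + u < exp u\<close>, which is strict away from u =
  0.\<close>

lemma xexp_less:
  fixes x :: real
  assumes "x \<noteq> 1"
  shows "x * exp (- x) < exp (-1)"
proof -
  have "x < exp (x - 1)"
  proof (cases "x > 0")
    case True
    then have "ln x < x - 1" using assms ln_less_self ln_le_minus_one[of x] ln_eq_minus_one[of x]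
      by fastforce
    then show ?thesis using True by (metis exp_less_mono exp_ln)
  next
    case False
    then show ?thesis using exp_gt_zero[of "x - 1"] by linarith
  qed
  then have "x * exp (- x) < exp (x - 1) * exp (- x)" by simp
  then show ?thesis by (simp add: exp_add[symmetric])
qed

text \<open>This order of composition can be continued only where \<open>z * exp (- z)\<close> stays
  in the disk of T. For a < 1 the real segment from 0 to a has this property, and the identity is
  continued along it.\<close>

lemma tree_fun_xexp:
  assumes "0 \<le> a" "a < 1"
  shows "tree_fun (of_real (a * exp (- a))) = of_real a"
proof -
  define D where "D = {z::complex. norm (z * exp (- z)) < exp (-1)}"
  have oD: "open D" unfolding D_def by (intro open_Collect_less continuous_intros)
  \<comment> \<open>Continuation needs a connected open set: the component of 0 in the open set D,
    which contains the segment.\<close>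
  define S where "S = connected_component_set D 0"
  have seg: "of_real ` {0..a} \<subseteq> D"
  proof
    fix z assume "z \<in> (of_real ` {0..a} :: complex set)"
    then obtain x where "0 \<le> x" "x \<le> a" "z = of_real x" by auto
    then show "z \<in> D" using xexp_less[of x] assms
      by (simp add: D_def norm_mult flip: of_real_minus)
  qed
  have conn: "connected (of_real ` {0..a} :: complex set)"
    by (intro connected_continuous_image continuous_intros) auto
  have "of_real ` {0..a} \<subseteq> S"
    unfolding S_def using assms by (intro connected_component_maximal seg conn image_eqI[of _ _ 0]) auto
  then have aS: "of_real a \<in> S" and 0: "0 \<in> S" using assms
    by (auto simp: image_subset_iff intro!: image_eqI dest: bspec[of _ _ 0])
  have SD: "S \<subseteq> D" unfolding S_def by (rule connected_component_subset)
  obtain s where s: "open s" "0 \<in> s" "\<And>z. z \<in> s \<Longrightarrow> tree_fun (z * exp (- z)) = z"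
    using eventually_tree_inverse_left by (auto simp: eventually_nhds)
  have "tree_fun (of_real a * exp (- of_real a)) = of_real a"
  proof (rule analytic_continuation_open[where s="s \<inter> S" and s'=S
        and f="\<lambda>z. tree_fun (z * exp (- z))" and g="\<lambda>z. z"])
    show "open (s \<inter> S)" "open S" using s(1) open_connected_component[OF oD] unfolding S_def by auto
    have "(\<lambda>z. z * exp (- z)) holomorphic_on S" by (intro holomorphic_intros)
    then show "(\<lambda>z. tree_fun (z * exp (- z))) holomorphic_on S"
      using SD by (intro holomorphic_on_compose_gen[OF _ tree_fun_holomorphic, unfolded o_def])
        (auto simp: D_def)
    show "connected S" unfolding S_def by (rule connected_connected_component)
    show "s \<inter> S \<noteq> {}" using s(2) 0 by blast
  qed (use s aS in \<open>auto intro!: holomorphic_intros\<close>)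
  then show ?thesis by (simp add: exp_of_real flip: of_real_minus of_real_mult)
qed

text \<open>The coefficients of T are nonnegative, so its modulus on a disk is largest at the
  positive radius, where \<open>tree_fun_xexp\<close> gives the value.\<close>

lemma norm_tree_fun_le:
  assumes "0 \<le> a" "a < 1" "norm z \<le> a * exp (- a)"
  shows "norm (tree_fun z) \<le> a"
proof -
  let ?y = "a * exp (- a)"
  have y: "?y < exp (-1)" using xexp_less[of a] assms by simp
  define t where "t n = (if n = 0 then 0 else real n ^ (n - 1) / fact n)" for n
  have t: "fps_nth tree_fps n = of_real (t n)" "0 \<le> t n" for n by (simp_all add: tree_fps_def t_def)
  have nz: "norm z < exp (-1)" using assms y by linarith
  have sz: "summable (\<lambda>n. norm (fps_nth tree_fps n * z ^ n))" by (rule tree_summable[OF nz])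
  have "summable (\<lambda>n. norm (fps_nth tree_fps n * of_real ?y ^ n))"
    using y assms by (intro tree_summable) (simp del: of_real_mult)
  then have sy: "summable (\<lambda>n. t n * ?y ^ n)"
    using assms by (simp add: t norm_mult norm_power del: of_real_mult)
  have "norm (tree_fun z) \<le> (\<Sum>n. norm (fps_nth tree_fps n * z ^ n))"
    using summable_norm[OF sz] by (simp add: tree_fun_eval_fps[OF nz] eval_fps_def)
  also have "\<dots> \<le> (\<Sum>n. t n * ?y ^ n)"
    using assms t by (intro suminf_le sz sy)
      (auto simp: norm_mult norm_power intro!: mult_left_mono power_mono)
  also have "complex_of_real (\<Sum>n. t n * ?y ^ n) = tree_fun (of_real ?y)"
  proof (subst tree_fun_eval_fps)
    show "norm (of_real ?y :: complex) < exp (-1)" using y assms by (simp only: norm_of_real) simp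
    show "complex_of_real (\<Sum>n. t n * ?y ^ n) = eval_fps tree_fps (of_real ?y)"
      unfolding eval_fps_def t suminf_of_real[OF sy] by (simp only: of_real_mult of_real_power)
  qed
  then have "(\<Sum>n. t n * ?y ^ n) = a"
    using tree_fun_xexp[OF assms(1,2)] by (metis of_real_eq_iff)
  finally show ?thesis .
qed

section \<open>The kernel identity for the first passage\<close>

definition stays_above :: "nat \<Rightarrow> nat list \<Rightarrow> bool" where
  "stays_above b xs \<longleftrightarrow> (\<forall>l\<le>length xs. b * l \<le> sum_list (take l xs))"

definition above_prob :: "nat \<Rightarrow> real \<Rightarrow> nat \<Rightarrow> nat \<Rightarrow> real" where
  "above_prob b r i n = measure_pmf.prob (poisson_lists r i) {xs. stays_above b xs \<and> sum_list xs = n}"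

definition pass_sum_prob :: "nat \<Rightarrow> real \<Rightarrow> nat \<Rightarrow> nat \<Rightarrow> real" where
  "pass_sum_prob b r i n = measure_pmf.prob (poisson_lists r i) {xs. first_pass b xs \<and> sum_list xs = n}"

lemma stays_above_or_pass:
  assumes "length xs = Suc i"
  shows "stays_above b (take i xs) \<longleftrightarrow> stays_above b xs \<or> first_pass b xs"
    "\<not> (stays_above b xs \<and> first_pass b xs)"
proof -
  have *: "stays_above b (take i xs) \<longleftrightarrow> (\<forall>l\<le>i. b * l \<le> sum_list (take l xs))"
    using assms by (auto simp: stays_above_def min_def)
  have **: "stays_above b xs \<longleftrightarrow> (\<forall>l\<le>i. b * l \<le> sum_list (take l xs)) \<and> b * Suc i \<le> sum_list xs"
    using assms by (auto simp: stays_above_def le_Suc_eq)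
  have ***: "first_pass b xs \<longleftrightarrow> (\<forall>l\<le>i. b * l \<le> sum_list (take l xs)) \<and> sum_list xs < b * Suc i"
    using assms by (auto simp: first_pass_def less_Suc_eq_le)
  show "stays_above b (take i xs) \<longleftrightarrow> stays_above b xs \<or> first_pass b xs"
    "\<not> (stays_above b xs \<and> first_pass b xs)"
    unfolding * ** *** by auto
qed

text \<open>A walk that has survived i steps either survives or passes at the next one; the right
  side is the convolution with that step.\<close>

lemma above_prob_Suc:
  assumes "r > 0"
  shows "above_prob b r (Suc i) n + pass_sum_prob b r (Suc i) n =
    (\<Sum>a\<le>n. above_prob b r i a * pmf (poisson_pmf r) (n - a))"
proof -
  let ?p = "poisson_lists r (i + 1)"
  have "above_prob b r (Suc i) n + pass_sum_prob b r (Suc i) n =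
    measure_pmf.prob ?p {xs. length xs = Suc i \<and> stays_above b xs \<and> sum_list xs = n} +
    measure_pmf.prob ?p {xs. length xs = Suc i \<and> first_pass b xs \<and> sum_list xs = n}"
    unfolding above_prob_def pass_sum_prob_def Suc_eq_plus1
    by (intro arg_cong2[where f="(+)"] measure_pmf.finite_measure_eq_AE)
      (auto simp: AE_measure_pmf_iff set_replicate_pmf)
  also have "\<dots> = measure_pmf.prob ?p ({xs. length xs = Suc i \<and> stays_above b xs \<and> sum_list xs = n} \<union>
      {xs. length xs = Suc i \<and> first_pass b xs \<and> sum_list xs = n})"
    using stays_above_or_pass(2)[of _ i b]
    by (intro measure_pmf.finite_measure_Union[symmetric]) auto
  also have "\<dots> = measure_pmf.prob ?p (\<Union>a\<le>n. {xs. (stays_above b (take i xs) \<and> sum_list (take i xs) =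
    a) \<and> sum_list (drop i xs) = n - a})"
  proof (intro measure_pmf.finite_measure_eq_AE)
    have sp: "sum_list xs = sum_list (take i xs) + sum_list (drop i xs)" for xs :: "nat list"
      by (metis append_take_drop_id sum_list_append)
    have "xs \<in> {xs. length xs = Suc i \<and> stays_above b xs \<and> sum_list xs = n} \<union>
      {xs. length xs = Suc i \<and> first_pass b xs \<and> sum_list xs = n} \<longleftrightarrow>
      xs \<in> (\<Union>a\<le>n. {xs. (stays_above b (take i xs) \<and> sum_list (take i xs) = a) \<and> sum_list (drop i xs) =
        n - a})"
      if "length xs = Suc i" for xs
      using that stays_above_or_pass(1)[OF that, of b] sp[of xs] by auto
    then show "AE xs in ?p. xs \<in> {xs. length xs = Suc i \<and> stays_above b xs \<and> sum_list xs = n} \<union>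
      {xs. length xs = Suc i \<and> first_pass b xs \<and> sum_list xs = n} \<longleftrightarrow>
      xs \<in> (\<Union>a\<le>n. {xs. (stays_above b (take i xs) \<and> sum_list (take i xs) = a) \<and> sum_list (drop i xs) =
        n - a})"
      unfolding AE_measure_pmf_iff set_replicate_pmf by auto
  qed auto
  also have "\<dots> = (\<Sum>a\<le>n. measure_pmf.prob ?p {xs. (stays_above b (take i xs) \<and> sum_list (take i xs) =
    a) \<and> sum_list (drop i xs) = n - a})"
    by (intro measure_pmf.finite_measure_finite_Union) (auto simp: disjoint_family_on_def)
  also have "\<dots> = (\<Sum>a\<le>n. above_prob b r i a * pmf (poisson_pmf r) (n - a))"
  proof (intro sum.cong refl)
    fix a
    have "measure_pmf.prob (poisson_lists r 1) {xs. sum_list xs = n - a} = pmf (poisson_pmf r) (n - a)"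
      unfolding replicate_pmf_1 by (simp add: vimage_def measure_pmf_single)
    then show "measure_pmf.prob ?p {xs. (stays_above b (take i xs) \<and> sum_list (take i xs) =
      a) \<and> sum_list (drop i xs) = n - a} =
      above_prob b r i a * pmf (poisson_pmf r) (n - a)"
      unfolding above_prob_def by (subst prob_replicate_pmf_split[where P="\<lambda>xs. stays_above b xs \<and>
        sum_list xs = a" and Q="\<lambda>xs. sum_list xs = n - a"]) simp
  qed
  finally show ?thesis .
qed

lemma above_prob_sums:
  "(\<lambda>n. above_prob b r i n) sums measure_pmf.prob (poisson_lists r i) {xs. stays_above b xs}"
proof -
  have "(\<lambda>n. measure_pmf.prob (poisson_lists r i) {xs. stays_above b xs \<and> sum_list xs = n}) sums
    measure_pmf.prob (poisson_lists r i) (\<Union>n. {xs. stays_above b xs \<and> sum_list xs = n})"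
    by (intro measure_pmf.finite_measure_UNION) (auto simp: disjoint_family_on_def)
  moreover have "(\<Union>n. {xs. stays_above b xs \<and> sum_list xs = n}) = {xs. stays_above b xs}" by auto
  ultimately show ?thesis by (simp add: above_prob_def)
qed

lemma above_prob_nonneg: "above_prob b r i n \<ge> 0" by (simp add: above_prob_def)

lemma above_prob_eq_0: "n < b * i \<Longrightarrow> above_prob b r i n = 0"
  unfolding above_prob_def
  by (subst measure_pmf_zero_iff) (auto simp: set_replicate_pmf stays_above_def)

text \<open>Survival for i steps forces a total of at least \<open>b * i\<close>, so at passage the
  total is one of b consecutive values. This is why the kernel equation becomes a polynomial
  equation of degree b.\<close>

lemma pass_sum_prob_eq_0:
  assumes "n < b * i \<or> b * Suc i \<le> n"
  shows "pass_sum_prob b r (Suc i) n = 0"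
  unfolding pass_sum_prob_def
proof (subst measure_pmf_zero_iff, safe)
  fix xs :: "nat list" assume xs: "xs \<in> set_pmf (poisson_lists r (Suc i))" "first_pass b xs" "n =
    sum_list xs"
  then have "length xs = Suc i" by (auto dest: replicate_pmf_length)
  then have "b * i \<le> sum_list (take i xs)" "sum_list xs < b * Suc i" using xs(2)
    by (auto simp: first_pass_def)
  moreover have "sum_list xs = sum_list (take i xs) + sum_list (drop i xs)"
    by (metis append_take_drop_id sum_list_append)
  ultimately show "xs \<in> {}" using assms xs(3) by auto
qed

lemma pass_sum_prob_nonneg: "pass_sum_prob b r i n \<ge> 0" by (simp add: pass_sum_prob_def)

lemma pass_sum_prob_le_1: "pass_sum_prob b r i n \<le> 1" by (simp add: pass_sum_prob_def)

lemma pass_prob_eq_sum: "pass_prob b r (Suc i) = (\<Sum>c<b. pass_sum_prob b r (Suc i) (b * i + c))"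
proof -
  have "pass_prob b r (Suc i) = measure_pmf.prob (poisson_lists r (Suc i))
    (\<Union>c<b. {xs. first_pass b xs \<and> sum_list xs = b * i + c})"
    unfolding pass_prob_def
  proof (intro measure_pmf.finite_measure_eq_AE)
    have "first_pass b xs \<longleftrightarrow> (\<exists>c<b. first_pass b xs \<and> sum_list xs = b * i + c)"
      if "length xs = Suc i" for xs
    proof -
      have "\<exists>c<b. sum_list xs = b * i + c" if "first_pass b xs"
      proof -
        have "b * i \<le> sum_list (take i xs)" "sum_list xs < b * Suc i"
          using that \<open>length xs = Suc i\<close> by (auto simp: first_pass_def)
        moreover have "sum_list xs = sum_list (take i xs) + sum_list (drop i xs)"
          by (metis append_take_drop_id sum_list_append)
        ultimately show ?thesis by (intro exI[of _ "sum_list xs - b * i"]) auto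
      qed
      then show ?thesis by blast
    qed
    then show "AE xs in poisson_lists r (Suc i). xs \<in> {zs. first_pass b zs} \<longleftrightarrow>
      xs \<in> (\<Union>c<b. {xs. first_pass b xs \<and> sum_list xs = b * i + c})"
      unfolding AE_measure_pmf_iff set_replicate_pmf by auto
  qed auto
  also have "\<dots> = (\<Sum>c<b. pass_sum_prob b r (Suc i) (b * i + c))"
    unfolding pass_sum_prob_def
    by (intro measure_pmf.finite_measure_finite_Union) (auto simp: disjoint_family_on_def)
  finally show ?thesis .
qed

lemma pass_prob_0 [simp]: "pass_prob b r 0 = 0"
  by (simp add: pass_prob_def first_pass_def indicator_def)

lemma pass_prob_nonneg: "pass_prob b r k \<ge> 0" by (simp add: pass_prob_def)

section \<open>Generating functions of the surviving walk\<close>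

definition above_gf :: "nat \<Rightarrow> real \<Rightarrow> nat \<Rightarrow> complex \<Rightarrow> complex" where
  "above_gf b r i z = (\<Sum>n. of_real (above_prob b r i n) * z ^ n)"

lemma above_gf_summable:
  fixes z :: complex
  assumes "norm z \<le> 1"
  shows "summable (\<lambda>n. norm (of_real (above_prob b r i n) * z ^ n))"
proof (rule summable_comparison_test_ev)
  show "summable (above_prob b r i)" using above_prob_sums by (rule sums_summable)
  show "\<forall>\<^sub>F n in sequentially. norm (norm (of_real (above_prob b r i n) * z ^ n)) \<le> above_prob b r i n"
    using assms above_prob_nonneg[of b r i]
    by (intro always_eventually allI) (simp add: norm_mult norm_power mult_left_le power_le_one)
qed

text \<open>Surviving walks have total at least \<open>b * i\<close>, so \<open>z ^ (b * i)\<close>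
  can be taken out. This cancels the denominator of the martingale in the kernel method.\<close>

lemma norm_above_gf_le:
  assumes "norm z \<le> 1"
  shows "norm (above_gf b r i z) \<le> norm z ^ (b * i)"
proof -
  have "norm (above_gf b r i z) \<le> (\<Sum>n. norm (of_real (above_prob b r i n) * z ^ n))"
    unfolding above_gf_def by (rule summable_norm[OF above_gf_summable[OF assms]])
  also have "\<dots> \<le> (\<Sum>n. above_prob b r i n * norm z ^ (b * i))"
  proof (intro suminf_le above_gf_summable[OF assms] summable_mult2 sums_summable[OF above_prob_sums])
    fix n
    show "norm (of_real (above_prob b r i n) * z ^ n) \<le> above_prob b r i n * norm z ^ (b * i)"
    proof (cases "n < b * i")
      case False
      then have "norm z ^ n \<le> norm z ^ (b * i)" using assms by (intro power_decreasing) auto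
      then show ?thesis using above_prob_nonneg[of b r i n]
        by (simp add: norm_mult norm_power mult_left_mono)
    qed (simp add: above_prob_eq_0)
  qed
  also have "\<dots> = measure_pmf.prob (poisson_lists r i) {xs. stays_above b xs} * norm z ^ (b * i)"
    using sums_unique[OF sums_mult2[OF above_prob_sums]] by metis
  also have "\<dots> \<le> 1 * norm z ^ (b * i)" by (intro mult_right_mono) auto
  finally show ?thesis by simp
qed

text \<open>The recursion \<open>above_prob_Suc\<close> in generating functions: the Poisson step
  multiplies by \<open>exp (r * (z - 1))\<close>, and the passing walks leave a power of z times a
  polynomial of degree below b.\<close>

lemma above_gf_Suc:
  assumes r: "r > 0" and z: "norm z \<le> 1"
  shows "above_gf b r (Suc i) z + z ^ (b * i) * (\<Sum>c<b. of_real (pass_sum_prob b r (Suc i) (b * i +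
    c)) * z ^ c) =
    above_gf b r i z * exp (of_real r * (z - 1))"
proof -
  have psums: "(\<lambda>n. of_real (pmf (poisson_pmf r) n) * z ^ n) sums exp (of_real r * (z - 1))"
  proof -
    have "(\<lambda>n. (of_real r * z) ^ n /\<^sub>R fact n * of_real (exp (- r))) sums
      (exp (of_real r * z) * of_real (exp (- r)))"
      by (intro sums_mult2 exp_converges)
    moreover have "exp (of_real r * z) * of_real (exp (- r)) = exp (of_real r * (z - 1))"
      by (simp add: exp_of_real exp_add[symmetric] algebra_simps exp_minus flip: of_real_minus)
        (simp add: exp_diff exp_of_real divide_inverse)
    moreover have "(of_real r * z) ^ n /\<^sub>R fact n * of_real (exp (- r)) =
      of_real (pmf (poisson_pmf r) n) * z ^ n" for n
      using r by (simp add: scaleR_conv_of_real power_mult_distrib field_simps)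
    ultimately show ?thesis by simp
  qed
  have pnorm: "summable (\<lambda>n. norm (of_real (pmf (poisson_pmf r) n) * z ^ n))"
  proof (rule summable_comparison_test_ev)
    have "(\<lambda>n. r ^ n /\<^sub>R fact n * exp (- r)) sums (exp r * exp (- r))"
      by (intro sums_mult2 exp_converges)
    then show "summable (\<lambda>n. pmf (poisson_pmf r) n)" using r
      by (auto simp: sums_iff scaleR_conv_of_real divide_inverse mult_ac)
    show "\<forall>\<^sub>F n in sequentially. norm (norm (of_real (pmf (poisson_pmf r) n) * z ^ n)) \<le>
      pmf (poisson_pmf r) n"
      using z by (intro always_eventually allI)
        (simp add: norm_mult norm_power mult_left_le power_le_one)
  qed
  have "(\<lambda>n. \<Sum>a\<le>n. (of_real (above_prob b r i a) * z ^ a) * (of_real (pmf (poisson_pmf r) (n - a)) *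
    z ^ (n - a))) sums
    ((\<Sum>n. of_real (above_prob b r i n) * z ^ n) * (\<Sum>n. of_real (pmf (poisson_pmf r) n) * z ^ n))"
    by (rule Cauchy_product_sums[OF above_gf_summable[OF z] pnorm])
  moreover have "(\<Sum>a\<le>n. (of_real (above_prob b r i a) * z ^ a) *
    (of_real (pmf (poisson_pmf r) (n - a)) * z ^ (n - a))) =
     of_real (above_prob b r (Suc i) n) * z ^ n + of_real (pass_sum_prob b r (Suc i) n) * z ^ n" for n
  proof -
    have "(\<Sum>a\<le>n. (of_real (above_prob b r i a) * z ^ a) * (of_real (pmf (poisson_pmf r) (n - a)) *
      z ^ (n - a))) =
      (\<Sum>a\<le>n. of_real (above_prob b r i a * pmf (poisson_pmf r) (n - a)) * z ^ n)"
    proof (intro sum.cong refl)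
      fix a assume "a \<in> {..n}"
      then have "z ^ n = z ^ a * z ^ (n - a)" by (simp flip: power_add)
      then show "(of_real (above_prob b r i a) * z ^ a) * (of_real (pmf (poisson_pmf r) (n - a)) *
        z ^ (n - a)) =
        of_real (above_prob b r i a * pmf (poisson_pmf r) (n - a)) * z ^ n"
          by (simp only: of_real_mult mult_ac)
    qed
    also have "\<dots> = of_real (above_prob b r (Suc i) n + pass_sum_prob b r (Suc i) n) * z ^ n"
      unfolding above_prob_Suc[OF r] of_real_sum sum_distrib_right ..
    finally show ?thesis by (simp only: of_real_add distrib_right)
  qed
  ultimately have conv: "(\<lambda>n. of_real (above_prob b r (Suc i) n) * z ^ n +
    of_real (pass_sum_prob b r (Suc i) n) * z ^ n) sums
    (above_gf b r i z * exp (of_real r * (z - 1)))"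
    using sums_unique[OF psums] by (simp add: above_gf_def)
  have 1: "(\<lambda>n. of_real (above_prob b r (Suc i) n) * z ^ n) sums above_gf b r (Suc i) z"
    unfolding above_gf_def by (rule summable_sums, rule summable_norm_cancel, rule above_gf_summable[OF z])
  have "(\<lambda>n. of_real (pass_sum_prob b r (Suc i) n) * z ^ n) sums
    (\<Sum>n\<in>{b * i..<b * i + b}. of_real (pass_sum_prob b r (Suc i) n) * z ^ n)"
    by (intro sums_finite) (auto simp: pass_sum_prob_eq_0 not_less)
  also have "(\<Sum>n\<in>{b * i..<b * i + b}. of_real (pass_sum_prob b r (Suc i) n) * z ^ n) =
    (\<Sum>c<b. of_real (pass_sum_prob b r (Suc i) (b * i + c)) * z ^ (b * i + c))"
    by (rule sum.reindex_bij_witness[where i="\<lambda>c. b * i + c" and j="\<lambda>n. n - b * i"]) auto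
  also have "\<dots> = z ^ (b * i) * (\<Sum>c<b. of_real (pass_sum_prob b r (Suc i) (b * i + c)) * z ^ c)"
    by (simp only: sum_distrib_left power_add mult_ac)
  finally have 2: "(\<lambda>n. of_real (pass_sum_prob b r (Suc i) n) * z ^ n) sums
    (z ^ (b * i) * (\<Sum>c<b. of_real (pass_sum_prob b r (Suc i) (b * i + c)) * z ^ c))" .
  show ?thesis using sums_unique2[OF sums_add[OF 1 2] conv] .
qed

lemma above_gf_0 [simp]: "above_gf b r 0 z = 1"
proof -
  have "above_prob b r 0 n = (if n = 0 then 1 else 0)" for n
    by (auto simp: above_prob_def stays_above_def indicator_def)
  then have "above_gf b r 0 z = (\<Sum>n. if n = 0 then 1 else 0)"
    unfolding above_gf_def by (intro suminf_cong) auto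
  then show ?thesis using suminf_finite[of "{0}" "\<lambda>n. if n = 0 then 1 else (0::complex)"] by simp
qed

text \<open>The kernel method: when \<open>q E z^X = z^b\<close>, the walk \<open>q^i z^(S_i - b i)\<close> stopped at the
  first passage is a bounded martingale started at 1.\<close>

lemma kernel_sums:
  fixes z q :: complex
  assumes r: "r > 0" and z: "norm z \<le> 1" "z \<noteq> 0" and q: "norm q < 1"
    and ker: "q * exp (of_real r * (z - 1)) = z ^ b"
  shows "(\<lambda>i. q ^ Suc i * (\<Sum>c<b. of_real (pass_sum_prob b r (Suc i) (b * i + c)) * z ^ c)) sums z ^ b"
proof -
  \<comment> \<open>The part of the martingale carried by walks surviving i steps; its decrements
    are the parts stopped at time i + 1.\<close>
  define a where "a i = q ^ i * above_gf b r i z / z ^ (b * i)" for i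
  have step: "q ^ Suc i * (\<Sum>c<b. of_real (pass_sum_prob b r (Suc i) (b * i + c)) * z ^ c) =
    z ^ b * (a i - a (Suc i))" for i
  proof -
    define Q where "Q = (\<Sum>c<b. of_real (pass_sum_prob b r (Suc i) (b * i + c)) * z ^ c)"
    define A where "A = above_gf b r i z"
    define e where "e = exp (of_real r * (z - 1))"
    have A': "above_gf b r (Suc i) z = A * e - z ^ (b * i) * Q"
      using above_gf_Suc[OF r z(1), of b i] by (simp add: Q_def A_def e_def algebra_simps)
    define Z where "Z = z ^ (b * i)"
    have zb: "Z \<noteq> 0" "z ^ b \<noteq> 0" using z by (simp_all add: Z_def)
    have "z ^ b * a (Suc i) = z ^ b * (q ^ Suc i * (A * e - Z * Q) / (z ^ b * Z))"
      unfolding a_def A' Z_def by (simp only: mult_Suc_right power_add)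
    also have "\<dots> = q ^ Suc i * (A * e - Z * Q) / Z"
      unfolding times_divide_eq_right by (rule mult_divide_mult_cancel_left[OF zb(2)])
    also have "\<dots> = q ^ i * A * (q * e) / Z - q ^ Suc i * Q"
      using zb(1) by (simp add: field_simps)
    also have "q * e = z ^ b" using ker by (simp add: e_def)
    finally show ?thesis unfolding Q_def[symmetric] by (simp add: a_def A_def Z_def algebra_simps)
  qed
  have "a \<longlonglongrightarrow> 0"
  proof (rule Lim_null_comparison)
    show "(\<lambda>i. norm q ^ i) \<longlonglongrightarrow> 0" using q by (intro LIMSEQ_realpow_zero) auto
    show "\<forall>\<^sub>F i in sequentially. norm (a i) \<le> norm q ^ i"
    proof (intro always_eventually allI)
      fix i
      have "norm (above_gf b r i z) / norm z ^ (b * i) \<le> 1" using norm_above_gf_le[OF z(1), of b r i] z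
        by simp
      then have "norm q ^ i * (norm (above_gf b r i z) / norm z ^ (b * i)) \<le> norm q ^ i"
        by (intro mult_left_le) auto
      then show "norm (a i) \<le> norm q ^ i" by (simp add: a_def norm_mult norm_divide norm_power)
    qed
  qed
  then have "(\<lambda>i. a i - a (Suc i)) sums (a 0 - 0)" by (rule telescope_sums')
  then have "(\<lambda>i. z ^ b * (a i - a (Suc i))) sums (z ^ b * (a 0 - 0))" by (rule sums_mult)
  then show ?thesis unfolding step by (simp add: a_def)
qed

text \<open>Two monic polynomials of degree b that agree at b points coincide; evaluate them at 1.
  Distinctness of the points is what identifies the polynomial.\<close>

lemma monic_poly_at_1:
  fixes C :: "nat \<Rightarrow> complex"
  assumes "inj_on \<zeta> {..<b}" "\<And>l. l < b \<Longrightarrow> (\<Sum>c<b. C c * \<zeta> l ^ c) = \<zeta> l ^ b"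
  shows "1 - (\<Sum>c<b. C c) = (\<Prod>l<b. 1 - \<zeta> l)"
proof -
  define R where "R = (\<Sum>c<b. monom (C c) c)"
  define P where "P = monom 1 b - R"
  define Q where "Q = (\<Prod>l<b. [:- \<zeta> l, 1:])"
  have evR: "poly R x = (\<Sum>c<b. C c * x ^ c)" for x by (simp add: R_def poly_sum poly_monom)
  have evQ: "poly Q x = (\<Prod>l<b. x - \<zeta> l)" for x by (simp add: Q_def poly_prod)
  have degQ: "degree Q = b" unfolding Q_def by (simp add: degree_prod_eq_sum_degree)
  have "lead_coeff Q = 1" unfolding Q_def by (simp only: lead_coeff_prod) simp
  then have cQ: "coeff Q b = 1" by (simp add: degQ)
  have cR: "coeff R n = 0" if "n \<ge> b" for n using that by (simp add: R_def coeff_sum)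
  have "P = Q"
  proof (rule poly_eqI_degree_lead_coeff[where A="\<zeta> ` {..<b}" and n=b])
    show "coeff P b = coeff Q b" using cR by (simp add: P_def cQ)
    show "b \<le> card (\<zeta> ` {..<b})" by (simp add: card_image[OF assms(1)])
    show "degree P \<le> b" using cR by (intro degree_le) (auto simp: P_def)
    show "degree Q \<le> b" by (simp add: degQ)
    show "poly P z = poly Q z" if "z \<in> \<zeta> ` {..<b}" for z
    proof -
      from that obtain l where l: "l < b" "z = \<zeta> l" by auto
      then have "poly Q z = 0" by (auto simp: evQ)
      moreover have "poly P z = 0" using assms(2)[OF l(1)] l by (simp add: P_def evR poly_monom)
      ultimately show ?thesis by simp
    qed
  qed
  then have "poly P 1 = poly Q 1" by simp
  then show ?thesis by (simp add: P_def evR evQ poly_monom)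
qed

lemma pass_gf_product:
  fixes q :: complex and \<zeta> :: "nat \<Rightarrow> complex"
  assumes r: "r > 0" and q: "norm q < 1" and inj: "inj_on \<zeta> {..<b}"
    and \<zeta>: "\<And>l. l < b \<Longrightarrow> norm (\<zeta> l) \<le> 1 \<and> \<zeta> l \<noteq> 0 \<and> q * exp (of_real r * (\<zeta> l - 1)) = \<zeta> l ^ b"
  shows "(\<lambda>i. of_real (pass_prob b r i) * q ^ i) sums (1 - (\<Prod>l<b. 1 - \<zeta> l))"
proof -
  \<comment> \<open>Split by the level c of the walk at passage: summed over i this gives the
    coefficient of \<open>z ^ c\<close> in the polynomial, summed over c the passage
    probability.\<close>
  define f where "f c i = q ^ Suc i * of_real (pass_sum_prob b r (Suc i) (b * i + c))" for c i
  have sf: "summable (f c)" for c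
  proof (rule summable_comparison_test_ev)
    show "summable (\<lambda>i. norm q ^ Suc i)" using q
      by (simp add: summable_geometric summable_Suc_iff del: power_Suc)
    show "\<forall>\<^sub>F i in sequentially. norm (f c i) \<le> norm q ^ Suc i"
      using pass_sum_prob_nonneg[of b r] pass_sum_prob_le_1[of b r]
      by (intro always_eventually allI) (simp add: f_def norm_mult norm_power mult_left_le del: power_Suc)
  qed
  have "(\<Sum>c<b. suminf (f c) * \<zeta> l ^ c) = \<zeta> l ^ b" if "l < b" for l
  proof -
    have "(\<lambda>i. \<Sum>c<b. f c i * \<zeta> l ^ c) sums (\<Sum>c<b. suminf (f c) * \<zeta> l ^ c)"
      by (intro sums_sum sums_mult2 summable_sums sf)
    moreover have "(\<lambda>i. \<Sum>c<b. f c i * \<zeta> l ^ c) sums \<zeta> l ^ b"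
      using kernel_sums[OF r _ _ q, of "\<zeta> l" b] \<zeta>[OF that]
        by (simp add: f_def sum_distrib_left mult_ac del: power_Suc)
    ultimately show ?thesis by (rule sums_unique2)
  qed
  then have prod: "1 - (\<Sum>c<b. suminf (f c)) = (\<Prod>l<b. 1 - \<zeta> l)" by (rule monic_poly_at_1[OF inj])
  have "(\<lambda>i. \<Sum>c<b. f c i) sums (\<Sum>c<b. suminf (f c))" by (intro sums_sum summable_sums sf)
  moreover have "(\<Sum>c<b. f c i) = of_real (pass_prob b r (Suc i)) * q ^ Suc i" for i
    by (simp add: f_def pass_prob_eq_sum sum_distrib_left sum_distrib_right mult_ac del: power_Suc)
  moreover have "(\<Sum>c<b. suminf (f c)) = 1 - (\<Prod>l<b. 1 - \<zeta> l)" using prod by (simp add: algebra_simps)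
  ultimately have "(\<lambda>i. of_real (pass_prob b r (Suc i)) * q ^ Suc i) sums (1 - (\<Prod>l<b. 1 - \<zeta> l))"
    by (simp only:)
  then show ?thesis by (subst (asm) sums_Suc_iff) simp
qed

section \<open>The generating function of the first passage\<close>

context poisson_load
begin

text \<open>The modulus of w at which \<open>\<alpha> * exp (- \<alpha>) * w\<close> reaches
  \<open>exp (-1)\<close>, the radius on which T is available; its b-th power is the radius in
  q.\<close>

definition root_radius :: real where "root_radius = exp (\<alpha> - 1) / \<alpha>"

lemma xexp_radius: "\<alpha> * exp (- \<alpha>) * root_radius = exp (-1)"
  using \<alpha> by (simp add: root_radius_def exp_add[symmetric])

lemma pgf_radius_eq: "pgf_radius b \<alpha> = root_radius ^ b"
  by (simp add: pgf_radius_def root_radius_def)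

lemma root_radius_gt_1: "root_radius > 1"
proof -
  have "\<alpha> * exp (- \<alpha>) * 1 < \<alpha> * exp (- \<alpha>) * root_radius"
    using xexp_less[of \<alpha>] xexp_radius \<alpha> by simp
  then show ?thesis using \<alpha> by (subst (asm) mult_less_cancel_left_pos) auto
qed

lemma norm_root_unity [simp]: "norm (root_unity b) = 1"
proof -
  have "root_unity b = cis (2 * pi / real b)" by (simp add: root_unity_def cis_conv_exp mult_ac)
  then show ?thesis by simp
qed

lemma root_unity_power_b: "(root_unity b ^ l) ^ b = 1"
proof -
  have "root_unity b ^ b = exp (of_nat b * (2 * of_real pi * \<i> / of_nat b))"
    unfolding root_unity_def by (simp only: exp_of_nat_mult)
  also have "\<dots> = exp (2 * of_real pi * \<i>)" using b by simp
  also have "\<dots> = 1" by (simp add: exp_two_pi_i)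
  finally have "root_unity b ^ b = 1" .
  then show ?thesis by (metis mult.commute power_mult power_one)
qed

lemma inj_on_root_unity: "inj_on (\<lambda>l. root_unity b ^ l) {..<b}"
proof -
  have "root_unity b ^ l = cis (2 * pi * real l / real b)" for l
  proof -
    have "root_unity b = cis (2 * pi / real b)" by (simp add: root_unity_def cis_conv_exp mult_ac)
    then show ?thesis by (simp add: Complex.DeMoivre mult_ac)
  qed
  then show ?thesis using Complex.bij_betw_roots_unity[of b] b by (simp add: bij_betw_def)
qed

section \<open>The branches as roots of the kernel equation\<close>

abbreviation zeta :: "nat \<Rightarrow> complex \<Rightarrow> complex" where
  "zeta \<equiv> zeta_br b \<alpha>"

definition zeta_arg :: "nat \<Rightarrow> complex \<Rightarrow> complex" where
  "zeta_arg l w = root_unity b ^ l * of_real (\<alpha> * exp (- \<alpha>)) * w"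

lemma zeta_br_eq: "zeta l w = tree_fun (zeta_arg l w) / of_real \<alpha>"
  by (simp add: zeta_br_def zeta_arg_def)

lemma norm_zeta_arg: "norm (zeta_arg l w) = \<alpha> * exp (- \<alpha>) * norm w"
  using \<alpha> by (simp add: zeta_arg_def norm_mult norm_power)

lemma zeta_arg_bound: "norm w < root_radius \<Longrightarrow> norm (zeta_arg l w) < exp (-1)"
proof -
  assume "norm w < root_radius"
  then have "\<alpha> * exp (- \<alpha>) * norm w < \<alpha> * exp (- \<alpha>) * root_radius" using \<alpha>
    by (intro mult_strict_left_mono) auto
  then show ?thesis by (simp add: norm_zeta_arg xexp_radius)
qed

lemma zeta_equation:
  assumes "norm w < root_radius"
  shows "zeta l w * exp (- of_real \<alpha> * zeta l w) = root_unity b ^ l * of_real (exp (- \<alpha>)) * w"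
proof -
  have "of_real \<alpha> * zeta l w = tree_fun (zeta_arg l w)" using \<alpha> by (simp add: zeta_br_eq)
  then have "of_real \<alpha> * (zeta l w * exp (- of_real \<alpha> * zeta l w)) = zeta_arg l w"
    using tree_fun_inverse[OF zeta_arg_bound[OF assms]] by (simp add: mult.assoc[symmetric])
  also have "\<dots> = of_real \<alpha> * (root_unity b ^ l * of_real (exp (- \<alpha>)) * w)" by (simp add: zeta_arg_def)
  finally show ?thesis using \<alpha> by simp
qed

text \<open>The b-th power removes the root of unity from \<open>zeta_equation\<close>, so every
  branch solves the same kernel equation with \<open>q = w ^ b\<close>.\<close>

lemma zeta_kernel:
  assumes "norm w < root_radius"
  shows "w ^ b * exp (of_real rate * (zeta l w - 1)) = zeta l w ^ b"
proof -
  define z where "z = zeta l w"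
  have "(z * exp (- of_real \<alpha> * z)) ^ b = (root_unity b ^ l * of_real (exp (- \<alpha>)) * w) ^ b"
    using zeta_equation[OF assms] by (simp add: z_def)
  then have "z ^ b * exp (- of_real \<alpha> * z) ^ b = of_real (exp (- \<alpha>)) ^ b * w ^ b"
    by (simp add: power_mult_distrib root_unity_power_b)
  then have eq: "z ^ b * exp (of_nat b * (- of_real \<alpha> * z)) = exp (of_nat b * (- of_real \<alpha>)) * w ^ b"
    by (simp only: exp_of_nat_mult exp_of_real of_real_minus[symmetric])
  have "w ^ b * exp (of_real rate * (z - 1)) =
    exp (of_real rate * z) * (exp (of_nat b * (- of_real \<alpha>)) * w ^ b)"
    by (simp add: exp_add[symmetric] algebra_simps)
  also have "\<dots> = z ^ b * (exp (of_real rate * z) * exp (of_nat b * (- of_real \<alpha> * z)))"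
    unfolding eq[symmetric] by (simp only: mult_ac)
  also have "exp (of_real rate * z) * exp (of_nat b * (- of_real \<alpha> * z)) = 1"
    by (simp add: exp_add[symmetric] algebra_simps)
  finally show ?thesis by (simp add: z_def)
qed

lemma norm_zeta_le_1: "norm w \<le> 1 \<Longrightarrow> norm (zeta l w) \<le> 1"
proof -
  assume "norm w \<le> 1"
  then have "norm (zeta_arg l w) \<le> \<alpha> * exp (- \<alpha>)" using \<alpha> by (simp add: norm_zeta_arg mult_left_le)
  then have "norm (tree_fun (zeta_arg l w)) \<le> \<alpha>" using \<alpha> by (intro norm_tree_fun_le) auto
  then show ?thesis using \<alpha> by (simp add: zeta_br_eq norm_divide)
qed

lemma zeta_0_1: "zeta 0 1 = 1"
  using tree_fun_xexp[of \<alpha>] \<alpha> by (simp add: zeta_br_def)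

lemma zeta_at_0: "zeta l 0 = 0"
  using tree_fun_xexp[of 0] by (simp add: zeta_br_def)

text \<open>By \<open>zeta_equation\<close> the value of the branch determines
  \<open>root_unity b ^ l * w\<close>, and hence l.\<close>

lemma inj_on_zeta:
  assumes "norm w < root_radius" "w \<noteq> 0"
  shows "inj_on (\<lambda>l. zeta l w) {..<b}"
proof (rule inj_onI)
  fix l l' assume l: "l \<in> {..<b}" "l' \<in> {..<b}" "zeta l w = zeta l' w"
  then have "root_unity b ^ l * of_real (exp (- \<alpha>)) * w = root_unity b ^ l' * of_real (exp (- \<alpha>)) * w"
    using zeta_equation[OF assms(1)] by metis
  then have "root_unity b ^ l = root_unity b ^ l'" using assms(2) by simp
  then show "l = l'" using inj_on_root_unity l by (auto dest: inj_onD)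
qed

lemma zeta_nonzero:
  assumes "norm w < root_radius" "w \<noteq> 0"
  shows "zeta l w \<noteq> 0"
proof
  assume "zeta l w = 0"
  then have "root_unity b ^ l * of_real (exp (- \<alpha>)) * w = 0" using zeta_equation[OF assms(1), of l]
    by simp
  moreover have "root_unity b \<noteq> 0" using norm_root_unity by (metis norm_zero zero_neq_one)
  ultimately show False using assms(2) by simp
qed

lemma zeta_holomorphic: "zeta l holomorphic_on ball 0 root_radius"
proof -
  have "(tree_fun \<circ> zeta_arg l) holomorphic_on ball 0 root_radius"
  proof (rule holomorphic_on_compose_gen[OF _ tree_fun_holomorphic])
    show "zeta_arg l holomorphic_on ball 0 root_radius"
      unfolding zeta_arg_def[abs_def] by (intro holomorphic_intros)
  qed (use zeta_arg_bound in auto)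
  then have "(\<lambda>w. (tree_fun \<circ> zeta_arg l) w / of_real \<alpha>) holomorphic_on ball 0 root_radius"
    by (rule holomorphic_on_divide) (use \<alpha> in simp_all)
  then show ?thesis by (rule holomorphic_transform) (simp add: zeta_br_eq)
qed

text \<open>Written in w with \<open>q = w ^ b\<close>, which avoids a branch of the b-th root and
  gives a function holomorphic on a full disk.\<close>

definition pass_gf_root :: "complex \<Rightarrow> complex" where
  "pass_gf_root w = 1 - (\<Prod>l<b. 1 - zeta l w)"

lemma pass_gf_root_holomorphic: "pass_gf_root holomorphic_on ball 0 root_radius"
  unfolding pass_gf_root_def by (intro holomorphic_intros zeta_holomorphic)

lemma pass_gf_root_sums_unit:
  assumes "norm w < 1"
  shows "(\<lambda>i. of_real (pass_prob b rate i) * (w ^ b) ^ i) sums pass_gf_root w"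
proof (cases "w = 0")
  case True
  have "(\<lambda>i. of_real (pass_prob b rate i) * (w ^ b) ^ i) = (\<lambda>i. 0 :: complex)"
  proof
    fix i show "of_real (pass_prob b rate i) * (w ^ b) ^ i = (0 :: complex)"
      using True b by (cases i) auto
  qed
  then show ?thesis using True by (simp add: pass_gf_root_def zeta_at_0)
next
  case False
  have R: "norm w < root_radius" using assms root_radius_gt_1 by simp
  show ?thesis unfolding pass_gf_root_def
  proof (rule pass_gf_product[OF rate_pos _ inj_on_zeta[OF R False]])
    show "norm (w ^ b) < 1" using assms b by (simp add: norm_power power_less_one_iff)
    show "norm (zeta l w) \<le> 1 \<and> zeta l w \<noteq> 0 \<and>
      w ^ b * exp (of_real rate * (zeta l w - 1)) = zeta l w ^ b" for l
      using norm_zeta_le_1[of w l] zeta_nonzero[OF R False] zeta_kernel[OF R] assms by simp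
  qed
qed

text \<open>The identity extends from the unit disk because the left-hand side is the Taylor series of
  a function holomorphic on the larger disk.\<close>

lemma pass_gf_root_sums:
  assumes "norm w < root_radius"
  shows "(\<lambda>i. of_real (pass_prob b rate i) * (w ^ b) ^ i) sums pass_gf_root w"
    and "summable (\<lambda>i. norm (of_real (pass_prob b rate i) * (w ^ b) ^ i))"
proof -
  \<comment> \<open>The series in \<open>w ^ b\<close> is stretched to a power series in w, with
    zeros between the multiples of b.\<close>
  define c where "c n = (if b dvd n then of_real (pass_prob b rate (n div b)) else 0 :: complex)" for n
  have mono: "strict_mono (\<lambda>i. b * i)" using b by (auto simp: strict_mono_def)
  have zero: "c n * w ^ n = 0" if "n \<notin> range (\<lambda>i. b * i)" for n w using that by (auto simp: c_def)
  have cb: "c (b * i) * w ^ (b * i) = of_real (pass_prob b rate i) * (w ^ b) ^ i" for i w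
    using b by (simp add: c_def power_mult)
  have reindex: "(\<lambda>i. of_real (pass_prob b rate i) * (w ^ b) ^ i) sums x \<longleftrightarrow>
    (\<lambda>n. c n * w ^ n) sums x" for w x
    using sums_mono_reindex[OF mono, of "\<lambda>n. c n * w ^ n" x] zero unfolding cb by blast
  have unit: "(\<lambda>n. c n * w ^ n) sums pass_gf_root w" if "norm w < 1" for w
    using pass_gf_root_sums_unit[OF that] reindex by blast
  define F where "F = Abs_fps c"
  have "fps_conv_radius F \<ge> 1"
    unfolding fps_conv_radius_def
  proof (rule conv_radius_geI_ex')
    fix r :: real assume "0 < r" "ereal r < 1"
    then show "summable (\<lambda>n. fps_nth F n * of_real r ^ n)"
      using unit[of "of_real r"] by (auto simp: F_def one_ereal_def dest: sums_summable)
  qed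
  then have rpos: "fps_conv_radius F > 0" by (rule less_le_trans[rotated]) simp
  have "eventually (\<lambda>z::complex. z \<in> ball 0 1) (nhds 0)" by (intro eventually_nhds_in_open) auto
  then have "eventually (\<lambda>z. eval_fps F z = pass_gf_root z) (nhds 0)"
  proof eventually_elim
    case (elim z)
    then show ?case using unit[of z] by (simp add: eval_fps_def F_def sums_iff)
  qed
  then have "pass_gf_root has_fps_expansion F" using rpos by (simp add: has_fps_expansion_def)
  then have FE: "fps_expansion pass_gf_root 0 = F" by (rule fps_expansion_eqI)
  \<comment> \<open>The Taylor series of a function holomorphic on a disk converges on that disk, so
    the radius of F is at least \<open>root_radius\<close>.\<close>
  have hol: "pass_gf_root holomorphic_on eball 0 (ereal root_radius)" using pass_gf_root_holomorphic
    by simp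
  have "fps_conv_radius F \<ge> ereal root_radius" using conv_radius_fps_expansion[OF hol] by (simp add: FE)
  moreover have "ereal (norm w) < ereal root_radius" using assms by simp
  ultimately have wr: "ereal (norm w) < fps_conv_radius F" by order
  have "eval_fps F w = pass_gf_root w" using eval_fps_expansion'[OF hol, of w] assms by (simp add: FE)
  moreover have "summable (\<lambda>n. norm (c n * w ^ n))"
    using abs_summable_in_conv_radius[of w "fps_nth F"] wr by (simp add: fps_conv_radius_def F_def)
  ultimately have "(\<lambda>n. c n * w ^ n) sums pass_gf_root w"
    by (simp add: sums_iff eval_fps_def F_def summable_norm_cancel)
  then show "(\<lambda>i. of_real (pass_prob b rate i) * (w ^ b) ^ i) sums pass_gf_root w" using reindex by blast
  have "summable (\<lambda>i. norm (c (b * i) * w ^ (b * i)))"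
    using \<open>summable (\<lambda>n. norm (c n * w ^ n))\<close> zero summable_mono_reindex[OF mono, of "\<lambda>n. norm (c n *
      w ^ n)"] by auto
  then show "summable (\<lambda>i. norm (of_real (pass_prob b rate i) * (w ^ b) ^ i))" unfolding cb .
qed

section \<open>The generating function in the variable q and its derivative\<close>

definition pass_gf :: "complex \<Rightarrow> complex" where
  "pass_gf q = (\<Sum>i. of_real (pass_prob b rate i) * q ^ i)"

lemma root_in_radius:
  fixes q :: complex
  assumes "norm q < pgf_radius b \<alpha>"
  obtains w where "w ^ b = q" "norm w < root_radius"
proof -
  obtain w where w: "w ^ b = q" using exists_complex_root[of b q] b by auto
  have "norm w ^ b < root_radius ^ b" using assms w by (simp add: pgf_radius_eq flip: norm_power)
  then have "norm w < root_radius" 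
    by (rule power_less_imp_less_base) (use root_radius_gt_1 in simp)
  with w that show ?thesis by blast
qed

lemma pass_gf_summable:
  fixes q :: complex
  assumes "norm q < pgf_radius b \<alpha>"
  shows "summable (\<lambda>i. norm (of_real (pass_prob b rate i) * q ^ i))"
proof -
  obtain w where "w ^ b = q" "norm w < root_radius" using root_in_radius[OF assms] .
  then show ?thesis using pass_gf_root_sums(2)[of w] by simp
qed

lemma pass_gf_root: "norm w < root_radius \<Longrightarrow> pass_gf (w ^ b) = pass_gf_root w"
  using pass_gf_root_sums(1) by (simp add: pass_gf_def sums_iff)

lemma pass_gf_has_derivative:
  assumes "norm q < pgf_radius b \<alpha>"
  shows "(pass_gf has_field_derivative (\<Sum>i. of_nat (Suc i) * of_real (pass_prob b rate (Suc i)) *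
    q ^ i)) (at q)"
    and "summable (\<lambda>i. norm (of_nat i * of_real (pass_prob b rate i) * q ^ i))"
proof -
  \<comment> \<open>Termwise differentiation needs convergence at a point of larger modulus.\<close>
  obtain x where x: "norm q < x" "x < pgf_radius b \<alpha>" using assms dense by blast
  define K :: complex where "K = of_real x"
  have nK: "norm q < norm K" "norm K < pgf_radius b \<alpha>" 
  proof -
    have "x > 0" using x norm_ge_zero[of q] by linarith
    then show "norm q < norm K" "norm K < pgf_radius b \<alpha>" using x by (simp_all add: K_def)
  qed
  let ?c = "\<lambda>i. of_real (pass_prob b rate i) :: complex"
  have sK: "summable (\<lambda>i. norm (?c i * K ^ i))" by (rule pass_gf_summable[OF nK(2)])
  have d: "DERIV (\<lambda>x. \<Sum>n. ?c n * x ^ n) q :> (\<Sum>n. diffs ?c n * q ^ n)"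
    by (rule termdiffs_strong[OF summable_norm_cancel[OF sK] nK(1)])
  then show "(pass_gf has_field_derivative (\<Sum>i. of_nat (Suc i) * of_real (pass_prob b rate (Suc i)) *
    q ^ i)) (at q)"
    by (simp only: pass_gf_def[abs_def] diffs_def)
  have "summable (\<lambda>n. diffs (pass_prob b rate) n * norm q ^ n)"
  proof (rule termdiff_converges[of _ x])
    show "norm (norm q) < x" using x by simp
    fix y :: real assume "norm y < x"
    then have "summable (\<lambda>i. norm (of_real (pass_prob b rate i) * complex_of_real y ^ i))"
      using x by (intro pass_gf_summable) simp
    then have "summable (\<lambda>i. \<bar>pass_prob b rate i * y ^ i\<bar>)"
      by (simp add: norm_mult norm_power abs_mult power_abs)
    then show "summable (\<lambda>i. pass_prob b rate i * y ^ i)" by (rule summable_rabs_cancel)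
  qed
  moreover have "norm (diffs ?c n * q ^ n) = diffs (pass_prob b rate) n * norm q ^ n" for n
    using pass_prob_nonneg[of b rate "Suc n"]
    by (simp add: diffs_def norm_mult norm_power del: of_nat_Suc)
  ultimately have "summable (\<lambda>n. norm (diffs ?c n * q ^ n))" by simp
  then have "summable (\<lambda>n. norm q * norm (diffs ?c n * q ^ n))" by (rule summable_mult)
  then have "summable (\<lambda>i. norm (of_nat (Suc i) * of_real (pass_prob b rate (Suc i)) * q ^ Suc i))"
    by (simp add: diffs_def norm_mult mult_ac)
  then show "summable (\<lambda>i. norm (of_nat i * of_real (pass_prob b rate i) * q ^ i))"
    by (subst (asm) summable_Suc_iff)
qed

lemma pass_gf_derivative_mult:
  assumes "norm q < pgf_radius b \<alpha>"
  shows "(\<lambda>i. of_nat i * of_real (pass_prob b rate i) * q ^ i) sums (q * deriv pass_gf q)"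
proof -
  have D: "deriv pass_gf q = (\<Sum>i. of_nat (Suc i) * of_real (pass_prob b rate (Suc i)) * q ^ i)"
    by (rule DERIV_imp_deriv[OF pass_gf_has_derivative(1)[OF assms]])
  have S: "summable (\<lambda>i. of_nat i * of_real (pass_prob b rate i) * q ^ i)"
    by (rule summable_norm_cancel[OF pass_gf_has_derivative(2)[OF assms]])
  show ?thesis
  proof (cases "q = 0")
    case True
    have "(\<lambda>i. of_nat i * of_real (pass_prob b rate i) * q ^ i) = (\<lambda>i. 0)"
      using True by (auto simp: fun_eq_iff power_0_left)
    then show ?thesis using True by simp
  next
    case False
    have "(\<lambda>i. of_nat i * of_real (pass_prob b rate i) * q ^ i) sums
      (\<Sum>i. of_nat i * of_real (pass_prob b rate i) * q ^ i)"
      using S by (rule summable_sums)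
    then have s1: "(\<lambda>i. of_nat (Suc i) * of_real (pass_prob b rate (Suc i)) * q ^ Suc i) sums
       (\<Sum>i. of_nat i * of_real (pass_prob b rate i) * q ^ i)"
      by (subst sums_Suc_iff) simp
    have "(\<lambda>i. of_nat (Suc i) * of_real (pass_prob b rate (Suc i)) * q ^ Suc i / q) sums
       ((\<Sum>i. of_nat i * of_real (pass_prob b rate i) * q ^ i) / q)"
      by (rule sums_divide[OF s1])
    moreover have "x * q ^ Suc i / q = x * q ^ i" for x i using False by simp
    ultimately have "(\<lambda>i. of_nat (Suc i) * of_real (pass_prob b rate (Suc i)) * q ^ i) sums
       ((\<Sum>i. of_nat i * of_real (pass_prob b rate i) * q ^ i) / q)"
      by (simp only:)
    then have "deriv pass_gf q = (\<Sum>i. of_nat i * of_real (pass_prob b rate i) * q ^ i) / q"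
      unfolding D by (rule sums_unique[symmetric])
    then have "q * deriv pass_gf q = (\<Sum>i. of_nat i * of_real (pass_prob b rate i) * q ^ i)" using False
      by simp
    then show ?thesis using summable_sums[OF S] by simp
  qed
qed

lemma pgf_radius_gt_1: "pgf_radius b \<alpha> > 1"
  unfolding pgf_radius_eq using root_radius_gt_1 b by (intro one_less_power) auto

lemma zeta_has_derivative:
  assumes "norm w < root_radius"
  shows "(zeta l has_field_derivative deriv (zeta l) w) (at w)"
  using holomorphic_derivI[OF zeta_holomorphic[of l], of w] assms by auto

lemma pass_gf_root_derivative:
  assumes "norm w < root_radius"
  shows "(pass_gf_root has_field_derivative
    (\<Sum>l<b. deriv (zeta l) w * (\<Prod>j\<in>{..<b} - {l}. 1 - zeta j w))) (at w)"
proof -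
  have "((\<lambda>w. \<Prod>l<b. 1 - zeta l w) has_field_derivative
    (\<Sum>l<b. (0 - deriv (zeta l) w) * (\<Prod>j\<in>{..<b} - {l}. 1 - zeta j w))) (at w)"
    by (intro has_field_derivative_prod DERIV_diff DERIV_const zeta_has_derivative assms)
  from DERIV_diff[OF DERIV_const[of 1] this] show ?thesis
    by (simp add: pass_gf_root_def[abs_def] sum_negf)
qed

text \<open>Differentiate \<open>z * exp (- \<alpha> * z) = exp (- \<alpha>) * w\<close> at w = 1,
  where z = 1: this gives \<open>z' * (1 - \<alpha>) = 1\<close>.\<close>

lemma deriv_zeta_0_1: "deriv (zeta 0) 1 = 1 / (1 - of_real \<alpha>)"
proof -
  let ?z = "zeta 0"
  have 1: "norm (1::complex) < root_radius" using root_radius_gt_1 by simp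
  have "((\<lambda>w. ?z w * exp (- of_real \<alpha> * ?z w)) has_field_derivative
     (deriv ?z 1 * exp (- of_real \<alpha> * ?z 1) +
       exp (- of_real \<alpha> * ?z 1) * (- of_real \<alpha> * deriv ?z 1) * ?z 1)) (at 1)"
    using zeta_has_derivative[OF 1, of 0] by (auto intro!: derivative_eq_intros)
  moreover have "((\<lambda>w. ?z w * exp (- of_real \<alpha> * ?z w)) has_field_derivative of_real (exp (- \<alpha>))) (at 1)"
  proof -
    have "((\<lambda>w. of_real (exp (- \<alpha>)) * w) has_field_derivative of_real (exp (- \<alpha>)) * 1) (at (1::complex))"
      by (intro DERIV_cmult DERIV_ident)
    moreover have "eventually (\<lambda>w. w \<in> ball 0 root_radius) (nhds (1::complex))"
      using 1 by (intro eventually_nhds_in_open) auto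
    then have "eventually (\<lambda>w. of_real (exp (- \<alpha>)) * w = ?z w * exp (- of_real \<alpha> * ?z w)) (nhds 1)"
      by eventually_elim (use zeta_equation[of _ 0] in simp)
    ultimately show ?thesis by (subst DERIV_cong_ev[OF refl, symmetric]) auto
  qed
  ultimately have "deriv ?z 1 * exp (- of_real \<alpha>) + exp (- of_real \<alpha>) * (- of_real \<alpha> * deriv ?z 1) =
    of_real (exp (- \<alpha>))"
    using DERIV_unique zeta_0_1 by fastforce
  moreover define e where "e = exp (- complex_of_real \<alpha>)"
  moreover have "of_real (exp (- \<alpha>)) = e" unfolding e_def
    by (simp only: exp_of_real[symmetric] of_real_minus)
  ultimately have "deriv ?z 1 * e + e * (- of_real \<alpha> * deriv ?z 1) = e" by simp
  then have "e * (deriv ?z 1 * (1 - of_real \<alpha>)) = e * 1" by (simp add: algebra_simps)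
  moreover have "e \<noteq> 0" by (simp add: e_def)
  ultimately have "deriv ?z 1 * (1 - of_real \<alpha>) = 1" by (simp only: mult_cancel_left simp_thms)
  moreover have "1 - complex_of_real \<alpha> \<noteq> 0" 
  proof -
    have "complex_of_real (1 - \<alpha>) \<noteq> 0" unfolding of_real_eq_0_iff using \<alpha> by simp
    then show ?thesis by simp
  qed
  ultimately show ?thesis by (simp add: eq_divide_eq)
qed

text \<open>In the product rule at w = 1 every summand except l = 0 contains the factor
  \<open>1 - zeta 0 1 = 0\<close>; the substitution \<open>q = w ^ b\<close> accounts for the factor
  b. As division by zero yields 0, the equation by itself does not yet exclude
  \<open>T0 b \<alpha> = 0\<close>.\<close>

lemma deriv_pass_gf_1: "deriv pass_gf 1 = 1 / T0 b \<alpha>"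
proof -
  have 1: "norm (1::complex) < root_radius" using root_radius_gt_1 by simp
  have q1: "norm (1::complex) < pgf_radius b \<alpha>" using pgf_radius_gt_1 by simp
  have "(pass_gf_root has_field_derivative
    (\<Sum>l<b. deriv (zeta l) 1 * (\<Prod>j\<in>{..<b} - {l}. 1 - zeta j 1))) (at 1)"
    by (rule pass_gf_root_derivative[OF 1])
  also have "(\<Sum>l<b. deriv (zeta l) 1 * (\<Prod>j\<in>{..<b} - {l}. 1 - zeta j 1)) =
    (\<Sum>l\<in>{0}. deriv (zeta l) 1 * (\<Prod>j\<in>{..<b} - {l}. 1 - zeta j 1))"
  proof (rule sum.mono_neutral_right)
    show "\<forall>l\<in>{..<b} - {0}. deriv (zeta l) 1 * (\<Prod>j\<in>{..<b} - {l}. 1 - zeta j 1) = 0"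
    proof
      fix l assume "l \<in> {..<b} - {0}"
      then have "(\<Prod>j\<in>{..<b} - {l}. 1 - zeta j 1) = 0"
        using zeta_0_1 by (intro prod_zero) (auto intro!: bexI[of _ 0])
      then show "deriv (zeta l) 1 * (\<Prod>j\<in>{..<b} - {l}. 1 - zeta j 1) = 0" by simp
    qed
  qed (use b in auto)
  also have "\<dots> = (\<Prod>j\<in>{..<b} - {0}. 1 - zeta j 1) / (1 - of_real \<alpha>)"
    by (simp add: deriv_zeta_0_1)
  also have "{..<b} - {0} = {1..b - 1}" using b by auto
  finally have d1: "(pass_gf_root has_field_derivative (\<Prod>j=1..b-1. 1 - zeta j 1) / (1 - of_real \<alpha>))
    (at 1)" .
  have "((\<lambda>w. w ^ b) has_field_derivative of_nat b * 1 ^ (b - 1)) (at (1::complex))"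
    by (auto intro!: derivative_eq_intros)
  then have "((\<lambda>w. w ^ b) has_field_derivative of_nat b) (at (1::complex))" by simp
  moreover have "(pass_gf has_field_derivative deriv pass_gf 1) (at 1)"
    using pass_gf_has_derivative(1)[OF q1] DERIV_imp_deriv by metis
  then have "(pass_gf has_field_derivative deriv pass_gf 1) (at (1 ^ b))" by simp
  ultimately have "((\<lambda>w. pass_gf (w ^ b)) has_field_derivative deriv pass_gf 1 * of_nat b) (at 1)"
    by (intro DERIV_chain2)
  moreover have "eventually (\<lambda>w. w \<in> ball 0 root_radius) (nhds (1::complex))"
    using 1 by (intro eventually_nhds_in_open) auto
  then have "eventually (\<lambda>w. pass_gf (w ^ b) = pass_gf_root w) (nhds 1)"
    by eventually_elim (simp add: pass_gf_root)
  ultimately have "(pass_gf_root has_field_derivative deriv pass_gf 1 * of_nat b) (at 1)"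
    by (subst DERIV_cong_ev[OF refl, symmetric]) auto
  then have "deriv pass_gf 1 * of_nat b = (\<Prod>j=1..b-1. 1 - zeta j 1) / (1 - of_real \<alpha>)"
    using d1 by (rule DERIV_unique)
  then have "deriv pass_gf 1 = (\<Prod>j=1..b-1. 1 - zeta j 1) / (1 - of_real \<alpha>) / of_nat b"
    by (rule eq_divide_imp[rotated]) (use b in simp)
  then show ?thesis by (simp only: T0_def divide_divide_eq_left divide_divide_eq_right mult_1_left mult.commute)
qed

text \<open>\<open>zeta 0 1 = 1\<close> makes the product vanish, so the walk passes almost
  surely.\<close>

lemma pass_prob_sums_1: "pass_prob b rate sums 1"
proof -
  have "pass_gf_root 1 = 1"
    using zeta_0_1 b by (auto simp: pass_gf_root_def intro!: bexI[of _ 0])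
  then have "(\<lambda>i. complex_of_real (pass_prob b rate i)) sums of_real 1"
    using pass_gf_root_sums(1)[of 1] root_radius_gt_1 by simp
  then show ?thesis by (simp only: sums_of_real_iff)
qed

lemma pass_prob_mean_sums: "(\<lambda>i. of_nat i * of_real (pass_prob b rate i)) sums (1 / T0 b \<alpha>)"
  using pass_gf_derivative_mult[of 1] pgf_radius_gt_1 by (simp add: deriv_pass_gf_1)

end

section \<open>Block length distributions\<close>

text \<open>Stated for Banach-valued g, so that moments, distribution functions and complex powers
  are covered alike.\<close>

lemma nat_valued_expectation:
  fixes g :: "nat \<Rightarrow> 'b :: {banach, second_countable_topology}"
  assumes "prob_space M" and Z: "Z \<in> measurable M (count_space UNIV)"
    and s: "summable (\<lambda>k. measure M {x \<in> space M. Z x = k} * norm (g k))"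
  shows "integrable M (\<lambda>x. g (Z x))"
    and "(\<lambda>k. measure M {x \<in> space M. Z x = k} *\<^sub>R g k) sums (\<integral>x. g (Z x) \<partial>M)"
proof -
  interpret prob_space M by fact
  define A where "A k = {x \<in> space M. Z x = k}" for k
  have A[measurable]: "A k \<in> sets M" for k
    using measurable_sets[OF Z, of "{k}"] by (simp add: A_def vimage_def Int_def conj_commute)
  define f where "f k x = indicator (A k) x *\<^sub>R g k" for k x
  have int: "integrable M (f k)" for k unfolding f_def by (simp add: emeasure_eq_measure)
  have nf: "norm (f k x) = indicator (A k) x * norm (g k)" for k x by (simp add: f_def)
  have fin: "f k x = 0" if "k \<notin> {Z x}" for k x using that by (simp add: f_def A_def)
  have AE: "AE x in M. summable (\<lambda>k. norm (f k x))"
  proof (rule AE_I2)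
    fix x show "summable (\<lambda>k. norm (f k x))"
      by (rule summable_finite[of "{Z x}"]) (auto simp: fin)
  qed
  have sn: "summable (\<lambda>k. \<integral>x. norm (f k x) \<partial>M)"
    using s by (simp add: nf A_def[symmetric] emeasure_eq_measure)
  have val: "(\<Sum>k. f k x) = g (Z x)" if "x \<in> space M" for x
    using suminf_finite[of "{Z x}" "\<lambda>k. f k x"] fin that by (simp add: f_def A_def)
  have "integrable M (\<lambda>x. \<Sum>k. f k x)" by (rule integrable_suminf[OF int AE sn])
  then show "integrable M (\<lambda>x. g (Z x))"
    by (rule Bochner_Integration.integrable_cong[OF refl, THEN iffD1, rotated]) (rule val)
  have "(\<lambda>k. integral\<^sup>L M (f k)) sums (\<integral>x. (\<Sum>k. f k x) \<partial>M)" by (rule sums_integral[OF int AE sn])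
  moreover have "(\<integral>x. (\<Sum>k. f k x) \<partial>M) = (\<integral>x. g (Z x) \<partial>M)"
    by (rule Bochner_Integration.integral_cong[OF refl]) (rule val)
  moreover have "integral\<^sup>L M (f k) = measure M (A k) *\<^sub>R g k" for k
    unfolding f_def by (simp add: emeasure_eq_measure)
  ultimately show "(\<lambda>k. measure M {x \<in> space M. Z x = k} *\<^sub>R g k) sums (\<integral>x. g (Z x) \<partial>M)"
    by (simp add: A_def)
qed

lemma nat_valued_prob_sums_1:
  assumes "prob_space M" and Z: "Z \<in> measurable M (count_space UNIV)"
  shows "(\<lambda>k. measure M {x \<in> space M. Z x = k}) sums 1"
proof -
  interpret prob_space M by fact
  have A: "{x \<in> space M. Z x = k} \<in> sets M" for k
    using measurable_sets[OF Z, of "{k}"] by (simp add: vimage_def Int_def conj_commute)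
  have "(\<lambda>k. prob {x \<in> space M. Z x = k}) sums prob (\<Union>k. {x \<in> space M. Z x = k})"
    using A by (intro finite_measure_UNION) (auto simp: disjoint_family_on_def)
  moreover have "(\<Union>k. {x \<in> space M. Z x = k}) = space M" by auto
  ultimately show ?thesis by (simp add: prob_space)
qed

section \<open>The law of the hitting time\<close>

lemma first_pass_map:
  "first_pass b (map x [1..<Suc k]) \<longleftrightarrow> 1 \<le> k \<and> (\<Sum>j=1..k. x j) < b * k \<and> (\<forall>l<k. b * l \<le> (\<Sum>j=1..l. x j))"
proof -
  have sum: "sum_list (map x [1..<Suc l]) = (\<Sum>j=1..l. x j)" for l
    by (simp add: interv_sum_list_conv_sum_set_nat atLeastLessThanSuc_atLeastAtMost del: upt_Suc)
  have "take l (map x [1..<Suc k]) = map x [1..<Suc l]" if "l < k" for l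
    using that by (simp add: take_map del: upt_Suc)
  then have "(\<forall>l<k. b * l \<le> sum_list (take l (map x [1..<Suc k]))) \<longleftrightarrow> (\<forall>l<k. b * l \<le> (\<Sum>j=1..l. x j))"
    by (metis sum)
  moreover have "map x [1..<Suc k] \<noteq> [] \<longleftrightarrow> 1 \<le> k" by auto
  ultimately show ?thesis unfolding first_pass_def by (simp only: sum length_map length_upt diff_Suc_1)
qed

lemma first_below_eq:
  assumes "first_pass b (map x [1..<Suc k])"
  shows "first_below b x = k"
proof -
  have f: "1 \<le> k" "(\<Sum>j=1..k. x j) < b * k" "\<And>l. l < k \<Longrightarrow> b * l \<le> (\<Sum>j=1..l. x j)"
    using assms unfolding first_pass_map by blast+
  show ?thesis unfolding first_below_def
  proof (rule Least_equality)
    show "k \<le> i" if "1 \<le> i \<and> (\<Sum>j=1..i. x j) < b * i" for i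
      using f(3)[of i] that by (meson leD leI)
  qed (use f in blast)
qed

text \<open>Without a passage the value is the default of \<open>LEAST\<close>. Its preimage has to
  be known for measurability; \<open>passage_eq\<close> attaches it to what turns out to be a null
  set.\<close>

lemma first_below_none:
  assumes "\<And>k. \<not> first_pass b (map x [1..<Suc k])"
  shows "first_below b x = (LEAST i. False)"
proof -
  have "\<not> (\<exists>i. 1 \<le> i \<and> (\<Sum>j=1..i. x j) < b * i)"
  proof
    assume ex: "\<exists>i. 1 \<le> i \<and> (\<Sum>j=1..i. x j) < b * i"
    define k where "k = (LEAST i. 1 \<le> i \<and> (\<Sum>j=1..i. x j) < b * i)"
    have k: "1 \<le> k \<and> (\<Sum>j=1..k. x j) < b * k" unfolding k_def by (rule LeastI_ex[OF ex])
    have "b * l \<le> (\<Sum>j=1..l. x j)" if "l < k" for l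
      using not_less_Least[OF that[unfolded k_def]] by (cases "l = 0") auto
    with k assms[of k] show False unfolding first_pass_map by blast
  qed
  then have "(\<lambda>i. 1 \<le> i \<and> (\<Sum>j=1..i. x j) < b * i) = (\<lambda>i. False)" by blast
  then show ?thesis unfolding first_below_def by simp
qed

locale passage_model = poisson_load +
  fixes N :: "'c measure" and Y :: "nat \<Rightarrow> 'c \<Rightarrow> nat"
  assumes iid: "iid_poisson N {1..} Y rate"
begin

sublocale prob_space N using iid by (simp add: iid_poisson_def)

definition passage :: "'c \<Rightarrow> nat" where "passage y = first_below b (\<lambda>i. Y i y)"

definition pass_event :: "nat \<Rightarrow> 'c set" where
  "pass_event k = {y \<in> space N. first_pass b (map (\<lambda>i. Y i y) [1..<Suc k])}"

lemma pass_event_measurable [measurable]: "pass_event k \<in> sets N"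
proof -
  have "(\<lambda>y. map (\<lambda>i. Y i y) [1..<Suc k]) \<in> measurable N (count_space UNIV)"
    by (intro measurable_map_list iid_poisson_measurable[OF iid]) auto
  from measurable_sets[OF this, of "{zs. first_pass b zs}"] show ?thesis
    by (simp add: pass_event_def vimage_def Int_def conj_commute del: upt_Suc)
qed

lemma prob_pass_event: "prob (pass_event k) = pass_prob b rate k"
  unfolding pass_event_def pass_prob_def
  by (subst iid_poisson_prob_map[OF iid]) (auto simp del: upt_Suc)

lemma prob_pass_events: "prob (\<Union>k. pass_event k) = 1"
proof -
  have "(\<lambda>k. prob (pass_event k)) sums prob (\<Union>k. pass_event k)"
  proof (intro finite_measure_UNION)
    show "disjoint_family pass_event"
      unfolding disjoint_family_on_def pass_event_def using first_below_eq by blast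
  qed auto
  then show ?thesis using pass_prob_sums_1 sums_unique2 unfolding prob_pass_event by blast
qed

lemma passage_eq:
  "{y \<in> space N. passage y = k} =
    pass_event k \<union> (if k = (LEAST i. False) then space N - (\<Union>k. pass_event k) else {})"
proof (intro set_eqI)
  fix y
  show "y \<in> {y \<in> space N. passage y = k} \<longleftrightarrow>
    y \<in> pass_event k \<union> (if k = (LEAST i. False) then space N - (\<Union>k. pass_event k) else {})"
  proof (cases "y \<in> space N \<and> (\<exists>k'. y \<in> pass_event k')")
    case True
    then obtain k' where k': "y \<in> pass_event k'" by blast
    then have "passage y = k'" unfolding passage_def pass_event_def by (blast intro: first_below_eq)
    moreover have "y \<in> pass_event k \<Longrightarrow> passage y = k" unfolding passage_def pass_event_def
      by (blast intro: first_below_eq)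
    ultimately show ?thesis using k' True by auto
  next
    case False
    then show ?thesis
      using first_below_none[of b "\<lambda>i. Y i y"] unfolding passage_def pass_event_def
        by (auto simp del: upt_Suc)
  qed
qed

lemma passage_measurable: "passage \<in> measurable N (count_space UNIV)"
proof (subst measurable_count_space_eq_countable, safe)
  fix k
  have "passage -` {k} \<inter> space N = {y \<in> space N. passage y = k}" by auto
  then show "passage -` {k} \<inter> space N \<in> sets N" unfolding passage_eq by auto
qed auto

lemma prob_passage: "prob {y \<in> space N. passage y = k} = pass_prob b rate k"
proof -
  have "AE y in N. y \<in> (\<Union>k. pass_event k)"
    using prob_pass_events by (intro AE_prob_1)
  then have "AE y in N. (y \<in> {y \<in> space N. passage y = k}) \<longleftrightarrow> y \<in> pass_event k"
    unfolding passage_eq by eventually_elim auto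
  moreover have "{y \<in> space N. passage y = k} \<in> sets N" unfolding passage_eq by auto
  ultimately show ?thesis unfolding prob_pass_event[symmetric] by (intro finite_measure_eq_AE) auto
qed

lemma passage_pgf:
  assumes "norm q < pgf_radius b \<alpha>"
  shows "integrable N (\<lambda>y. q ^ passage y)" "pgf N passage q = pass_gf q"
proof -
  have s: "summable (\<lambda>k. prob {y \<in> space N. passage y = k} * norm (q ^ k))"
    using pass_gf_summable[OF assms] pass_prob_nonneg by (simp add: prob_passage norm_mult)
  show "integrable N (\<lambda>y. q ^ passage y)"
    by (rule nat_valued_expectation(1)[OF prob_space_axioms passage_measurable s])
  show "pgf N passage q = pass_gf q"
    using nat_valued_expectation(2)[OF prob_space_axioms passage_measurable s]
    by (simp add: pgf_def pass_gf_def prob_passage scaleR_conv_of_real sums_iff)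
qed

lemma passage_mean: "complex_of_real (\<integral>y. real (passage y) \<partial>N) = 1 / T0 b \<alpha>"
proof -
  have "summable (\<lambda>i. norm (of_nat i * of_real (pass_prob b rate i) * (1 :: complex) ^ i))"
    using pgf_radius_gt_1 by (intro pass_gf_has_derivative(2)) simp
  then have s: "summable (\<lambda>k. prob {y \<in> space N. passage y = k} * norm (real k))"
    using pass_prob_nonneg by (simp add: prob_passage norm_mult mult.commute)
  have "(\<lambda>k. pass_prob b rate k * real k) sums (\<integral>y. real (passage y) \<partial>N)"
    using nat_valued_expectation(2)[OF prob_space_axioms passage_measurable s]
      by (simp add: prob_passage)
  then have "(\<lambda>k. complex_of_real (pass_prob b rate k * real k)) sums of_real (\<integral>y. real (passage y) \<partial>N)"
    by (simp only: sums_of_real_iff)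
  moreover have "(\<lambda>k. complex_of_real (pass_prob b rate k * real k)) sums (1 / T0 b \<alpha>)"
    using pass_prob_mean_sums by (simp add: mult.commute)
  ultimately show ?thesis by (rule sums_unique2)
qed

end

section \<open>Weighted convergence of the block length laws\<close>

context infinite_model
begin

definition block_len :: "'a \<Rightarrow> nat" where
  "block_len \<omega> = block_length (infinite_full b (counts \<omega>)) 0"

definition block_pmf :: "nat \<Rightarrow> real" where
  "block_pmf k = real k * (nonfull_prob b rate * pass_prob b rate k)"

definition exact_pmf :: "nat \<Rightarrow> nat \<Rightarrow> int \<Rightarrow> nat \<Rightarrow> real" where
  "exact_pmf m n v k = hash_prob m n {as. block_length (exact_full b m as) v = k}"

definition ratio :: real where "ratio = decay upper_load"

text \<open>A number strictly between 1 and \<open>1 / ratio\<close>: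
  \<open>growth * ratio < 1\<close> keeps the weighted majorant summable, and the excess over 1
  becomes \<delta>. It depends on b and \<alpha> only.\<close>

definition growth :: real where "growth = (1 + 1 / ratio) / 2"

lemma ratio_bounds: "0 < ratio" "ratio < 1"
  using decay_bounds[OF upper_load(1,2)] by (simp_all add: ratio_def)

lemma growth: "growth > 1" "growth * ratio < 1"
  using ratio_bounds by (simp_all add: growth_def field_simps)

lemma majorant_summable: "summable (\<lambda>k. real k * ratio ^ (k - 1) * growth ^ k)"
proof -
  have "(\<lambda>k. real (Suc k) * (growth * ratio) ^ k) sums (1 / (1 - growth * ratio)\<^sup>2)"
    using growth ratio_bounds by (intro geometric_deriv_sums) simp
  then have "summable (\<lambda>k. growth * (real (Suc k) * (growth * ratio) ^ k))"
    by (intro summable_mult) (rule sums_summable)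
  then have "summable (\<lambda>k. real (Suc k) * ratio ^ (Suc k - 1) * growth ^ Suc k)"
    by (simp add: power_mult_distrib mult_ac)
  then show ?thesis by (subst (asm) summable_Suc_iff)
qed

lemma exact_pmf_bounds:
  assumes "real n \<le> real b * upper_load * real m" "n < b * m"
  shows "0 \<le> exact_pmf m n v k" "exact_pmf m n v k \<le> real k * ratio ^ (k - 1)"
  using exact_block_length_bound[OF upper_load(1,2) assms, of v k]
    by (simp_all add: exact_pmf_def ratio_def)

context
  fixes m n :: "nat \<Rightarrow> nat" and v :: "nat \<Rightarrow> int"
  assumes m: "filterlim m at_top sequentially" and n: "filterlim n at_top sequentially"
    and nm: "\<And>t. n t < b * m t"
    and lim: "(\<lambda>t. real (n t) / (real b * real (m t))) \<longlonglongrightarrow> \<alpha>"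
begin

lemma exact_pmf_limit: "(\<lambda>t. exact_pmf (m t) (n t) (v t) k) \<longlonglongrightarrow> block_pmf k"
  unfolding exact_pmf_def block_pmf_def by (rule exact_block_length_limit[OF m n nm lim])

lemma block_pmf_bounds_of_sequence: "0 \<le> block_pmf k" "block_pmf k \<le> real k * ratio ^ (k - 1)"
proof -
  show "0 \<le> block_pmf k"
    by (rule tendsto_lowerbound[OF exact_pmf_limit]) (auto simp: exact_pmf_def)
  show "block_pmf k \<le> real k * ratio ^ (k - 1)"
  proof (rule tendsto_upperbound[OF exact_pmf_limit])
    show "\<forall>\<^sub>F t in sequentially. exact_pmf (m t) (n t) (v t) k \<le> real k * ratio ^ (k - 1)"
      using eventually_upper_load[OF m lim] by eventually_elim (rule exact_pmf_bounds(2)[OF _ nm])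
  qed simp
qed

text \<open>Tannery's theorem with the common majorant. This one weighted norm controls every test
  function bounded by \<open>C * growth ^ k\<close>, and so all the modes of convergence at
  once.\<close>

lemma exact_pmf_weighted_l1:
  "(\<lambda>t. \<Sum>k. \<bar>exact_pmf (m t) (n t) (v t) k - block_pmf k\<bar> * growth ^ k) \<longlonglongrightarrow> 0"
proof -
  have "(\<lambda>t. \<Sum>k. \<bar>exact_pmf (m t) (n t) (v t) k - block_pmf k\<bar> * growth ^ k) \<longlonglongrightarrow> (\<Sum>k. 0 :: real)"
  proof (rule tannerys_theorem[THEN conjunct2, THEN conjunct2])
    fix k
    have "(\<lambda>t. \<bar>exact_pmf (m t) (n t) (v t) k - block_pmf k\<bar> * growth ^ k) \<longlonglongrightarrow>
      \<bar>block_pmf k - block_pmf k\<bar> * growth ^ k"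
      by (intro tendsto_intros exact_pmf_limit)
    then show "(\<lambda>t. \<bar>exact_pmf (m t) (n t) (v t) k - block_pmf k\<bar> * growth ^ k) \<longlonglongrightarrow> 0" by simp
  next
    show "summable (\<lambda>k. real k * ratio ^ (k - 1) * growth ^ k)" by (rule majorant_summable)
    have "\<forall>\<^sub>F (k :: nat, t) in at_top \<times>\<^sub>F sequentially. real (n t) \<le> real b * upper_load * real (m t)"
      using eventually_upper_load[OF m lim] by (simp add: eventually_prod2)
    then show "\<forall>\<^sub>F (k, t) in at_top \<times>\<^sub>F sequentially.
      norm (\<bar>exact_pmf (m t) (n t) (v t) k - block_pmf k\<bar> * growth ^ k) \<le>
        real k * ratio ^ (k - 1) * growth ^ k"
    proof (rule eventually_mono, clarify)
      fix k t assume "real (n t) \<le> real b * upper_load * real (m t)"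
      then have "\<bar>exact_pmf (m t) (n t) (v t) k - block_pmf k\<bar> \<le> real k * ratio ^ (k - 1)"
        using exact_pmf_bounds[OF _ nm, of t "v t" k] block_pmf_bounds_of_sequence[of k] by linarith
      then show "norm (\<bar>exact_pmf (m t) (n t) (v t) k - block_pmf k\<bar> * growth ^ k) \<le>
        real k * ratio ^ (k - 1) * growth ^ k"
        using growth by (simp add: abs_mult mult_right_mono)
    qed
  qed simp
  then show ?thesis by simp
qed

end

text \<open>Facts about the infinite model alone, namely the bound on its block law and the total
  mass, are inherited from exact tables along some sequence. Take m = t + 1 and round the expected
  number of keys down.\<close>

lemma exact_sequence_exists:
  obtains m n :: "nat \<Rightarrow> nat" where "filterlim m at_top sequentially" "filterlim n at_top sequentially"
    "\<And>t. n t < b * m t" "(\<lambda>t. real (n t) / (real b * real (m t))) \<longlonglongrightarrow> \<alpha>"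
proof -
  define n where "n t = nat \<lfloor>rate * real (Suc t)\<rfloor>" for t
  have nl: "real (n t) \<le> rate * real (Suc t)" "rate * real (Suc t) - 1 \<le> real (n t)" for t
    using rate_pos by (simp_all add: n_def del: of_nat_Suc)
  have "filterlim (\<lambda>t. rate * real (Suc t) - 1) at_top sequentially"
  proof -
    have "filterlim (\<lambda>t. c * real (Suc t) - 1) at_top sequentially" if "c > 0" for c :: real
      using that by real_asymp
    then show ?thesis using rate_pos by blast
  qed
  then have "filterlim (\<lambda>t. real (n t)) at_top sequentially"
    by (rule filterlim_at_top_mono) (simp add: nl del: of_nat_Suc)
  then have 1: "filterlim n at_top sequentially" by (simp add: filterlim_sequentially_iff_filterlim_real)
  have 2: "n t < b * Suc t" for t
  proof -
    have "rate * real (Suc t) < real b * real (Suc t)" using \<alpha> b by (intro mult_strict_right_mono) auto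
    then have "real (n t) < real (b * Suc t)" using nl(1)[of t] by (simp only: of_nat_mult)
    then show ?thesis by (simp only: of_nat_less_iff)
  qed
  have "(\<lambda>t. real (n t) / (real b * real (Suc t)) - \<alpha>) \<longlonglongrightarrow> 0"
  proof (rule Lim_null_comparison)
    have "(\<lambda>t. 1 / (c * real (Suc t))) \<longlonglongrightarrow> 0" if "c > 0" for c :: real using that by real_asymp
    then show "(\<lambda>t. 1 / (real b * real (Suc t))) \<longlonglongrightarrow> 0" using b by simp
    show "\<forall>\<^sub>F t in sequentially. norm (real (n t) / (real b * real (Suc t)) - \<alpha>) \<le>
      1 / (real b * real (Suc t))"
    proof (intro always_eventually allI)
      fix t
      define c where "c = real b * real (Suc t)"
      have c: "c > 0" using b by (simp add: c_def)
      have "real (n t) / c - \<alpha> = (real (n t) - rate * real (Suc t)) / c" using c 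
      proof -
        have eq: "rate * real (Suc t) = \<alpha> * c" by (simp only: c_def mult_ac)
        show ?thesis unfolding eq using c by (simp add: diff_divide_distrib)
      qed
      moreover have "\<bar>real (n t) - rate * real (Suc t)\<bar> \<le> 1" using nl[of t] by linarith
      ultimately show "norm (real (n t) / (real b * real (Suc t)) - \<alpha>) \<le> 1 / (real b * real (Suc t))"
        using c unfolding c_def[symmetric] by (simp add: divide_right_mono)
    qed
  qed
  then have 3: "(\<lambda>t. real (n t) / (real b * real (Suc t))) \<longlonglongrightarrow> \<alpha>" by (simp add: LIM_zero_iff)
  show ?thesis using that[of Suc n] 1 2 3 filterlim_Suc by blast
qed

lemma block_pmf_bounds: "0 \<le> block_pmf k" "block_pmf k \<le> real k * ratio ^ (k - 1)"
proof -
  obtain m n where "filterlim m at_top sequentially" "filterlim n at_top sequentially"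
    "\<And>t. n t < b * m t" "(\<lambda>t. real (n t) / (real b * real (m t))) \<longlonglongrightarrow> \<alpha>"
    using exact_sequence_exists by blast
  from block_pmf_bounds_of_sequence[OF this] show "0 \<le> block_pmf k" "block_pmf k \<le>
    real k * ratio ^ (k - 1)" .
qed

lemma exact_pmf_sums_1: "exact_pmf m n v sums 1"
proof -
  have "(\<lambda>as. block_length (exact_full b m as) v) \<in> measurable (measure_pmf (hash_addresses m n))
    (count_space UNIV)" by simp
  from nat_valued_prob_sums_1[OF measure_pmf.prob_space_axioms this] show ?thesis
    by (simp add: exact_pmf_def[abs_def])
qed

lemma weighted_summable:
  assumes "\<And>k. 0 \<le> f k \<and> f k \<le> real k * ratio ^ (k - 1)" "\<And>k. 0 \<le> h k \<and> h k \<le> C * growth ^ k"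
  shows "summable (\<lambda>k. f k * h k)"
proof (rule summable_comparison_test_ev)
  show "summable (\<lambda>k. C * (real k * ratio ^ (k - 1) * growth ^ k))"
    by (intro summable_mult majorant_summable)
  show "\<forall>\<^sub>F k in sequentially. norm (f k * h k) \<le> C * (real k * ratio ^ (k - 1) * growth ^ k)"
  proof (intro always_eventually allI)
    fix k
    have "f k * h k \<le> (real k * ratio ^ (k - 1)) * (C * growth ^ k)"
      using assms(1)[of k] assms(2)[of k] ratio_bounds by (intro mult_mono) auto
    then show "norm (f k * h k) \<le> C * (real k * ratio ^ (k - 1) * growth ^ k)"
      using assms(1)[of k] assms(2)[of k] by (simp add: mult_ac)
  qed
qed

lemma abs_diff_summable:
  assumes "real n \<le> real b * upper_load * real m" "n < b * m"
  shows "summable (\<lambda>k. \<bar>exact_pmf m n v k - block_pmf k\<bar> * growth ^ k)"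
proof (rule weighted_summable[where C=1])
  show "0 \<le> \<bar>exact_pmf m n v k - block_pmf k\<bar> \<and> \<bar>exact_pmf m n v k - block_pmf k\<bar> \<le>
    real k * ratio ^ (k - 1)" for k
    using exact_pmf_bounds[OF assms, of v k] block_pmf_bounds[of k] by linarith
qed (use growth in simp)

text \<open>The exact laws have mass 1, and the weighted norm dominates the difference of total
  masses because \<open>growth ^ k\<close> is at least 1. So no mass escapes in the limit.\<close>

lemma block_pmf_sums_1: "block_pmf sums 1"
proof -
  obtain m n where mn: "filterlim m at_top sequentially" "filterlim n at_top sequentially"
    "\<And>t. n t < b * m t" "(\<lambda>t. real (n t) / (real b * real (m t))) \<longlonglongrightarrow> \<alpha>"
    using exact_sequence_exists by blast
  have sb: "summable block_pmf"
    using weighted_summable[of block_pmf "\<lambda>_. 1" 1] block_pmf_bounds growth by simp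
  have "eventually (\<lambda>t. \<bar>1 - suminf block_pmf\<bar> \<le>
    (\<Sum>k. \<bar>exact_pmf (m t) (n t) 0 k - block_pmf k\<bar> * growth ^ k)) sequentially"
    using eventually_upper_load[OF mn(1,4)]
  proof eventually_elim
    case (elim t)
    let ?d = "\<lambda>k. exact_pmf (m t) (n t) 0 k - block_pmf k"
    have s: "summable (\<lambda>k. \<bar>?d k\<bar> * growth ^ k)" by (rule abs_diff_summable[OF elim mn(3)])
    have le: "\<bar>?d k\<bar> \<le> \<bar>?d k\<bar> * growth ^ k" for k
      using growth one_le_power[of growth k]
        by (intro mult_left_le_one_le[THEN order.trans, rotated] mult_le_cancel_left1[THEN iffD2]) auto
    have s': "summable (\<lambda>k. \<bar>?d k\<bar>)"
      by (rule summable_comparison_test_ev[OF _ s]) (use le in \<open>auto intro!: always_eventually\<close>)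
    have "1 - suminf block_pmf = (\<Sum>k. ?d k)"
      using exact_pmf_sums_1[of "m t" "n t" 0] sb suminf_diff[of "exact_pmf (m t) (n t) 0" block_pmf]
      by (simp add: sums_iff)
    also have "\<bar>\<dots>\<bar> \<le> (\<Sum>k. \<bar>?d k\<bar>)" by (rule summable_rabs[OF s'])
    also have "\<dots> \<le> (\<Sum>k. \<bar>?d k\<bar> * growth ^ k)" by (rule suminf_le[OF le s' s])
    finally show ?case .
  qed
  then have "\<bar>1 - suminf block_pmf\<bar> \<le> 0"
    by (intro tendsto_lowerbound[OF exact_pmf_weighted_l1[OF mn, of "\<lambda>_. 0"]]) auto
  then show ?thesis using summable_sums[OF sb] by simp
qed

lemma block_len_measurable: "block_len \<in> measurable M (count_space UNIV)"
  unfolding block_len_def[abs_def] by (rule block_length_measurable)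

lemma prob_block_len: "prob {\<omega> \<in> space M. block_len \<omega> = k} = block_pmf k"
proof (cases "k = 0")
  case False
  then show ?thesis using prob_block_length[of k] by (simp add: block_len_def block_pmf_def)
next
  \<comment> \<open>Length 0 stands for the absence of a block; its probability is accessible only
    as the mass left over by the positive lengths.\<close>
  case True
  have "(\<lambda>k. prob {\<omega> \<in> space M. block_len \<omega> = k}) sums 1"
    by (rule nat_valued_prob_sums_1[OF prob_space_axioms block_len_measurable])
  then have "(\<lambda>k. prob {\<omega> \<in> space M. block_len \<omega> = Suc k}) sums
    (1 - prob {\<omega> \<in> space M. block_len \<omega> = 0})"
    by (subst sums_Suc_iff) simp
  moreover have "(\<lambda>k. block_pmf (Suc k)) sums (1 - block_pmf 0)"
    using block_pmf_sums_1 by (subst sums_Suc_iff) simp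
  moreover have "prob {\<omega> \<in> space M. block_len \<omega> = Suc k} = block_pmf (Suc k)" for k
    using prob_block_length[of "Suc k"] by (simp add: block_len_def block_pmf_def)
  ultimately have "prob {\<omega> \<in> space M. block_len \<omega> = 0} = block_pmf 0"
    using sums_unique2 by fastforce
  then show ?thesis using True by simp
qed

lemma block_len_expectation:
  fixes g :: "nat \<Rightarrow> 'b :: {banach, second_countable_topology}"
  assumes "\<And>k. norm (g k) \<le> C * growth ^ k"
  shows "integrable M (\<lambda>\<omega>. g (block_len \<omega>))" "(\<lambda>k. block_pmf k *\<^sub>R g k) sums (\<integral>\<omega>. g (block_len \<omega>) \<partial>M)"
proof -
  have s: "summable (\<lambda>k. prob {\<omega> \<in> space M. block_len \<omega> = k} * norm (g k))"
    unfolding prob_block_len using block_pmf_bounds assms by (intro weighted_summable) auto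
  show "integrable M (\<lambda>\<omega>. g (block_len \<omega>))" "(\<lambda>k. block_pmf k *\<^sub>R g k) sums (\<integral>\<omega>. g (block_len \<omega>) \<partial>M)"
    using nat_valued_expectation[OF prob_space_axioms block_len_measurable s]
      by (simp_all add: prob_block_len)
qed

text \<open>The test function enters only through C, so the estimate is uniform over families with a
  common C, such as \<open>q ^ k\<close> on a disk.\<close>

lemma exact_expectation_close:
  fixes g :: "nat \<Rightarrow> 'b :: {banach, second_countable_topology}"
  assumes g: "\<And>k. norm (g k) \<le> C * growth ^ k"
    and n: "real n \<le> real b * upper_load * real m" "n < b * m"
  shows "norm ((\<integral>as. g (block_length (exact_full b m as) v) \<partial>measure_pmf (hash_addresses m n)) - (\<integral>\<omega>. g
    (block_len \<omega>) \<partial>M)) \<le>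
    C * (\<Sum>k. \<bar>exact_pmf m n v k - block_pmf k\<bar> * growth ^ k)"
proof -
  have meas: "(\<lambda>as. block_length (exact_full b m as) v) \<in> measurable (measure_pmf (hash_addresses m n))
    (count_space UNIV)" by simp
  have s: "summable (\<lambda>k. measure (measure_pmf (hash_addresses m n)) {as \<in> space (measure_pmf
    (hash_addresses m n)). block_length (exact_full b m as) v = k} * norm (g k))"
    using exact_pmf_bounds[OF n, of v] g unfolding exact_pmf_def
    by (intro weighted_summable) auto
  have 1: "(\<lambda>k. exact_pmf m n v k *\<^sub>R g k) sums
    (\<integral>as. g (block_length (exact_full b m as) v) \<partial>measure_pmf (hash_addresses m n))"
    using nat_valued_expectation(2)[OF measure_pmf.prob_space_axioms meas s] by (simp add: exact_pmf_def)
  have diff: "(\<lambda>k. (exact_pmf m n v k - block_pmf k) *\<^sub>R g k) sums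
    ((\<integral>as. g (block_length (exact_full b m as) v) \<partial>measure_pmf (hash_addresses m n)) - (\<integral>\<omega>. g
      (block_len \<omega>) \<partial>M))"
    using sums_diff[OF 1 block_len_expectation(2)[OF g]] by (simp add: scaleR_diff_left)
  have le: "norm ((exact_pmf m n v k - block_pmf k) *\<^sub>R g k) \<le>
    C * (\<bar>exact_pmf m n v k - block_pmf k\<bar> * growth ^ k)" for k
    using mult_left_mono[OF g[of k], of "\<bar>exact_pmf m n v k - block_pmf k\<bar>"] by (simp add: mult_ac)
  have sC: "summable (\<lambda>k. C * (\<bar>exact_pmf m n v k - block_pmf k\<bar> * growth ^ k))"
    by (intro summable_mult abs_diff_summable n)
  have "norm (\<Sum>k. (exact_pmf m n v k - block_pmf k) *\<^sub>R g k) \<le>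
    (\<Sum>k. C * (\<bar>exact_pmf m n v k - block_pmf k\<bar> * growth ^ k))"
    by (rule norm_suminf_le[OF le sC])
  also have "\<dots> = C * (\<Sum>k. \<bar>exact_pmf m n v k - block_pmf k\<bar> * growth ^ k)"
    by (intro suminf_mult abs_diff_summable n)
  finally show ?thesis using sums_unique[OF diff] by simp
qed

text \<open>With \<open>\<epsilon> = ln growth\<close>, the number
  \<open>(\<epsilon> * k) ^ r / r!\<close> is a term of the series of
  \<open>exp (\<epsilon> * k) = growth ^ k\<close>.\<close>

lemma power_le_growth: "\<exists>C. \<forall>k. real k ^ r \<le> C * growth ^ k"
proof -
  define \<epsilon> where "\<epsilon> = ln growth"
  have \<epsilon>: "\<epsilon> > 0" using growth by (simp add: \<epsilon>_def)
  have "real k ^ r \<le> fact r / \<epsilon> ^ r * growth ^ k" for k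
  proof -
    have "(\<epsilon> * real k) ^ r / fact r \<le> exp (\<epsilon> * real k)"
      using sum_le_suminf[OF summable_exp[of "\<epsilon> * real k"], of "{r}"] \<epsilon>
      by (simp add: exp_def divide_inverse mult.commute)
    also have "exp (\<epsilon> * real k) = growth ^ k"
      using growth exp_of_nat2_mult[of \<epsilon> k] by (simp add: \<epsilon>_def)
    finally show ?thesis using \<epsilon> by (simp add: field_simps power_mult_distrib)
  qed
  then show ?thesis by blast
qed

end

section \<open>Identification of the constant and the generating functions\<close>

context infinite_model
begin

text \<open>The block law \<open>k * p * P(B = k)\<close> has total mass 1, while
  \<open>k * P(B = k)\<close> adds up to \<open>1 / T0\<close>.\<close>

lemma nonfull_prob_T0: "complex_of_real (nonfull_prob b rate) = T0 b \<alpha>"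
proof -
  have "(\<lambda>k. complex_of_real (block_pmf k)) sums of_real 1"
    using block_pmf_sums_1 by (simp only: sums_of_real_iff)
  moreover have "(\<lambda>k. complex_of_real (block_pmf k)) sums (of_real (nonfull_prob b rate) * (1 / T0 b \<alpha>))"
    using sums_mult[OF pass_prob_mean_sums, of "of_real (nonfull_prob b rate)"]
      by (simp add: block_pmf_def mult_ac)
  ultimately have "of_real (nonfull_prob b rate) * (1 / T0 b \<alpha>) = 1"
    using sums_unique2 by fastforce
  \<comment> \<open>If \<open>T0\<close> were 0, then \<open>1 / T0\<close> would be 0 as well and
    the product could not be 1.\<close>
  then show ?thesis by (cases "T0 b \<alpha> = 0") (simp_all add: field_simps)
qed

lemma block_len_pgf:
  assumes "norm q < pgf_radius b \<alpha>"
  shows "integrable M (\<lambda>\<omega>. q ^ block_len \<omega>)" "pgf M block_len q = T0 b \<alpha> * q * deriv pass_gf q"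
proof -
  have "summable (\<lambda>k. nonfull_prob b rate * norm (of_nat k * of_real (pass_prob b rate k) * q ^ k))"
    by (intro summable_mult pass_gf_has_derivative(2) assms)
  then have s: "summable (\<lambda>k. prob {\<omega> \<in> space M. block_len \<omega> = k} * norm (q ^ k))"
    using pass_prob_nonneg by (simp add: prob_block_len block_pmf_def norm_mult mult_ac)
  show "integrable M (\<lambda>\<omega>. q ^ block_len \<omega>)"
    by (rule nat_valued_expectation(1)[OF prob_space_axioms block_len_measurable s])
  have "(\<lambda>k. of_real (block_pmf k) * q ^ k) sums pgf M block_len q"
    using nat_valued_expectation(2)[OF prob_space_axioms block_len_measurable s]
    by (simp add: pgf_def prob_block_len scaleR_conv_of_real)
  moreover have "(\<lambda>k. of_real (block_pmf k) * q ^ k) sums (T0 b \<alpha> * (q * deriv pass_gf q))"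
    using sums_mult[OF pass_gf_derivative_mult[OF assms], of "T0 b \<alpha>"]
    by (simp add: block_pmf_def nonfull_prob_T0[symmetric] mult_ac)
  ultimately show "pgf M block_len q = T0 b \<alpha> * q * deriv pass_gf q"
    using sums_unique2 by (metis mult.assoc)
qed

end

context poisson_load
begin

text \<open>Near q the function \<open>pass_gf\<close> is \<open>pass_gf_root\<close> composed with
  \<rho>, whichever branch \<rho> is; the chain rule is applied to each factor of the
  product.\<close>

lemma pass_gf_branch:
  assumes U: "open U" "\<rho> holomorphic_on U" "\<forall>z\<in>U. \<rho> z ^ b = z" and q: "q \<in> U" "norm q < pgf_radius b \<alpha>"
  shows "(\<lambda>z. zeta l (\<rho> z)) field_differentiable (at q)"
    and "deriv pass_gf q = (\<Sum>l<b. deriv (\<lambda>z. zeta l (\<rho> z)) q *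
            (\<Prod>j\<in>{..<b} - {l}. 1 - zeta j (\<rho> q)))"
proof -
  have rad: "norm (\<rho> z) < root_radius" if "z \<in> U" "norm z < pgf_radius b \<alpha>" for z
  proof (rule power_less_imp_less_base[of _ b])
    show "norm (\<rho> z) ^ b < root_radius ^ b" using that U(3) by (simp add: pgf_radius_eq flip: norm_power)
  qed (use root_radius_gt_1 in simp)
  have d\<rho>: "(\<rho> has_field_derivative deriv \<rho> q) (at q)" by (rule holomorphic_derivI[OF U(2,1) q(1)])
  have dz: "((\<lambda>z. zeta l (\<rho> z)) has_field_derivative deriv (zeta l) (\<rho> q) * deriv \<rho> q) (at q)" for l
    by (rule DERIV_chain2[OF zeta_has_derivative[OF rad[OF q]] d\<rho>])
  then show "(\<lambda>z. zeta l (\<rho> z)) field_differentiable (at q)"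
    by (auto simp: field_differentiable_def)
  have dz': "deriv (\<lambda>z. zeta l (\<rho> z)) q = deriv (zeta l) (\<rho> q) * deriv \<rho> q" for l
    by (rule DERIV_imp_deriv[OF dz])
  have "((\<lambda>z. pass_gf_root (\<rho> z)) has_field_derivative
    (\<Sum>l<b. deriv (zeta l) (\<rho> q) * (\<Prod>j\<in>{..<b} - {l}. 1 - zeta j (\<rho> q))) * deriv \<rho> q) (at q)"
    by (rule DERIV_chain2[OF pass_gf_root_derivative[OF rad[OF q]] d\<rho>])
  moreover have "eventually (\<lambda>z. z \<in> U \<inter> ball 0 (pgf_radius b \<alpha>)) (nhds q)"
    using q U(1) by (intro eventually_nhds_in_open) auto
  then have "eventually (\<lambda>z. pass_gf_root (\<rho> z) = pass_gf z) (nhds q)"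
  proof eventually_elim
    case (elim z)
    then show ?case using pass_gf_root[of "\<rho> z"] rad[of z] U(3) by simp
  qed
  ultimately have "(pass_gf has_field_derivative
    (\<Sum>l<b. deriv (zeta l) (\<rho> q) * (\<Prod>j\<in>{..<b} - {l}. 1 - zeta j (\<rho> q))) * deriv \<rho> q) (at q)"
    by (subst DERIV_cong_ev[OF refl, symmetric]) auto
  then have "deriv pass_gf q = (\<Sum>l<b. deriv (zeta l) (\<rho> q) * (\<Prod>j\<in>{..<b} - {l}. 1 - zeta j (\<rho> q))) *
    deriv \<rho> q"
    by (rule DERIV_imp_deriv)
  then show "deriv pass_gf q = (\<Sum>l<b. deriv (\<lambda>z. zeta l (\<rho> z)) q *
            (\<Prod>j\<in>{..<b} - {l}. 1 - zeta j (\<rho> q)))"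
    unfolding dz' by (simp add: sum_distrib_left sum_distrib_right mult_ac)
qed

end

context passage_model
begin

lemma passage_pgf_derivative:
  assumes "norm q < pgf_radius b \<alpha>"
  shows "pgf N passage field_differentiable (at q)" "deriv (pgf N passage) q = deriv pass_gf q"
proof -
  have "eventually (\<lambda>z. z \<in> ball 0 (pgf_radius b \<alpha>)) (nhds q)"
    using assms by (intro eventually_nhds_in_open) auto
  then have ev: "eventually (\<lambda>z. pgf N passage z = pass_gf z) (nhds q)"
    by eventually_elim (simp add: passage_pgf)
  then show "deriv (pgf N passage) q = deriv pass_gf q" by (rule deriv_cong_ev) simp
  show "pgf N passage field_differentiable (at q)"
    unfolding field_differentiable_def
    using DERIV_cong_ev[OF refl ev refl] pass_gf_has_derivative(1)[OF assms] by blast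
qed

end

section \<open>Modes of convergence in the exact model\<close>

context infinite_model
begin

context
  fixes m n :: "nat \<Rightarrow> nat" and v :: "nat \<Rightarrow> int"
  assumes m: "filterlim m at_top sequentially" and n: "filterlim n at_top sequentially"
    and nm: "\<And>t. n t < b * m t"
    and lim: "(\<lambda>t. real (n t) / (real b * real (m t))) \<longlonglongrightarrow> \<alpha>"
begin

abbreviation exact_len :: "nat \<Rightarrow> nat list \<Rightarrow> nat" where
  "exact_len t as \<equiv> block_length (exact_full b (m t) as) (v t)"

lemma exact_expectation_limit:
  fixes g :: "nat \<Rightarrow> 'b :: {banach, second_countable_topology}"
  assumes "\<And>k. norm (g k) \<le> C * growth ^ k"
  shows "(\<lambda>t. \<integral>as. g (exact_len t as) \<partial>measure_pmf (hash_addresses (m t) (n t))) \<longlonglongrightarrow>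
    (\<integral>\<omega>. g (block_len \<omega>) \<partial>M)"
proof -
  have bound: "(\<lambda>t. C * (\<Sum>k. \<bar>exact_pmf (m t) (n t) (v t) k - block_pmf k\<bar> * growth ^ k)) \<longlonglongrightarrow> C * 0"
    by (intro tendsto_mult tendsto_const exact_pmf_weighted_l1[OF m n nm lim])
  have close: "eventually (\<lambda>t. norm ((\<integral>as. g (exact_len t as) \<partial>measure_pmf (hash_addresses (m t)
    (n t))) - (\<integral>\<omega>. g (block_len \<omega>) \<partial>M)) \<le>
    C * (\<Sum>k. \<bar>exact_pmf (m t) (n t) (v t) k - block_pmf k\<bar> * growth ^ k)) sequentially"
    using eventually_upper_load[OF m lim]
      by eventually_elim (rule exact_expectation_close[OF assms _ nm])
  have "(\<lambda>t. (\<integral>as. g (exact_len t as) \<partial>measure_pmf (hash_addresses (m t) (n t))) - (\<integral>\<omega>. g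
    (block_len \<omega>) \<partial>M)) \<longlonglongrightarrow> 0"
    by (rule Lim_null_comparison[OF close bound[unfolded mult_zero_right]])
  then show ?thesis by (simp add: LIM_zero_iff)
qed

text \<open>On the closed disk of radius \<open>growth\<close> the powers of q satisfy the test
  function bound with C = 1 for all q at once.\<close>

lemma exact_pgf_uniform_limit:
  "uniform_limit (cball 0 growth) (\<lambda>t q. pgf (measure_pmf (hash_addresses (m t) (n t)))
    (exact_len t) q) (pgf M block_len) sequentially"
proof (rule uniform_limitI)
  fix e :: real assume e: "e > 0"
  have "eventually (\<lambda>t. (\<Sum>k. \<bar>exact_pmf (m t) (n t) (v t) k - block_pmf k\<bar> * growth ^ k) <
    e) sequentially"
    by (rule order_tendstoD(2)[OF exact_pmf_weighted_l1[OF m n nm lim] e])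
  then show "\<forall>\<^sub>F t in sequentially. \<forall>q\<in>cball 0 growth.
      dist (pgf (measure_pmf (hash_addresses (m t) (n t))) (exact_len t) q) (pgf M block_len q) < e"
    using eventually_upper_load[OF m lim]
  proof eventually_elim
    case (elim t)
    show ?case
    proof
      fix q :: complex assume q: "q \<in> cball 0 growth"
      have "norm (q ^ k) \<le> 1 * growth ^ k" for k
        using q by (simp add: norm_power power_mono)
      from exact_expectation_close[where g="\<lambda>k. q ^ k", OF this elim(2) nm, of "v t"] elim(1)
      show "dist (pgf (measure_pmf (hash_addresses (m t) (n t))) (exact_len t) q) (pgf M block_len q) <
        e"
        by (simp add: pgf_def dist_norm)
    qed
  qed
qed

text \<open>The test function is the indicator of an initial segment, bounded by 1; the distribution
  functions converge at every point x, not only at points of continuity.\<close>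

lemma exact_weak_conv:
  "weak_conv_m (\<lambda>t. distr (measure_pmf (hash_addresses (m t) (n t))) borel (\<lambda>as. real (exact_len t as)))
     (distr M borel (\<lambda>\<omega>. real (block_len \<omega>)))"
  unfolding weak_conv_m_def weak_conv_def
proof (intro allI impI)
  fix x :: real
  define g where "g k = (of_bool (real k \<le> x) :: real)" for k
  have meas: "(\<lambda>\<omega>. real (block_len \<omega>)) \<in> borel_measurable M"
    by (rule measurable_compose[OF block_len_measurable]) simp
  have g: "norm (g k) \<le> 1 * growth ^ k" for k using growth by (simp add: g_def)
  have "cdf (distr (measure_pmf (hash_addresses (m t) (n t))) borel (\<lambda>as. real (exact_len t as))) x =
    (\<integral>as. g (exact_len t as) \<partial>measure_pmf (hash_addresses (m t) (n t)))" for t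
  proof -
    have "cdf (distr (measure_pmf (hash_addresses (m t) (n t))) borel (\<lambda>as. real (exact_len t as))) x =
      hash_prob (m t) (n t) {as. real (exact_len t as) \<le> x}"
      by (simp add: cdf_def measure_distr vimage_def)
    also have "\<dots> = (\<integral>as. indicator {as. real (exact_len t as) \<le>
      x} as \<partial>measure_pmf (hash_addresses (m t) (n t)))" by simp
    also have "indicator {as. real (exact_len t as) \<le> x} = (\<lambda>as. g (exact_len t as))"
      by (simp add: fun_eq_iff indicator_def g_def)
    finally show ?thesis .
  qed
  moreover have "cdf (distr M borel (\<lambda>\<omega>. real (block_len \<omega>))) x = (\<integral>\<omega>. g (block_len \<omega>) \<partial>M)"
  proof -
    have "cdf (distr M borel (\<lambda>\<omega>. real (block_len \<omega>))) x =
      prob ((\<lambda>\<omega>. real (block_len \<omega>)) -` {..x} \<inter> space M)"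
      using meas by (simp add: cdf_def measure_distr)
    also have "\<dots> = (\<integral>\<omega>. indicator ((\<lambda>\<omega>. real (block_len \<omega>)) -` {..x} \<inter> space M) \<omega> \<partial>M)" by simp
    also have "\<dots> = (\<integral>\<omega>. g (block_len \<omega>) \<partial>M)"
      by (intro Bochner_Integration.integral_cong refl) (simp add: indicator_def g_def)
    finally show ?thesis .
  qed
  ultimately show "(\<lambda>t. cdf (distr (measure_pmf (hash_addresses (m t) (n t))) borel (\<lambda>as. real
    (exact_len t as))) x)
    \<longlonglongrightarrow> cdf (distr M borel (\<lambda>\<omega>. real (block_len \<omega>))) x"
    using exact_expectation_limit[OF g] by simp
qed

lemma exact_moment_limit:
  "integrable M (\<lambda>\<omega>. real (block_len \<omega>) ^ r)"
  "(\<lambda>t. \<integral>as. real (exact_len t as) ^ r \<partial>measure_pmf (hash_addresses (m t) (n t))) \<longlonglongrightarrow>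
    (\<integral>\<omega>. real (block_len \<omega>) ^ r \<partial>M)"
proof -
  obtain C where "\<And>k. real k ^ r \<le> C * growth ^ k" using power_le_growth by blast
  then have C: "norm (real k ^ r) \<le> C * growth ^ k" for k by simp
  show "integrable M (\<lambda>\<omega>. real (block_len \<omega>) ^ r)"
    by (rule block_len_expectation(1)[where g="\<lambda>k. real k ^ r", OF C])
  show "(\<lambda>t. \<integral>as. real (exact_len t as) ^ r \<partial>measure_pmf (hash_addresses (m t) (n t))) \<longlonglongrightarrow>
    (\<integral>\<omega>. real (block_len \<omega>) ^ r \<partial>M)"
    by (rule exact_expectation_limit[where g="\<lambda>k. real k ^ r", OF C])
qed

end

end

theorem theorem10p9:
  fixes b :: nat and \<alpha> :: real
    and M :: "'a measure" and X :: "int \<Rightarrow> 'a \<Rightarrow> nat"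
    and N :: "'c measure" and Y :: "nat \<Rightarrow> 'c \<Rightarrow> nat"
    and B :: "'c \<Rightarrow> nat" and Bhat :: "'a \<Rightarrow> nat"
  assumes "b \<ge> 1" and "0 < \<alpha>" and "\<alpha> < 1"
    and "iid_poisson M UNIV X (\<alpha> * real b)"
    and "iid_poisson N {1..} Y (\<alpha> * real b)"
  defines "B \<equiv> (\<lambda>y. first_below b (\<lambda>i. Y i y))"
    and "Bhat \<equiv> (\<lambda>x. block_length (infinite_full b (\<lambda>i. X i x)) 0)"
  shows
    "(\<forall>k\<ge>1.
        measure M {x \<in> space M. Bhat x = k} =
          real k * measure N {y \<in> space N. B y = k} / (\<integral>y. real (B y) \<partial>N) \<and>
        complex_of_real (measure M {x \<in> space M. Bhat x = k}) =
          T0 b \<alpha> * of_nat k * of_real (measure N {y \<in> space N. B y = k}))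
     \<and>
     (\<forall>q. norm q < pgf_radius b \<alpha> \<longrightarrow>
        integrable M (\<lambda>x. q ^ Bhat x) \<and> integrable N (\<lambda>y. q ^ B y) \<and>
        pgf N B field_differentiable (at q) \<and>
        pgf M Bhat q = T0 b \<alpha> * q * deriv (pgf N B) q)
     \<and>
     (\<forall>U \<rho> q. open U \<and> \<rho> holomorphic_on U \<and> (\<forall>z\<in>U. \<rho> z ^ b = z) \<and>
        q \<in> U \<and> norm q < pgf_radius b \<alpha> \<longrightarrow>
        (\<forall>l<b. (\<lambda>z. zeta_br b \<alpha> l (\<rho> z)) field_differentiable (at q)) \<and>
        pgf M Bhat q =
          T0 b \<alpha> * q * (\<Sum>l<b. deriv (\<lambda>z. zeta_br b \<alpha> l (\<rho> z)) q *
            (\<Prod>j\<in>{..<b} - {l}. 1 - zeta_br b \<alpha> j (\<rho> q))))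
     \<and>
     (\<exists>\<delta>>0. \<forall>(m :: nat \<Rightarrow> nat) (n :: nat \<Rightarrow> nat) (v :: nat \<Rightarrow> nat).
        filterlim m at_top sequentially \<and> filterlim n at_top sequentially \<and>
        (\<forall>t. n t < b * m t) \<and> (\<forall>t. v t < m t) \<and>
        (\<lambda>t. real (n t) / (real b * real (m t))) \<longlonglongrightarrow> \<alpha> \<longrightarrow>
        (let P = (\<lambda>t. measure_pmf (hash_addresses (m t) (n t)));
             Bmn = (\<lambda>t as. block_length (exact_full b (m t) as) (int (v t)))
         in weak_conv_m (\<lambda>t. distr (P t) borel (\<lambda>as. real (Bmn t as)))
              (distr M borel (\<lambda>x. real (Bhat x))) \<and>
            (\<forall>r::nat. integrable M (\<lambda>x. real (Bhat x) ^ r) \<and>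
               (\<lambda>t. \<integral>as. real (Bmn t as) ^ r \<partial>P t) \<longlonglongrightarrow> (\<integral>x. real (Bhat x) ^ r \<partial>M)) \<and>
            uniform_limit (cball 0 (1 + \<delta>)) (\<lambda>t q. pgf (P t) (Bmn t) q) (pgf M Bhat) sequentially))"
proof -
  interpret L: poisson_load b \<alpha> by standard (use assms in auto)
  interpret I: infinite_model b \<alpha> M X by standard (use assms in auto)
  interpret P: passage_model b \<alpha> N Y by standard (use assms in auto)
  have B: "B = P.passage" by (simp add: B_def P.passage_def fun_eq_iff)
  have Bhat: "Bhat = I.block_len" by (simp add: Bhat_def I.block_len_def fun_eq_iff)
  have mean: "complex_of_real (\<integral>y. real (B y) \<partial>N) = 1 / T0 b \<alpha>" unfolding B by (rule P.passage_mean)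
  \<comment> \<open>\<open>T0\<close> is complex by definition; comparing embedded reals identifies
    p with the real number \<open>1 / E B\<close>.\<close>
  have p: "nonfull_prob b (\<alpha> * real b) = 1 / (\<integral>y. real (B y) \<partial>N)"
  proof -
    have "complex_of_real (nonfull_prob b (\<alpha> * real b)) = of_real (1 / (\<integral>y. real (B y) \<partial>N))"
      unfolding I.nonfull_prob_T0 of_real_divide mean by simp
    then show ?thesis by (simp only: of_real_eq_iff)
  qed
  have law: "measure M {x \<in> space M. Bhat x = k} =
      nonfull_prob b (\<alpha> * real b) * (real k * measure N {y \<in> space N. B y = k})" for k
    unfolding Bhat B I.prob_block_len P.prob_passage I.block_pmf_def by (simp only: mult_ac)
  show ?thesis
  proof (intro conjI, goal_cases)
    case 1
    show ?case
    proof (intro allI impI conjI)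
      fix k :: nat
      show "measure M {x \<in> space M. Bhat x = k} =
          real k * measure N {y \<in> space N. B y = k} / (\<integral>y. real (B y) \<partial>N)"
        unfolding law p by simp
      show "complex_of_real (measure M {x \<in> space M. Bhat x = k}) =
          T0 b \<alpha> * of_nat k * of_real (measure N {y \<in> space N. B y = k})"
        unfolding law of_real_mult I.nonfull_prob_T0 by simp
    qed
  next
    case 2
    show ?case
      unfolding Bhat B using I.block_len_pgf P.passage_pgf(1) P.passage_pgf_derivative by simp
  next
    case 3
    show ?case
    proof (intro allI impI, elim conjE)
      fix U \<rho> and q :: complex
      assume U: "open U" "\<rho> holomorphic_on U" "\<forall>z\<in>U. \<rho> z ^ b = z" and q: "q \<in> U" "norm q < pgf_radius b \<alpha>"
      show "(\<forall>l<b. (\<lambda>z. zeta_br b \<alpha> l (\<rho> z)) field_differentiable (at q)) \<and>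
        pgf M Bhat q = T0 b \<alpha> * q * (\<Sum>l<b. deriv (\<lambda>z. zeta_br b \<alpha> l (\<rho> z)) q *
          (\<Prod>j\<in>{..<b} - {l}. 1 - zeta_br b \<alpha> j (\<rho> q)))"
        unfolding Bhat I.block_len_pgf(2)[OF q(2)] L.pass_gf_branch(2)[OF U q]
        using L.pass_gf_branch(1)[OF U q] by blast
    qed
  next
    case 4
    show ?case
    \<comment> \<open>\<delta> has to be fixed before the sequences are given, which is possible
      because \<open>growth\<close> is built from b and \<alpha> alone.\<close>
    proof (rule exI[of _ "I.growth - 1"], intro conjI allI impI, goal_cases)
      case 1
      show ?case using I.growth by simp
    next
      case (2 m n v)
      then have h: "filterlim m at_top sequentially" "filterlim n at_top sequentially"
        "\<And>t. n t < b * m t" "(\<lambda>t. real (n t) / (real b * real (m t))) \<longlonglongrightarrow> \<alpha>" by blast+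
      have d: "1 + (I.growth - 1) = I.growth" by simp
      show ?case
        unfolding Let_def Bhat d
        using I.exact_weak_conv[OF h, of "\<lambda>t. int (v t)"] I.exact_moment_limit(1)[OF h]
          I.exact_moment_limit(2)[OF h, where v="\<lambda>t. int (v t)"]
          I.exact_pgf_uniform_limit[OF h, of "\<lambda>t. int (v t)"] by blast
    qed
  qed
qed

end
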